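(* The following are provable in $\mathbf{ZF}$: (i) $\mathbf{CMC}$ is equivalent to the statement: for every discrete topological space $\mathbf{X}$, the inclusion $U_{\aleph_0}(\mathbf{X})\subseteq U_{\aleph_0,MC}(\mathbf{X})$ holds. (ii) $\mathbf{CAC}$ is equivalent to the statement: for every discrete topological space $\mathbf{X}$, the inclusion $U_{\aleph_0}(\mathbf{X})\subseteq U_{\aleph_0,AC}(\mathbf{X})$ holds.
   Context: The base theory is $\mathbf{ZF}$ (no Axiom of Choice). A set is countable if it is equipotent to a subset of $\omega$, and denumerable if it is infinite and countable. $[A]^{<\omega}$ is the set of finite subsets of $A$. A choice function of a family $\{A_j:j\in J\}$ is an element of $\prod_{j\in J}A_j$; a multiple choice function of it is an element of $\prod_{j\in J}([A_j]^{<\omega}\setminus\{\emptyset\})$. $\mathbf{CAC}$: every denumerable family of non-empty sets has a choice function. $\mathbf{CMC}$: every denumerable family of non-empty sets has a multiple choice function. For a topological space $\mathbf{X}$ with underlying set $X$, $C(\mathbf{X})$ is the set of continuous functions $X\to\mathbb{R}$ ($\mathbb{R}$ with its natural topology), and for $A\subseteq X$, $f\in C(\mathbf{X})$, $\mathrm{osc}_A(f)=\sup\{|f(x)-f(y)|:x,y\in A\}$. - $U_{\aleph_0}(\mathbf{X})$ is the set of all $f\in C(\mathbf{X})$ such that for each $\varepsilon>0$ there is a countable cover $\mathcal{A}$ of $X$ by clopen subsets of $\mathbf{X}$ with $\mathrm{osc}_A(f)\le\varepsilon$ for all $A\in\mathcal{A}$. - $U_{\aleph_0,AC}(\mathbf{X})$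 (respectively $U_{\aleph_0,MC}(\mathbf{X})$) is the set of all $f\in C(\mathbf{X})$ such that for each $\varepsilon>0$ there is a cover $\mathcal{A}=\{A_j:j\in J\}$ of $X$ with $J$ countable, such that $\mathcal{A}$ is pairwise disjoint and has a choice function (respectively, a multiple choice function), and for every $j\in J$ the set $A_j$ is clopen in $\mathbf{X}$ and $\mathrm{osc}_{A_j}(f)\le\varepsilon$. *)

theory Defs
  imports Main
begin

text \<open>
  HOL itself proves the axiom of choice, so the claims ``provable in ZF'' are stated here about
  an explicit first-order theory: formulas over membership and equality, a natural deduction
  calculus for classical logic, and the axioms of ZF.
\<close>

section \<open>First-order logic over membership and equality\<close>

text \<open>Variables are de Bruijn indices; the language has no function symbols or constants.\<close>

datatype fm = FMem nat nat | FEq nat nat | FBot | FImp fm fm | FAll fm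

text \<open>Capture-free replacement of the free variables; variables are the only terms.\<close>

primrec ren :: "(nat \<Rightarrow> nat) \<Rightarrow> fm \<Rightarrow> fm" where
  "ren f (FMem i j) = FMem (f i) (f j)"
| "ren f (FEq i j) = FEq (f i) (f j)"
| "ren f FBot = FBot"
| "ren f (FImp p q) = FImp (ren f p) (ren f q)"
| "ren f (FAll p) = FAll (ren (case_nat 0 (Suc \<circ> f)) p)"

definition inst :: "nat \<Rightarrow> fm \<Rightarrow> fm" where
  "inst t p = ren (case_nat t id) p"

text \<open>
  Derivability from a set of axioms and a list of local assumptions. The axioms count as
  universally closed: an axiom may be used inside any context, and the premise of AllI only shifts
  the local assumptions (so that the generalised variable, index 0, is not free in them).
\<close>

inductive deriv :: "fm set \<Rightarrow> fm list \<Rightarrow> fm \<Rightarrow> bool" for T :: "fm set" where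
  Axiom: "p \<in> T \<Longrightarrow> deriv T G p"
| Assm: "p \<in> set G \<Longrightarrow> deriv T G p"
| ImpI: "deriv T (p # G) q \<Longrightarrow> deriv T G (FImp p q)"
| ImpE: "deriv T G (FImp p q) \<Longrightarrow> deriv T G p \<Longrightarrow> deriv T G q"
| Contr: "deriv T (FImp p FBot # G) FBot \<Longrightarrow> deriv T G p"
| AllI: "deriv T (map (ren Suc) G) p \<Longrightarrow> deriv T G (FAll p)"
| AllE: "deriv T G (FAll p) \<Longrightarrow> deriv T G (inst t p)"
| EqRefl: "deriv T G (FEq t t)"
| EqSubst: "deriv T G (FEq s t) \<Longrightarrow> deriv T G (inst s p) \<Longrightarrow> deriv T G (inst t p)"

definition provable :: "fm set \<Rightarrow> fm \<Rightarrow> bool" (infix "\<turnstile>" 50) where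
  "T \<turnstile> p \<longleftrightarrow> deriv T [] p"

section \<open>Writing formulas with named bound variables\<close>

text \<open>
  A schematic formula maps the number n of enclosing quantifiers to a formula. A bound variable
  is represented by its level, that is, the number of quantifiers around its binder; below n
  quantifiers the variable of level x has de Bruijn index \<open>n - Suc x\<close>.
\<close>

type_synonym var = nat
type_synonym form = "nat \<Rightarrow> fm"

definition sentence :: "form \<Rightarrow> fm" where
  "sentence p = p 0"

definition f_mem :: "var \<Rightarrow> var \<Rightarrow> form" (infix "\<^bold>\<in>" 50) where
  "(x \<^bold>\<in> y) = (\<lambda>n. FMem (n - Suc x) (n - Suc y))"

definition f_eq :: "var \<Rightarrow> var \<Rightarrow> form" (infix "\<^bold>=" 50) where
  "(x \<^bold>= y) = (\<lambda>n. FEq (n - Suc x) (n - Suc y))"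

definition f_imp :: "form \<Rightarrow> form \<Rightarrow> form" (infixr "\<^bold>\<longrightarrow>" 25) where
  "(p \<^bold>\<longrightarrow> q) = (\<lambda>n. FImp (p n) (q n))"

definition f_not :: "form \<Rightarrow> form" ("\<^bold>\<not> _" [40] 40) where
  "(\<^bold>\<not> p) = (\<lambda>n. FImp (p n) FBot)"

definition f_and :: "form \<Rightarrow> form \<Rightarrow> form" (infixr "\<^bold>\<and>" 35) where
  "(p \<^bold>\<and> q) = (\<^bold>\<not> (p \<^bold>\<longrightarrow> \<^bold>\<not> q))"

definition f_or :: "form \<Rightarrow> form \<Rightarrow> form" (infixr "\<^bold>\<or>" 30) where
  "(p \<^bold>\<or> q) = (\<^bold>\<not> p \<^bold>\<longrightarrow> q)"

definition f_iff :: "form \<Rightarrow> form \<Rightarrow> form" (infixr "\<^bold>\<longleftrightarrow>" 25) where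
  "(p \<^bold>\<longleftrightarrow> q) = ((p \<^bold>\<longrightarrow> q) \<^bold>\<and> (q \<^bold>\<longrightarrow> p))"

definition f_all :: "(var \<Rightarrow> form) \<Rightarrow> form" (binder "\<^bold>\<forall>" 10) where
  "(\<^bold>\<forall>x. P x) = (\<lambda>n. FAll (P n (Suc n)))"

definition f_ex :: "(var \<Rightarrow> form) \<Rightarrow> form" (binder "\<^bold>\<exists>" 10) where
  "(\<^bold>\<exists>x. P x) = (\<^bold>\<not> (\<^bold>\<forall>x. \<^bold>\<not> P x))"

definition f_ex1 :: "(var \<Rightarrow> form) \<Rightarrow> form" (binder "\<^bold>\<exists>\<^bold>!" 10) where
  "(\<^bold>\<exists>\<^bold>!x. P x) = (\<^bold>\<exists>x. P x \<^bold>\<and> (\<^bold>\<forall>y. P y \<^bold>\<longrightarrow> y \<^bold>= x))"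

text \<open>
  An arbitrary formula applied to one or two bound variables, for the axiom schemes. Its
  remaining free variables are parameters; they are shifted past all enclosing quantifiers.
\<close>

definition app1 :: "fm \<Rightarrow> var \<Rightarrow> form" where
  "app1 \<phi> x = (\<lambda>n. ren (case_nat (n - Suc x) (\<lambda>i. i + n)) \<phi>)"

definition app2 :: "fm \<Rightarrow> var \<Rightarrow> var \<Rightarrow> form" where
  "app2 \<phi> x y = (\<lambda>n. ren (case_nat (n - Suc x) (case_nat (n - Suc y) (\<lambda>i. i + n))) \<phi>)"

section \<open>The axioms of ZF\<close>

definition is_empty :: "var \<Rightarrow> form" where
  "is_empty x = (\<^bold>\<forall>z. \<^bold>\<not> z \<^bold>\<in> x)"

definition is_subset :: "var \<Rightarrow> var \<Rightarrow> form" (infix "\<^bold>\<subseteq>" 50) where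
  "(x \<^bold>\<subseteq> y) = (\<^bold>\<forall>z. z \<^bold>\<in> x \<^bold>\<longrightarrow> z \<^bold>\<in> y)"

definition is_succ :: "var \<Rightarrow> var \<Rightarrow> form" where
  "is_succ y x = (\<^bold>\<forall>z. z \<^bold>\<in> y \<^bold>\<longleftrightarrow> z \<^bold>\<in> x \<^bold>\<or> z \<^bold>= x)"

definition is_inductive :: "var \<Rightarrow> form" where
  "is_inductive w = ((\<^bold>\<exists>e. is_empty e \<^bold>\<and> e \<^bold>\<in> w) \<^bold>\<and>
     (\<^bold>\<forall>x. x \<^bold>\<in> w \<^bold>\<longrightarrow> (\<^bold>\<exists>y. is_succ y x \<^bold>\<and> y \<^bold>\<in> w)))"

definition extensionality :: form where
  "extensionality = (\<^bold>\<forall>x y. (\<^bold>\<forall>z. z \<^bold>\<in> x \<^bold>\<longleftrightarrow> z \<^bold>\<in> y) \<^bold>\<longrightarrow> x \<^bold>= y)"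

definition foundation :: form where
  "foundation = (\<^bold>\<forall>x. (\<^bold>\<exists>y. y \<^bold>\<in> x) \<^bold>\<longrightarrow> (\<^bold>\<exists>y. y \<^bold>\<in> x \<^bold>\<and> \<^bold>\<not> (\<^bold>\<exists>z. z \<^bold>\<in> x \<^bold>\<and> z \<^bold>\<in> y)))"

definition pairing :: form where
  "pairing = (\<^bold>\<forall>x y. \<^bold>\<exists>p. \<^bold>\<forall>z. z \<^bold>\<in> p \<^bold>\<longleftrightarrow> z \<^bold>= x \<^bold>\<or> z \<^bold>= y)"

definition union_axiom :: form where
  "union_axiom = (\<^bold>\<forall>x. \<^bold>\<exists>u. \<^bold>\<forall>z. z \<^bold>\<in> u \<^bold>\<longleftrightarrow> (\<^bold>\<exists>y. y \<^bold>\<in> x \<^bold>\<and> z \<^bold>\<in> y))"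

definition power_set :: form where
  "power_set = (\<^bold>\<forall>x. \<^bold>\<exists>p. \<^bold>\<forall>z. z \<^bold>\<in> p \<^bold>\<longleftrightarrow> z \<^bold>\<subseteq> x)"

definition infinity :: form where
  "infinity = (\<^bold>\<exists>w. is_inductive w)"

definition separation :: "fm \<Rightarrow> form" where
  "separation \<phi> = (\<^bold>\<forall>a. \<^bold>\<exists>b. \<^bold>\<forall>x. x \<^bold>\<in> b \<^bold>\<longleftrightarrow> x \<^bold>\<in> a \<^bold>\<and> app1 \<phi> x)"

definition replacement :: "fm \<Rightarrow> form" where
  "replacement \<phi> = (\<^bold>\<forall>a.
     (\<^bold>\<forall>x. x \<^bold>\<in> a \<^bold>\<longrightarrow> (\<^bold>\<forall>y z. app2 \<phi> x y \<^bold>\<and> app2 \<phi> x z \<^bold>\<longrightarrow> y \<^bold>= z)) \<^bold>\<longrightarrow>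
     (\<^bold>\<exists>b. \<^bold>\<forall>y. y \<^bold>\<in> b \<^bold>\<longleftrightarrow> (\<^bold>\<exists>x. x \<^bold>\<in> a \<^bold>\<and> app2 \<phi> x y)))"

definition ZF :: "fm set" where
  "ZF = sentence ` ({extensionality, foundation, pairing, union_axiom, power_set, infinity}
          \<union> range separation \<union> range replacement)"

section \<open>Functions, families and cardinality\<close>

definition is_upair :: "var \<Rightarrow> var \<Rightarrow> var \<Rightarrow> form" where
  "is_upair p x y = (\<^bold>\<forall>z. z \<^bold>\<in> p \<^bold>\<longleftrightarrow> z \<^bold>= x \<^bold>\<or> z \<^bold>= y)"

definition is_pair :: "var \<Rightarrow> var \<Rightarrow> var \<Rightarrow> form" where
  "is_pair p x y = (\<^bold>\<exists>a b. is_upair a x x \<^bold>\<and> is_upair b x y \<^bold>\<and> is_upair p a b)"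

text \<open>\<open>maps f x y\<close>: the pair (x, y) belongs to f; for a function f this is f(x) = y.\<close>

definition maps :: "var \<Rightarrow> var \<Rightarrow> var \<Rightarrow> form" where
  "maps f x y = (\<^bold>\<exists>p. is_pair p x y \<^bold>\<and> p \<^bold>\<in> f)"

definition fun_on :: "var \<Rightarrow> var \<Rightarrow> form" where
  "fun_on f A = ((\<^bold>\<forall>p. p \<^bold>\<in> f \<^bold>\<longrightarrow> (\<^bold>\<exists>x y. x \<^bold>\<in> A \<^bold>\<and> is_pair p x y)) \<^bold>\<and>
     (\<^bold>\<forall>x. x \<^bold>\<in> A \<^bold>\<longrightarrow> (\<^bold>\<exists>\<^bold>!y. maps f x y)))"

definition fun_into :: "var \<Rightarrow> var \<Rightarrow> var \<Rightarrow> form" where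
  "fun_into f A B = (fun_on f A \<^bold>\<and> (\<^bold>\<forall>x y. maps f x y \<^bold>\<longrightarrow> y \<^bold>\<in> B))"

definition is_bijection :: "var \<Rightarrow> var \<Rightarrow> var \<Rightarrow> form" where
  "is_bijection f A B = (fun_into f A B \<^bold>\<and> (\<^bold>\<forall>y. y \<^bold>\<in> B \<^bold>\<longrightarrow> (\<^bold>\<exists>\<^bold>!x. maps f x y)))"

definition equipotent :: "var \<Rightarrow> var \<Rightarrow> form" where
  "equipotent A B = (\<^bold>\<exists>f. is_bijection f A B)"

definition is_omega :: "var \<Rightarrow> form" where
  "is_omega w = (is_inductive w \<^bold>\<and> (\<^bold>\<forall>v. is_inductive v \<^bold>\<longrightarrow> w \<^bold>\<subseteq> v))"

definition is_finite :: "var \<Rightarrow> form" where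
  "is_finite A = (\<^bold>\<exists>w n. is_omega w \<^bold>\<and> n \<^bold>\<in> w \<^bold>\<and> equipotent A n)"

definition is_countable :: "var \<Rightarrow> form" where
  "is_countable A = (\<^bold>\<exists>w B. is_omega w \<^bold>\<and> B \<^bold>\<subseteq> w \<^bold>\<and> equipotent A B)"

definition is_denumerable :: "var \<Rightarrow> form" where
  "is_denumerable A = (\<^bold>\<not> is_finite A \<^bold>\<and> is_countable A)"

text \<open>A family indexed by J is a function F on J; \<open>maps F j a\<close> says that a is its j-th member.\<close>

definition choice_function :: "var \<Rightarrow> var \<Rightarrow> var \<Rightarrow> form" where
  "choice_function g J F = (fun_on g J \<^bold>\<and> (\<^bold>\<forall>j a x. maps F j a \<^bold>\<and> maps g j x \<^bold>\<longrightarrow> x \<^bold>\<in> a))"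

definition multiple_choice_function :: "var \<Rightarrow> var \<Rightarrow> var \<Rightarrow> form" where
  "multiple_choice_function g J F = (fun_on g J \<^bold>\<and>
     (\<^bold>\<forall>j a s. maps F j a \<^bold>\<and> maps g j s \<^bold>\<longrightarrow> s \<^bold>\<subseteq> a \<^bold>\<and> is_finite s \<^bold>\<and> \<^bold>\<not> is_empty s))"

definition has_choice :: "var \<Rightarrow> var \<Rightarrow> form" where
  "has_choice J F = (\<^bold>\<exists>g. choice_function g J F)"

definition has_multiple_choice :: "var \<Rightarrow> var \<Rightarrow> form" where
  "has_multiple_choice J F = (\<^bold>\<exists>g. multiple_choice_function g J F)"

definition denumerable_nonempty_family :: "var \<Rightarrow> var \<Rightarrow> form" where
  "denumerable_nonempty_family J F = (is_denumerable J \<^bold>\<and> fun_on F J \<^bold>\<and>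
     (\<^bold>\<forall>j a. maps F j a \<^bold>\<longrightarrow> \<^bold>\<not> is_empty a))"

definition CAC :: form where
  "CAC = (\<^bold>\<forall>J F. denumerable_nonempty_family J F \<^bold>\<longrightarrow> has_choice J F)"

definition CMC :: form where
  "CMC = (\<^bold>\<forall>J F. denumerable_nonempty_family J F \<^bold>\<longrightarrow> has_multiple_choice J F)"

section \<open>The real numbers\<close>

text \<open>
  As usual, the real numbers are specified up to isomorphism as a Dedekind-complete ordered
  field. A structure consists of (variables for) a carrier, the graphs of the two operations,
  the strict order as a set of pairs, and the two constants. ZF proves that such a field exists
  and is unique up to isomorphism, so \<open>for_the_reals\<close> introduces the reals by quantifying
  universally over all of them.
\<close>

record rstruct =
  rcarr :: var
  radd :: var
  rmul :: var
  rlt :: var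
  rzero :: var
  rone :: var

definition op_maps :: "var \<Rightarrow> var \<Rightarrow> var \<Rightarrow> var \<Rightarrow> form" where
  "op_maps f x y z = (\<^bold>\<exists>p. is_pair p x y \<^bold>\<and> maps f p z)"

definition binary_op :: "var \<Rightarrow> var \<Rightarrow> form" where
  "binary_op f R =
    ((\<^bold>\<forall>t. t \<^bold>\<in> f \<^bold>\<longrightarrow> (\<^bold>\<exists>p x y z. x \<^bold>\<in> R \<^bold>\<and> y \<^bold>\<in> R \<^bold>\<and> z \<^bold>\<in> R \<^bold>\<and> is_pair p x y \<^bold>\<and> is_pair t p z)) \<^bold>\<and>
     (\<^bold>\<forall>x y. x \<^bold>\<in> R \<^bold>\<and> y \<^bold>\<in> R \<^bold>\<longrightarrow> (\<^bold>\<exists>\<^bold>!z. op_maps f x y z)))"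

definition op_assoc :: "var \<Rightarrow> form" where
  "op_assoc f = (\<^bold>\<forall>x y z u v s t. op_maps f x y u \<^bold>\<and> op_maps f u z s \<^bold>\<and>
     op_maps f y z v \<^bold>\<and> op_maps f x v t \<^bold>\<longrightarrow> s \<^bold>= t)"

definition op_comm :: "var \<Rightarrow> form" where
  "op_comm f = (\<^bold>\<forall>x y u. op_maps f x y u \<^bold>\<longrightarrow> op_maps f y x u)"

definition op_neutral :: "var \<Rightarrow> var \<Rightarrow> var \<Rightarrow> form" where
  "op_neutral f R e = (e \<^bold>\<in> R \<^bold>\<and> (\<^bold>\<forall>x. x \<^bold>\<in> R \<^bold>\<longrightarrow> op_maps f x e x))"

definition is_field :: "rstruct \<Rightarrow> form" where
  "is_field \<R> =
    (binary_op (radd \<R>) (rcarr \<R>) \<^bold>\<and> op_assoc (radd \<R>) \<^bold>\<and> op_comm (radd \<R>) \<^bold>\<and>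
     op_neutral (radd \<R>) (rcarr \<R>) (rzero \<R>) \<^bold>\<and>
     (\<^bold>\<forall>x. x \<^bold>\<in> rcarr \<R> \<^bold>\<longrightarrow> (\<^bold>\<exists>y. y \<^bold>\<in> rcarr \<R> \<^bold>\<and> op_maps (radd \<R>) x y (rzero \<R>))) \<^bold>\<and>
     binary_op (rmul \<R>) (rcarr \<R>) \<^bold>\<and> op_assoc (rmul \<R>) \<^bold>\<and> op_comm (rmul \<R>) \<^bold>\<and>
     op_neutral (rmul \<R>) (rcarr \<R>) (rone \<R>) \<^bold>\<and>
     (\<^bold>\<forall>x. x \<^bold>\<in> rcarr \<R> \<^bold>\<and> \<^bold>\<not> x \<^bold>= rzero \<R> \<^bold>\<longrightarrow>
        (\<^bold>\<exists>y. y \<^bold>\<in> rcarr \<R> \<^bold>\<and> op_maps (rmul \<R>) x y (rone \<R>))) \<^bold>\<and>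
     (\<^bold>\<forall>x y z s t u v w. op_maps (radd \<R>) y z s \<^bold>\<and> op_maps (rmul \<R>) x s t \<^bold>\<and>
        op_maps (rmul \<R>) x y u \<^bold>\<and> op_maps (rmul \<R>) x z v \<^bold>\<and> op_maps (radd \<R>) u v w \<^bold>\<longrightarrow> t \<^bold>= w) \<^bold>\<and>
     \<^bold>\<not> rzero \<R> \<^bold>= rone \<R>)"

definition rless :: "rstruct \<Rightarrow> var \<Rightarrow> var \<Rightarrow> form" where
  "rless \<R> x y = maps (rlt \<R>) x y"

definition rleq :: "rstruct \<Rightarrow> var \<Rightarrow> var \<Rightarrow> form" where
  "rleq \<R> x y = (rless \<R> x y \<^bold>\<or> x \<^bold>= y)"

definition ordered_field :: "rstruct \<Rightarrow> form" where
  "ordered_field \<R> =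
    (is_field \<R> \<^bold>\<and>
     (\<^bold>\<forall>p. p \<^bold>\<in> rlt \<R> \<^bold>\<longrightarrow> (\<^bold>\<exists>x y. x \<^bold>\<in> rcarr \<R> \<^bold>\<and> y \<^bold>\<in> rcarr \<R> \<^bold>\<and> is_pair p x y)) \<^bold>\<and>
     (\<^bold>\<forall>x. \<^bold>\<not> rless \<R> x x) \<^bold>\<and>
     (\<^bold>\<forall>x y z. rless \<R> x y \<^bold>\<and> rless \<R> y z \<^bold>\<longrightarrow> rless \<R> x z) \<^bold>\<and>
     (\<^bold>\<forall>x y. x \<^bold>\<in> rcarr \<R> \<^bold>\<and> y \<^bold>\<in> rcarr \<R> \<^bold>\<longrightarrow> rless \<R> x y \<^bold>\<or> x \<^bold>= y \<^bold>\<or> rless \<R> y x) \<^bold>\<and>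
     (\<^bold>\<forall>x y z s t. rless \<R> x y \<^bold>\<and> op_maps (radd \<R>) x z s \<^bold>\<and> op_maps (radd \<R>) y z t \<^bold>\<longrightarrow>
        rless \<R> s t) \<^bold>\<and>
     (\<^bold>\<forall>x y t. rless \<R> (rzero \<R>) x \<^bold>\<and> rless \<R> (rzero \<R>) y \<^bold>\<and> op_maps (rmul \<R>) x y t \<^bold>\<longrightarrow>
        rless \<R> (rzero \<R>) t))"

text \<open>\<open>is_lub \<R> P s\<close>: s is the supremum in the ordered field of all elements satisfying P.\<close>

definition is_lub :: "rstruct \<Rightarrow> (var \<Rightarrow> form) \<Rightarrow> var \<Rightarrow> form" where
  "is_lub \<R> P s = (s \<^bold>\<in> rcarr \<R> \<^bold>\<and> (\<^bold>\<forall>d. P d \<^bold>\<longrightarrow> rleq \<R> d s) \<^bold>\<and>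
     (\<^bold>\<forall>u. u \<^bold>\<in> rcarr \<R> \<^bold>\<and> (\<^bold>\<forall>d. P d \<^bold>\<longrightarrow> rleq \<R> d u) \<^bold>\<longrightarrow> rleq \<R> s u))"

definition complete_ordered_field :: "rstruct \<Rightarrow> form" where
  "complete_ordered_field \<R> = (ordered_field \<R> \<^bold>\<and>
     (\<^bold>\<forall>S. S \<^bold>\<subseteq> rcarr \<R> \<^bold>\<and> \<^bold>\<not> is_empty S \<^bold>\<and>
        (\<^bold>\<exists>u. u \<^bold>\<in> rcarr \<R> \<^bold>\<and> (\<^bold>\<forall>d. d \<^bold>\<in> S \<^bold>\<longrightarrow> rleq \<R> d u)) \<^bold>\<longrightarrow>
        (\<^bold>\<exists>s. is_lub \<R> (\<lambda>d. d \<^bold>\<in> S) s)))"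

definition for_the_reals :: "(rstruct \<Rightarrow> form) \<Rightarrow> form" where
  "for_the_reals P = (\<^bold>\<forall>R a m l z e.
     let \<R> = \<lparr>rcarr = R, radd = a, rmul = m, rlt = l, rzero = z, rone = e\<rparr>
     in complete_ordered_field \<R> \<^bold>\<longrightarrow> P \<R>)"

text \<open>\<open>abs_diff \<R> x y d\<close>: d = |x - y|.\<close>

definition abs_diff :: "rstruct \<Rightarrow> var \<Rightarrow> var \<Rightarrow> var \<Rightarrow> form" where
  "abs_diff \<R> x y d = (\<^bold>\<exists>u. op_maps (radd \<R>) y u x \<^bold>\<and>
     (rleq \<R> (rzero \<R>) u \<^bold>\<and> d \<^bold>= u \<^bold>\<or>
      rless \<R> u (rzero \<R>) \<^bold>\<and> op_maps (radd \<R>) u d (rzero \<R>)))"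

section \<open>Topological spaces and continuous real functions\<close>

definition is_union :: "var \<Rightarrow> var \<Rightarrow> form" where
  "is_union u S = (\<^bold>\<forall>x. x \<^bold>\<in> u \<^bold>\<longleftrightarrow> (\<^bold>\<exists>U. U \<^bold>\<in> S \<^bold>\<and> x \<^bold>\<in> U))"

definition is_inter :: "var \<Rightarrow> var \<Rightarrow> var \<Rightarrow> form" where
  "is_inter w U V = (\<^bold>\<forall>x. x \<^bold>\<in> w \<^bold>\<longleftrightarrow> x \<^bold>\<in> U \<^bold>\<and> x \<^bold>\<in> V)"

definition is_diff :: "var \<Rightarrow> var \<Rightarrow> var \<Rightarrow> form" where
  "is_diff w U V = (\<^bold>\<forall>x. x \<^bold>\<in> w \<^bold>\<longleftrightarrow> x \<^bold>\<in> U \<^bold>\<and> \<^bold>\<not> x \<^bold>\<in> V)"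

definition topological_space :: "var \<Rightarrow> var \<Rightarrow> form" where
  "topological_space X T =
    ((\<^bold>\<forall>U. U \<^bold>\<in> T \<^bold>\<longrightarrow> U \<^bold>\<subseteq> X) \<^bold>\<and>
     X \<^bold>\<in> T \<^bold>\<and> (\<^bold>\<forall>U. is_empty U \<^bold>\<longrightarrow> U \<^bold>\<in> T) \<^bold>\<and>
     (\<^bold>\<forall>S U. S \<^bold>\<subseteq> T \<^bold>\<and> is_union U S \<^bold>\<longrightarrow> U \<^bold>\<in> T) \<^bold>\<and>
     (\<^bold>\<forall>U V W. U \<^bold>\<in> T \<^bold>\<and> V \<^bold>\<in> T \<^bold>\<and> is_inter W U V \<^bold>\<longrightarrow> W \<^bold>\<in> T))"

definition discrete_space :: "var \<Rightarrow> var \<Rightarrow> form" where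
  "discrete_space X T = (topological_space X T \<^bold>\<and> (\<^bold>\<forall>U. U \<^bold>\<subseteq> X \<^bold>\<longrightarrow> U \<^bold>\<in> T))"

definition clopen :: "var \<Rightarrow> var \<Rightarrow> var \<Rightarrow> form" where
  "clopen X T A = (A \<^bold>\<in> T \<^bold>\<and> (\<^bold>\<exists>B. is_diff B X A \<^bold>\<and> B \<^bold>\<in> T))"

definition real_open :: "rstruct \<Rightarrow> var \<Rightarrow> form" where
  "real_open \<R> V = (V \<^bold>\<subseteq> rcarr \<R> \<^bold>\<and>
     (\<^bold>\<forall>x. x \<^bold>\<in> V \<^bold>\<longrightarrow> (\<^bold>\<exists>e. rless \<R> (rzero \<R>) e \<^bold>\<and>
        (\<^bold>\<forall>y d. abs_diff \<R> x y d \<^bold>\<and> rless \<R> d e \<^bold>\<longrightarrow> y \<^bold>\<in> V))))"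

definition is_preimage :: "var \<Rightarrow> var \<Rightarrow> var \<Rightarrow> form" where
  "is_preimage U f V = (\<^bold>\<forall>x. x \<^bold>\<in> U \<^bold>\<longleftrightarrow> (\<^bold>\<exists>y. maps f x y \<^bold>\<and> y \<^bold>\<in> V))"

definition is_continuous :: "rstruct \<Rightarrow> var \<Rightarrow> var \<Rightarrow> var \<Rightarrow> form" where
  "is_continuous \<R> X T f = (fun_into f X (rcarr \<R>) \<^bold>\<and>
     (\<^bold>\<forall>V U. real_open \<R> V \<^bold>\<and> is_preimage U f V \<^bold>\<longrightarrow> U \<^bold>\<in> T))"

text \<open>
  \<open>osc_le \<R> f A e\<close>: the oscillation of f on A is at most e, for e > 0. The supremum is taken in
  the extended reals: an unbounded set of values has no supremum in the field, so the
  second disjunct then fails; the oscillation on the empty set never exceeds a positive e.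
\<close>

definition osc_le :: "rstruct \<Rightarrow> var \<Rightarrow> var \<Rightarrow> var \<Rightarrow> form" where
  "osc_le \<R> f A e = (is_empty A \<^bold>\<or>
     (\<^bold>\<exists>s. is_lub \<R> (\<lambda>d. \<^bold>\<exists>x y u v. x \<^bold>\<in> A \<^bold>\<and> y \<^bold>\<in> A \<^bold>\<and> maps f x u \<^bold>\<and> maps f y v \<^bold>\<and>
                        abs_diff \<R> u v d) s \<^bold>\<and> rleq \<R> s e))"

section \<open>The classes of functions\<close>

definition U_aleph0 :: "rstruct \<Rightarrow> var \<Rightarrow> var \<Rightarrow> var \<Rightarrow> form" where
  "U_aleph0 \<R> X T f = (is_continuous \<R> X T f \<^bold>\<and>
     (\<^bold>\<forall>e. rless \<R> (rzero \<R>) e \<^bold>\<longrightarrow>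
       (\<^bold>\<exists>C. is_countable C \<^bold>\<and> is_union X C \<^bold>\<and>
          (\<^bold>\<forall>A. A \<^bold>\<in> C \<^bold>\<longrightarrow> clopen X T A \<^bold>\<and> osc_le \<R> f A e))))"

definition covers :: "var \<Rightarrow> var \<Rightarrow> form" where
  "covers F X = (\<^bold>\<forall>x. x \<^bold>\<in> X \<^bold>\<longleftrightarrow> (\<^bold>\<exists>j a. maps F j a \<^bold>\<and> x \<^bold>\<in> a))"

definition pairwise_disjoint :: "var \<Rightarrow> form" where
  "pairwise_disjoint F = (\<^bold>\<forall>i j a b. maps F i a \<^bold>\<and> maps F j b \<^bold>\<and> \<^bold>\<not> i \<^bold>= j \<^bold>\<longrightarrow>
     \<^bold>\<not> (\<^bold>\<exists>x. x \<^bold>\<in> a \<^bold>\<and> x \<^bold>\<in> b))"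

definition U_disjoint :: "(var \<Rightarrow> var \<Rightarrow> form) \<Rightarrow> rstruct \<Rightarrow> var \<Rightarrow> var \<Rightarrow> var \<Rightarrow> form" where
  "U_disjoint has_selection \<R> X T f = (is_continuous \<R> X T f \<^bold>\<and>
     (\<^bold>\<forall>e. rless \<R> (rzero \<R>) e \<^bold>\<longrightarrow>
       (\<^bold>\<exists>J F. is_countable J \<^bold>\<and> fun_on F J \<^bold>\<and> covers F X \<^bold>\<and> pairwise_disjoint F \<^bold>\<and>
          has_selection J F \<^bold>\<and>
          (\<^bold>\<forall>j a. maps F j a \<^bold>\<longrightarrow> clopen X T a \<^bold>\<and> osc_le \<R> f a e))))"

definition U_aleph0_AC :: "rstruct \<Rightarrow> var \<Rightarrow> var \<Rightarrow> var \<Rightarrow> form" where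
  "U_aleph0_AC = U_disjoint has_choice"

definition U_aleph0_MC :: "rstruct \<Rightarrow> var \<Rightarrow> var \<Rightarrow> var \<Rightarrow> form" where
  "U_aleph0_MC = U_disjoint has_multiple_choice"

end

theory Submission
  imports Defs "HOL-Library.Countable_Set"
begin

text \<open>
  By the completeness theorem for the calculus, proved by a Henkin construction, it suffices to
  argue inside an arbitrary model of ZF over the natural numbers; separation applies there to every
  predicate that is definable with parameters.

  Given countable (multiple) choice, a countable clopen cover of a discrete space is made disjoint
  by removing from each member those that come earlier in an enumeration, and a choice for the
  non-empty differences is supplied by the axiom. Conversely, for a denumerable family of non-empty
  sets let f map the member of index j in the disjoint union to the term of index j of a sequence
  of reals whose terms are more than e apart. Every set on which f oscillates by at most e lies in
  one summand, so a selection for a disjoint countable cover by such sets yields one for the family.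
\<close>

section \<open>Completeness of the calculus\<close>

text \<open>Arguing in models replaces formal derivations, but HOL has choice and a model of ZF need
  not. What shapes the proof is keeping the two apart: each set or function of a model comes from
  separation applied to a predicate whose definability is proved, and a function only from a
  relation that is already single-valued. The natural numbers of a model may be non-standard, so
  induction is likewise limited to definable predicates, and its reals are known only through the
  laws they satisfy inside it. The same concern fixes the constructions. Removing earlier members
  from a cover is canonical, which leaves a single appeal to the axiom for each bound. In the
  converse, a block of the disjoint union may be met by many pieces of the cover; picking one piece
  per block would be the very choice at issue, and the enumeration of the pieces is there to make
  that pick definable. The sequence of reals consists of the multiples of c = e + e for some
  positive e: distinct multiples differ by at least c, which exceeds e.\<close>

primrec push :: "'a \<Rightarrow> (nat \<Rightarrow> 'a) \<Rightarrow> nat \<Rightarrow> 'a" where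
  "push x e 0 = x"
| "push x e (Suc i) = e i"

lemma case_nat_eq_push: "case_nat x e = push x e"
  by (simp add: fun_eq_iff split: nat.split)

lemma push_eqI: "f 0 = x \<Longrightarrow> (\<And>i. f (Suc i) = e i) \<Longrightarrow> f = push x e"
proof (rule ext)
  fix i assume "f 0 = x" "\<And>i. f (Suc i) = e i"
  then show "f i = push x e i" by (cases i) simp_all
qed

text \<open>The renaming f carried under one quantifier, whose bound variable is index 0. It recasts
  the \<open>case_nat\<close> in the last clause of \<open>ren\<close> in a form that simp can
  compute with.\<close>

definition lift :: "(nat \<Rightarrow> nat) \<Rightarrow> nat \<Rightarrow> nat" where
  "lift f = push 0 (\<lambda>i. Suc (f i))"

lemma lift_simps [simp]: "lift f 0 = 0" "lift f (Suc i) = Suc (f i)"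
  by (simp_all add: lift_def)

lemma ren_FAll [simp]: "ren f (FAll p) = FAll (ren (lift f) p)"
  by (simp add: lift_def case_nat_eq_push comp_def)

declare ren.simps(5) [simp del]

lemma push_lift [simp]: "(\<lambda>i. push x e (lift f i)) = push x (\<lambda>i. e (f i))"
  by (rule push_eqI) simp_all

lemma lift_comp [simp]: "(\<lambda>i. lift f (lift g i)) = lift (\<lambda>i. f (g i))"
  by (subst (3) lift_def, rule push_eqI) simp_all

lemma lift_ident [simp]: "lift (\<lambda>i. i) = (\<lambda>i. i)"
  unfolding lift_def by (rule push_eqI[symmetric]) simp_all

lemma ren_ren: "ren f (ren g p) = ren (\<lambda>i. f (g i)) p"
  by (induction p arbitrary: f g) simp_all

lemma ren_ident [simp]: "ren (\<lambda>i. i) p = p"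
  by (induction p) simp_all

lemma inst_eq: "inst t p = ren (push t (\<lambda>i. i)) p"
  by (simp add: inst_def case_nat_eq_push id_def)

text \<open>Fuses an instantiation and a renaming into one renaming by \<open>push t f\<close>. This
  mirrors the environment \<open>push x e\<close> in the quantifier clause of \<open>sat\<close>,
  and the truth lemma for the term model rests on that match.\<close>

lemma inst_ren_lift: "inst t (ren (lift f) p) = ren (push t f) p"
  by (simp add: inst_eq ren_ren)

lemma ren_inst: "ren f (inst t p) = inst (f t) (ren (lift f) p)"
proof -
  have "(\<lambda>i. f (push t (\<lambda>i. i) i)) = push (f t) f" by (rule push_eqI) simp_all
  then show ?thesis unfolding inst_ren_lift by (simp add: inst_eq ren_ren)
qed

lemma ren_Suc_lift: "ren (lift f) (ren Suc p) = ren Suc (ren f p)"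
  by (simp add: ren_ren)

text \<open>No free variable of p has index n or more, expressed through its use: renamings that
  agree below n act alike on p.\<close>

definition fresh_from :: "nat \<Rightarrow> fm \<Rightarrow> bool" where
  "fresh_from n p \<longleftrightarrow> (\<forall>f g. (\<forall>i<n. f i = g i) \<longrightarrow> ren f p = ren g p)"

lemma fresh_fromD: "fresh_from n p \<Longrightarrow> (\<And>i. i < n \<Longrightarrow> f i = g i) \<Longrightarrow> ren f p = ren g p"
  by (simp add: fresh_from_def)

lemma fresh_from_mono: "fresh_from n p \<Longrightarrow> n \<le> m \<Longrightarrow> fresh_from m p"
  by (auto simp: fresh_from_def)

lemma ex_fresh_from: "\<exists>n. fresh_from n p"
proof (induction p)
  case (FMem i j)
  show ?case by (rule exI[of _ "Suc (max i j)"]) (auto simp: fresh_from_def)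
next
  case (FEq i j)
  show ?case by (rule exI[of _ "Suc (max i j)"]) (auto simp: fresh_from_def)
next
  case FBot
  show ?case by (auto simp: fresh_from_def)
next
  case (FImp p q)
  then obtain n m where n: "fresh_from n p" "fresh_from m q" by blast
  have "fresh_from (max n m) p" "fresh_from (max n m) q"
    using n by (auto intro: fresh_from_mono)
  then have "fresh_from (max n m) (FImp p q)"
    unfolding fresh_from_def by (metis ren.simps(4))
  then show ?case by blast
next
  case (FAll p)
  then obtain n where n: "fresh_from n p" by blast
  have "fresh_from n (FAll p)"
    unfolding fresh_from_def
  proof (intro allI impI)
    fix f g :: "nat \<Rightarrow> nat" assume "\<forall>i<n. f i = g i"
    then have "lift f i = lift g i" if "i < n" for i using that by (cases i) simp_all
    then have "ren (lift f) p = ren (lift g) p" by (rule fresh_fromD[OF n])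
    then show "ren f (FAll p) = ren g (FAll p)" by simp
  qed
  then show ?case by blast
qed

lemma ex_fresh_from_set: "finite A \<Longrightarrow> \<exists>n. \<forall>p\<in>A. fresh_from n p"
proof (induction A rule: finite_induct)
  case (insert p A)
  obtain n m where "\<forall>q\<in>A. fresh_from n q" "fresh_from m p"
    using insert ex_fresh_from by blast
  then have "\<forall>q\<in>insert p A. fresh_from (max n m) q" by (auto intro: fresh_from_mono)
  then show ?case by blast
qed simp

section \<open>Admissible rules: weakening, renaming, generalisation over a fresh variable\<close>

lemma deriv_weaken: "deriv T G p \<Longrightarrow> set G \<subseteq> set H \<Longrightarrow> deriv T H p"
proof (induction arbitrary: H rule: deriv.induct)
  case (ImpI p G q)
  have "deriv T (p # H) q" by (rule ImpI.IH) (use ImpI.prems in auto)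
  then show ?case by (rule deriv.ImpI)
next
  case (Contr p G)
  have "deriv T (FImp p FBot # H) FBot" by (rule Contr.IH) (use Contr.prems in auto)
  then show ?case by (rule deriv.Contr)
next
  case (AllI G p)
  have "deriv T (map (ren Suc) H) p" by (rule AllI.IH) (use AllI.prems in auto)
  then show ?case by (rule deriv.AllI)
next
  case (EqSubst G s t p)
  from EqSubst.IH(1)[OF EqSubst.prems] EqSubst.IH(2)[OF EqSubst.prems] show ?case
    by (rule deriv.EqSubst)
qed (auto intro: deriv.intros)

text \<open>Each of the n outer quantifiers is instantiated by \<open>AllE\<close>. The stripped
  variables receive the values of h below n, all others move down by n, whence the condition on
  h.\<close>

lemma deriv_instances:
  assumes "deriv T [] ((FAll ^^ n) p)" "\<forall>i. h (i + n) = i"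
  shows "deriv T [] (ren h p)"
  using assms
proof (induction n arbitrary: p h)
  case 0
  then have "h = (\<lambda>i. i)" by (simp add: fun_eq_iff)
  with 0(1) show ?case by simp
next
  case (Suc n)
  have "deriv T [] (ren (\<lambda>i. h (Suc i)) (FAll p))"
    by (rule Suc.IH) (use Suc.prems in \<open>simp_all add: funpow_swap1\<close>)
  then have "deriv T [] (inst (h 0) (ren (lift (\<lambda>i. h (Suc i))) p))"
    by (auto intro: AllE)
  moreover have "push (h 0) (\<lambda>i. h (Suc i)) = h" by (rule push_eqI[symmetric]) simp_all
  ultimately show ?case by (simp add: inst_ren_lift)
qed

text \<open>An axiom counts as universally closed: in the empty context it can be generalised as
  often as needed and then instantiated at will.\<close>

lemma deriv_axiom_instance:
  assumes "p \<in> T"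
  shows "deriv T G (ren f p)"
proof -
  obtain n where n: "fresh_from n p" using ex_fresh_from by blast
  \<comment> \<open>Beyond n the renaming has to undo the n quantifiers, so f is replaced there by
    \<open>i - n\<close>; p has no free variable in that range and does not notice.\<close>
  have "deriv T [] ((FAll ^^ k) p)" for k
    by (induction k) (auto intro: deriv.Axiom deriv.AllI assms)
  then have "deriv T [] (ren (\<lambda>i. if i < n then f i else i - n) p)"
    by (rule deriv_instances[of _ n]) simp
  moreover have "ren (\<lambda>i. if i < n then f i else i - n) p = ren f p"
    using n unfolding fresh_from_def by simp
  ultimately show ?thesis by (auto intro: deriv_weaken)
qed

text \<open>The rules commute with renamings. The case that needs an argument is an axiom with free
  variables, since its renaming need not belong to T.\<close>

lemma deriv_ren: "deriv T G p \<Longrightarrow> deriv T (map (ren f) G) (ren f p)"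
proof (induction arbitrary: f rule: deriv.induct)
  case (Axiom p G)
  then show ?case by (rule deriv_axiom_instance)
next
  case (Assm p G)
  then show ?case by (auto intro: deriv.Assm)
next
  case (ImpI p G q)
  then show ?case by (auto intro: deriv.ImpI)
next
  case (ImpE G p q)
  from ImpE.IH[of f] show ?case by (auto intro: deriv.ImpE)
next
  case (Contr p G)
  from Contr.IH[of f] show ?case by (auto intro: deriv.Contr)
next
  case (AllI G p)
  from AllI.IH[of "lift f"]
  have "deriv T (map (ren Suc) (map (ren f) G)) (ren (lift f) p)"
    by (simp add: comp_def ren_Suc_lift)
  then have "deriv T (map (ren f) G) (FAll (ren (lift f) p))" by (rule deriv.AllI)
  then show ?case by simp
next
  case (AllE G p t)
  from AllE.IH[of f] show ?case unfolding ren_inst ren_FAll by (rule deriv.AllE)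
next
  case (EqRefl G t)
  show ?case by (auto intro: deriv.EqRefl)
next
  case (EqSubst G s t p)
  from EqSubst.IH(1)[of f] EqSubst.IH(2)[of f] show ?case
    unfolding ren_inst ren.simps by (rule deriv.EqSubst)
qed

lemma deriv_FBotE: "deriv T G FBot \<Longrightarrow> deriv T G p"
  by (rule Contr) (auto intro: deriv_weaken)

text \<open>The eigenvariable rule: \<open>AllI\<close> speaks of index 0 and shifted assumptions,
  whereas here a variable t is fresh without any shift.\<close>

lemma deriv_generalise:
  assumes d: "deriv T G (inst t r)"
    and G: "\<forall>p\<in>set G. fresh_from t p" and r: "fresh_from (Suc t) r"
  shows "deriv T G (FAll r)"
proof -
  \<comment> \<open>f moves t to index 0 and shifts every other variable, so it turns the instance
    at t back into r and acts on G as the shift required by \<open>AllI\<close>.\<close>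
  define f where "f i = (if i = t then 0 else Suc i)" for i
  have "deriv T (map (ren f) G) (ren f (inst t r))" using d by (rule deriv_ren)
  moreover have "map (ren f) G = map (ren Suc) G"
    using G unfolding fresh_from_def by (simp add: f_def)
  moreover have "ren f (inst t r) = r"
  proof -
    have "f (push t (\<lambda>i. i) i) = i" if "i < Suc t" for i
      using that by (cases i) (simp_all add: f_def)
    then have "ren (\<lambda>i. f (push t (\<lambda>i. i) i)) r = ren (\<lambda>i. i) r"
      by (rule fresh_fromD[OF r])
    then show ?thesis by (simp add: inst_eq ren_ren)
  qed
  ultimately show ?thesis by (auto intro: AllI)
qed

lemma consistent_witness:
  assumes c: "\<not> deriv T (FImp (FAll r) FBot # G) FBot"
  shows "\<exists>t. \<not> deriv T (FImp (inst t r) FBot # FImp (FAll r) FBot # G) FBot"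
proof -
  let ?H = "FImp (FAll r) FBot # G"
  obtain t where "\<forall>p\<in>set (r # ?H). fresh_from t p"
    using ex_fresh_from_set[OF finite_set] by blast
  then have t: "\<forall>p\<in>set ?H. fresh_from t p" "fresh_from (Suc t) r"
    by (auto intro: fresh_from_mono)
  have "\<not> deriv T (FImp (inst t r) FBot # ?H) FBot"
  proof
    assume "deriv T (FImp (inst t r) FBot # ?H) FBot"
    then have "deriv T ?H (inst t r)" by (rule Contr)
    then have "deriv T ?H (FAll r)" by (rule deriv_generalise) (use t in auto)
    moreover have "deriv T ?H (FImp (FAll r) FBot)" by (rule Assm) simp
    ultimately have "deriv T ?H FBot" by (blast intro: ImpE)
    with c show False ..
  qed
  then show ?thesis by blast
qed

section \<open>The Henkin theory\<close>

instance fm :: countable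
  by countable_datatype

text \<open>Adopting the negation of a universal formula also adopts a counterexample; by
  \<open>consistent_witness\<close> the chosen t keeps the list consistent whenever it was so
  before.\<close>

fun witnessed :: "fm set \<Rightarrow> fm \<Rightarrow> fm list \<Rightarrow> fm list" where
  "witnessed T (FImp (FAll r) FBot) G =
     FImp (inst (SOME t. \<not> deriv T (FImp (inst t r) FBot # FImp (FAll r) FBot # G) FBot) r) FBot
       # FImp (FAll r) FBot # G"
| "witnessed T p G = p # G"

lemma witnessed_subset: "insert p (set G) \<subseteq> set (witnessed T p G)"
  by (cases "(T, p, G)" rule: witnessed.cases) auto

lemma witnessed_consistent:
  "\<not> deriv T (p # G) FBot \<Longrightarrow> \<not> deriv T (witnessed T p G) FBot"
proof (cases "(T, p, G)" rule: witnessed.cases)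
  case (1 T' r G')
  assume "\<not> deriv T (p # G) FBot"
  with 1 have "\<exists>t. \<not> deriv T (FImp (inst t r) FBot # FImp (FAll r) FBot # G) FBot"
    by (intro consistent_witness) simp
  from someI_ex[OF this] 1 show ?thesis by simp
qed auto

text \<open>Stage n decides the n-th formula. The stages are lists, hence finite, which is what
  keeps a fresh variable available for each witness.\<close>

primrec henkin_chain :: "fm set \<Rightarrow> fm \<Rightarrow> nat \<Rightarrow> fm list" where
  "henkin_chain T q 0 = [FImp q FBot]"
| "henkin_chain T q (Suc n) =
    (let p = from_nat n; G = henkin_chain T q n
     in if deriv T (p # G) FBot then G else witnessed T p G)"

lemma henkin_chain_mono: "n \<le> m \<Longrightarrow> set (henkin_chain T q n) \<subseteq> set (henkin_chain T q m)"
proof (induction m rule: dec_induct)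
  case (step m)
  then show ?case using witnessed_subset by (fastforce simp: Let_def)
qed simp

definition henkin_theory :: "fm set \<Rightarrow> fm \<Rightarrow> fm set" where
  "henkin_theory T q = {p. \<exists>n. deriv T (henkin_chain T q n) p}"

lemma henkin_chain_consistent:
  assumes "\<not> T \<turnstile> q"
  shows "\<not> deriv T (henkin_chain T q n) FBot"
proof (induction n)
  case 0
  then show ?case using assms Contr unfolding provable_def by auto
next
  case (Suc n)
  then show ?case using witnessed_consistent by (auto simp: Let_def)
qed

lemma henkin_theory_2:
  assumes "p \<in> henkin_theory T q" "r \<in> henkin_theory T q"
  obtains n where "deriv T (henkin_chain T q n) p" "deriv T (henkin_chain T q n) r"
proof -
  obtain n m where "deriv T (henkin_chain T q n) p" "deriv T (henkin_chain T q m) r"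
    using assms unfolding henkin_theory_def by blast
  then have "deriv T (henkin_chain T q (max n m)) p" "deriv T (henkin_chain T q (max n m)) r"
    using henkin_chain_mono by (meson deriv_weaken max.cobounded1 max.cobounded2)+
  then show ?thesis by (rule that)
qed

lemma henkin_theory_mp:
  "FImp p r \<in> henkin_theory T q \<Longrightarrow> p \<in> henkin_theory T q \<Longrightarrow> r \<in> henkin_theory T q"
  by (erule henkin_theory_2, assumption) (auto simp: henkin_theory_def intro: ImpE)

context
  fixes T :: "fm set" and q :: fm
  assumes unprovable: "\<not> T \<turnstile> q"
begin

private abbreviation (input) "Th \<equiv> henkin_theory T q"

lemma FBot_notin_henkin_theory: "FBot \<notin> Th"
  using henkin_chain_consistent[OF unprovable] by (auto simp: henkin_theory_def)

text \<open>The formula p is treated at stage \<open>to_nat p\<close>: either it is inconsistent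
  with that stage, or it is adopted together with its witness.\<close>

lemma henkin_theory_step:
  "FImp p FBot \<in> Th \<or> set (witnessed T p (henkin_chain T q (to_nat p))) \<subseteq> Th"
proof (cases "deriv T (p # henkin_chain T q (to_nat p)) FBot")
  case True
  then have "FImp p FBot \<in> Th" by (auto simp: henkin_theory_def intro: ImpI)
  then show ?thesis ..
next
  case False
  then have "henkin_chain T q (Suc (to_nat p)) = witnessed T p (henkin_chain T q (to_nat p))"
    by (simp add: Let_def)
  then show ?thesis by (metis (mono_tags, lifting) Assm henkin_theory_def mem_Collect_eq subsetI)
qed

lemma henkin_theory_complete: "p \<in> Th \<or> FImp p FBot \<in> Th"
  using henkin_theory_step[of p] witnessed_subset by blast

lemma henkin_theory_not: "FImp p FBot \<in> Th \<longleftrightarrow> p \<notin> Th"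
  using henkin_theory_complete henkin_theory_mp FBot_notin_henkin_theory by blast

lemma henkin_theory_closed: "deriv T [] p \<Longrightarrow> p \<in> Th"
  unfolding henkin_theory_def using deriv_weaken[of T "[]" p] by simp

lemma henkin_theory_imp: "FImp p r \<in> Th \<longleftrightarrow> (p \<in> Th \<longrightarrow> r \<in> Th)"
proof
  show "FImp p r \<in> Th \<Longrightarrow> p \<in> Th \<longrightarrow> r \<in> Th" by (blast intro: henkin_theory_mp)
next
  assume *: "p \<in> Th \<longrightarrow> r \<in> Th"
  show "FImp p r \<in> Th"
  proof (cases "r \<in> Th")
    case True
    have "deriv T [] (FImp r (FImp p r))" by (intro ImpI Assm) simp
    then show ?thesis using True henkin_theory_closed henkin_theory_mp by blast
  next
    case False
    with * have "FImp p FBot \<in> Th" by (simp add: henkin_theory_not)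
    moreover have "deriv T [] (FImp (FImp p FBot) (FImp p r))"
      by (rule ImpI, rule ImpI, rule deriv_FBotE, rule ImpE[where p = p]; rule Assm; simp)
    ultimately show ?thesis using henkin_theory_closed henkin_theory_mp by blast
  qed
qed

lemma henkin_theory_all: "FAll p \<in> Th \<longleftrightarrow> (\<forall>t. inst t p \<in> Th)"
proof
  show "FAll p \<in> Th \<Longrightarrow> \<forall>t. inst t p \<in> Th" by (auto simp: henkin_theory_def intro: AllE)
next
  assume *: "\<forall>t. inst t p \<in> Th"
  show "FAll p \<in> Th"
  proof (rule ccontr)
    assume a: "FAll p \<notin> Th"
    \<comment> \<open>This rules out the first alternative of \<open>henkin_theory_step\<close> for
      the negation of \<open>FAll p\<close>, so that negation was adopted along with a refuted
      instance of p.\<close>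
    then have "FImp (FImp (FAll p) FBot) FBot \<notin> Th"
      by (simp add: henkin_theory_not)
    then have "set (witnessed T (FImp (FAll p) FBot)
        (henkin_chain T q (to_nat (FImp (FAll p) FBot)))) \<subseteq> Th"
      using henkin_theory_step by blast
    then show False using * by (auto simp: henkin_theory_not)
  qed
qed

end

section \<open>Truth in a structure, the term model and its quotient\<close>

primrec sat :: "('a \<Rightarrow> 'a \<Rightarrow> bool) \<Rightarrow> ('a \<Rightarrow> 'a \<Rightarrow> bool) \<Rightarrow> (nat \<Rightarrow> 'a) \<Rightarrow> fm \<Rightarrow> bool" where
  "sat E Q e (FMem i j) = E (e i) (e j)"
| "sat E Q e (FEq i j) = Q (e i) (e j)"
| "sat E Q e FBot = False"
| "sat E Q e (FImp p q) = (sat E Q e p \<longrightarrow> sat E Q e q)"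
| "sat E Q e (FAll p) = (\<forall>x. sat E Q (push x e) p)"

lemma sat_ren: "sat E Q e (ren f p) = sat E Q (\<lambda>i. e (f i)) p"
  by (induction p arbitrary: e f) simp_all

text \<open>The truth lemma. The elements of the term model are the variables themselves, so an
  environment e is at the same time a renaming.\<close>

lemma sat_henkin:
  assumes "\<not> T \<turnstile> q"
  shows "sat (\<lambda>i j. FMem i j \<in> henkin_theory T q) (\<lambda>i j. FEq i j \<in> henkin_theory T q) e p
    \<longleftrightarrow> ren e p \<in> henkin_theory T q"
proof (induction p arbitrary: e)
  case FBot
  then show ?case using FBot_notin_henkin_theory[OF assms] by simp
next
  case (FImp p r)
  then show ?case by (simp add: henkin_theory_imp[OF assms])
next
  case (FAll p)
  then show ?case by (simp add: henkin_theory_all[OF assms] inst_ren_lift)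
qed simp_all

lemma inst_FMem_FEq:
  "inst t (FMem 0 (Suc j)) = FMem t j" "inst t (FMem (Suc i) 0) = FMem i t"
  "inst t (FEq 0 (Suc j)) = FEq t j" "inst t (FEq (Suc i) 0) = FEq i t"
  by (simp_all add: inst_eq)

text \<open>In the term model distinct variables may be provably equal, so equality is first
  interpreted by a relation Q and made genuine by passing to classes.\<close>

definition congruence :: "('a \<Rightarrow> 'a \<Rightarrow> bool) \<Rightarrow> ('a \<Rightarrow> 'a \<Rightarrow> bool) \<Rightarrow> bool" where
  "congruence E Q \<longleftrightarrow> equivp Q \<and> (\<forall>x y z. Q x y \<longrightarrow> (E x z \<longleftrightarrow> E y z) \<and> (E z x \<longleftrightarrow> E z y))"

text \<open>Every property is an instance of \<open>EqSubst\<close> for an atomic formula in which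
  index 0 marks the place to be replaced.\<close>

lemma henkin_congruence:
  "congruence (\<lambda>i j. FMem i j \<in> henkin_theory T q) (\<lambda>i j. FEq i j \<in> henkin_theory T q)"
proof -
  let ?Th = "henkin_theory T q"
  have refl: "FEq i i \<in> ?Th" for i by (auto simp: henkin_theory_def intro: EqRefl)
  have subst: "inst t p \<in> ?Th" if "FEq s t \<in> ?Th" "inst s p \<in> ?Th" for s t p
    using that by (rule henkin_theory_2) (unfold henkin_theory_def, blast intro: EqSubst[of T _ s t p])
  have sym: "FEq j i \<in> ?Th" if "FEq i j \<in> ?Th" for i j
    using subst[of i j "FEq 0 (Suc i)"] that refl by (simp add: inst_FMem_FEq)
  have trans: "FEq i k \<in> ?Th" if "FEq i j \<in> ?Th" "FEq j k \<in> ?Th" for i j k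
    using subst[of j k "FEq (Suc i) 0"] that by (simp add: inst_FMem_FEq)
  have mem: "FMem j k \<in> ?Th" if "FEq i j \<in> ?Th" "FMem i k \<in> ?Th" for i j k
    using subst[of i j "FMem 0 (Suc k)"] that by (simp add: inst_FMem_FEq)
  have mem': "FMem k j \<in> ?Th" if "FEq i j \<in> ?Th" "FMem k i \<in> ?Th" for i j k
    using subst[of i j "FMem (Suc k) 0"] that by (simp add: inst_FMem_FEq)
  show ?thesis unfolding congruence_def
    by (intro conjI equivpI reflpI sympI transpI) (blast intro: refl sym trans mem mem')+
qed

lemma sat_quotient:
  assumes "surj h" "\<And>x y. E' (h x) (h y) = E x y" "\<And>x y. h x = h y \<longleftrightarrow> Q x y"
  shows "sat E' (=) (\<lambda>i. h (e i)) p = sat E Q e p"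
proof (induction p arbitrary: e)
  case (FAll p)
  have "push (h y) (\<lambda>i. h (e i)) = (\<lambda>i. h (push y e i))" for y
    by (rule push_eqI[symmetric]) simp_all
  then have "sat E' (=) (push (h y) (\<lambda>i. h (e i))) p = sat E Q (push y e) p" for y
    using FAll by simp
  then have "(\<forall>y. sat E' (=) (push (h y) (\<lambda>i. h (e i))) p) = sat E Q e (FAll p)" by simp
  moreover have "(\<forall>x. P x) \<longleftrightarrow> (\<forall>y. P (h y))" for P
    using \<open>surj h\<close> by (metis surjD)
  ultimately show ?case by simp
qed (simp_all add: assms)

text \<open>Infinitely many classes are required so that the quotient of the Henkin model can be
  re-indexed by all of nat, which spares a relativisation to a carrier set.\<close>

theorem completeness:
  assumes inf: "\<And>(E :: nat \<Rightarrow> nat \<Rightarrow> bool) Q S. congruence E Q \<Longrightarrow>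
      (\<And>p e. p \<in> T \<Longrightarrow> sat E Q e p) \<Longrightarrow> finite S \<Longrightarrow> \<exists>x. \<forall>y\<in>S. \<not> Q x y"
    and valid: "\<And>(E :: nat \<Rightarrow> nat \<Rightarrow> bool) e. (\<And>p e. p \<in> T \<Longrightarrow> sat E (=) e p) \<Longrightarrow>
      sat E (=) e q"
  shows "T \<turnstile> q"
proof (rule ccontr)
  assume np: "\<not> T \<turnstile> q"
  define E where "E = (\<lambda>i j. FMem i j \<in> henkin_theory T q)"
  define Q where "Q = (\<lambda>i j. FEq i j \<in> henkin_theory T q)"
  have cong: "congruence E Q" unfolding E_def Q_def by (rule henkin_congruence)
  then have Q: "equivp Q" by (simp add: congruence_def)
  have truth: "sat E Q e p \<longleftrightarrow> ren e p \<in> henkin_theory T q" for e p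
    unfolding E_def Q_def by (rule sat_henkin[OF np])
  have ax: "sat E Q e p" if "p \<in> T" for e p
    unfolding truth using deriv_axiom_instance[OF that] henkin_theory_closed[OF np] by blast
  \<comment> \<open>The least member of a class is its representative.\<close>
  define r where "r i = (LEAST j. Q i j)" for i
  have Qr: "Q i (r i)" for i
    unfolding r_def by (rule LeastI[of _ i]) (rule equivp_reflp[OF Q])
  have r_eq: "r i = r j \<longleftrightarrow> Q i j" for i j
  proof
    show "r i = r j \<Longrightarrow> Q i j" by (metis Qr Q equivp_symp equivp_transp)
    show "Q i j \<Longrightarrow> r i = r j" using Q unfolding r_def equivp_def by metis
  qed
  have infin: "infinite (range r)"
  proof
    assume "finite (range r)"
    then obtain x where "\<forall>y\<in>range r. \<not> Q x y" using inf[OF cong ax] by blast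
    then show False using Qr by blast
  qed
  \<comment> \<open>Infinitely many representatives can be numbered by all of nat, so h maps onto
    nat and its fibres are the classes of Q.\<close>
  define h where "h i = to_nat_on (range r) (r i)" for i
  have bij: "bij_betw (to_nat_on (range r)) (range r) UNIV"
    using infin by (intro to_nat_on_infinite) auto
  have "range h = to_nat_on (range r) ` range r" by (auto simp: h_def)
  then have "surj h" using bij by (simp add: bij_betw_def)
  have h_eq: "h i = h j \<longleftrightarrow> Q i j" for i j
    unfolding h_def r_eq[symmetric] by (rule inj_on_eq_iff[OF bij_betw_imp_inj_on[OF bij]]) auto
  define E' where "E' a b \<longleftrightarrow> (\<exists>i j. h i = a \<and> h j = b \<and> E i j)" for a b
  have E': "E' (h i) (h j) = E i j" for i j
  proof
    assume "E' (h i) (h j)"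
    then obtain i' j' where "Q i' i" "Q j' j" "E i' j'" unfolding E'_def h_eq by blast
    then show "E i j" using cong unfolding congruence_def by blast
  next
    show "E i j \<Longrightarrow> E' (h i) (h j)" unfolding E'_def by blast
  qed
  note sq = sat_quotient[of h E' E Q, OF \<open>surj h\<close> E' h_eq]
  have "sat E' (=) e p" if "p \<in> T" for e p
  proof -
    have "h (inv h (e i)) = e i" for i using \<open>surj h\<close> by (rule surj_f_inv_f)
    then show ?thesis using sq[of "\<lambda>i. inv h (e i)" p] ax[OF that] by simp
  qed
  then have "sat E' (=) (\<lambda>i. h i) q" by (rule valid)
  then have "sat E Q (\<lambda>i. i) q" using sq[of "\<lambda>i. i" q] by simp
  then have "q \<in> henkin_theory T q" using truth[of "\<lambda>i. i" q] by simp
  moreover have "FImp q FBot \<in> henkin_theory T q"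
    unfolding henkin_theory_def using Assm[of _ "henkin_chain T q 0"] by (auto intro!: exI[of _ 0])
  ultimately show False by (simp add: henkin_theory_not[OF np])
qed

section \<open>Semantics of the named formulas\<close>

text \<open>Below n quantifiers, s assigns values to the levels less than n; r covers the indices that
  point outside, which occur only as parameters of the axiom schemes.\<close>

definition level_env :: "(nat \<Rightarrow> 'a) \<Rightarrow> nat \<Rightarrow> (nat \<Rightarrow> 'a) \<Rightarrow> nat \<Rightarrow> 'a" where
  "level_env r n s i = (if i < n then s (n - Suc i) else r (i - n))"

definition holds :: "('a \<Rightarrow> 'a \<Rightarrow> bool) \<Rightarrow> ('a \<Rightarrow> 'a \<Rightarrow> bool) \<Rightarrow> (nat \<Rightarrow> 'a) \<Rightarrow> nat \<Rightarrow> (nat \<Rightarrow> 'a)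
    \<Rightarrow> form \<Rightarrow> bool" where
  "holds E Q r n s \<phi> = sat E Q (level_env r n s) (\<phi> n)"

named_theorems holds

lemma sat_sentence: "sat E Q r (sentence \<phi>) = holds E Q r 0 s \<phi>"
  by (simp add: holds_def sentence_def level_env_def[abs_def])

lemma holds_mem [holds]: "x < n \<Longrightarrow> y < n \<Longrightarrow> holds E Q r n s (x \<^bold>\<in> y) = E (s x) (s y)"
  by (simp add: holds_def f_mem_def level_env_def)

lemma holds_eq [holds]: "x < n \<Longrightarrow> y < n \<Longrightarrow> holds E Q r n s (x \<^bold>= y) = Q (s x) (s y)"
  by (simp add: holds_def f_eq_def level_env_def)

lemma holds_connectives [holds]:
  "holds E Q r n s (p \<^bold>\<longrightarrow> q) = (holds E Q r n s p \<longrightarrow> holds E Q r n s q)"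
  "holds E Q r n s (\<^bold>\<not> p) = (\<not> holds E Q r n s p)"
  "holds E Q r n s (p \<^bold>\<and> q) = (holds E Q r n s p \<and> holds E Q r n s q)"
  "holds E Q r n s (p \<^bold>\<or> q) = (holds E Q r n s p \<or> holds E Q r n s q)"
  "holds E Q r n s (p \<^bold>\<longleftrightarrow> q) = (holds E Q r n s p = holds E Q r n s q)"
  by (auto simp: holds_def f_imp_def f_not_def f_and_def f_or_def f_iff_def)

text \<open>Levels count from the outside: a further quantifier assigns level n and leaves the
  others in place, where de Bruijn indices would all shift.\<close>

lemma holds_all [holds]:
  "holds E Q r n s (f_all P) = (\<forall>v. holds E Q r (Suc n) (s(n := v)) (P n))"
proof -
  have "push v (level_env r n s) = level_env r (Suc n) (s(n := v))" for v
    by (rule push_eqI[symmetric]) (auto simp: level_env_def)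
  then show ?thesis by (simp add: holds_def f_all_def)
qed

lemma holds_ex [holds]:
  "holds E Q r n s (f_ex P) = (\<exists>v. holds E Q r (Suc n) (s(n := v)) (P n))"
  by (simp add: f_ex_def holds)

lemma holds_ex1 [holds]:
  "holds E (=) r n s (f_ex1 P) = (\<exists>v. holds E (=) r (Suc n) (s(n := v)) (P n) \<and>
     (\<forall>w. holds E (=) r (Suc (Suc n)) (s(n := v, Suc n := w)) (P (Suc n)) \<longrightarrow> w = v))"
  by (simp add: f_ex1_def holds)

text \<open>The parameters of the formula were shifted past all n quantifiers, hence they fall into
  the range that \<open>level_env\<close> hands over to r.\<close>

lemma holds_app1:
  "x < n \<Longrightarrow> holds E Q r n s (app1 \<phi> x) = sat E Q (push (s x) r) \<phi>"
  unfolding holds_def app1_def sat_ren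
  by (rule arg_cong[where f = "\<lambda>e. sat E Q e \<phi>"], rule push_eqI)
    (auto simp: level_env_def)

section \<open>The formulas read as predicates of a structure\<close>

locale membership =
  fixes E :: "'a \<Rightarrow> 'a \<Rightarrow> bool" (infix "\<epsilon>" 50)
begin

definition "m_empty x \<longleftrightarrow> (\<forall>z. \<not> z \<epsilon> x)"
definition "m_sub x y \<longleftrightarrow> (\<forall>z. z \<epsilon> x \<longrightarrow> z \<epsilon> y)"
definition "m_succ y x \<longleftrightarrow> (\<forall>z. z \<epsilon> y \<longleftrightarrow> z \<epsilon> x \<or> z = x)"
definition "m_inductive w \<longleftrightarrow> (\<exists>e. m_empty e \<and> e \<epsilon> w) \<and>
  (\<forall>x. x \<epsilon> w \<longrightarrow> (\<exists>y. m_succ y x \<and> y \<epsilon> w))"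
definition "m_upair p x y \<longleftrightarrow> (\<forall>z. z \<epsilon> p \<longleftrightarrow> z = x \<or> z = y)"
definition "m_pair p x y \<longleftrightarrow> (\<exists>a b. m_upair a x x \<and> m_upair b x y \<and> m_upair p a b)"
definition "m_maps f x y \<longleftrightarrow> (\<exists>p. m_pair p x y \<and> p \<epsilon> f)"
definition "m_fun_on f A \<longleftrightarrow> (\<forall>p. p \<epsilon> f \<longrightarrow> (\<exists>x y. x \<epsilon> A \<and> m_pair p x y)) \<and>
  (\<forall>x. x \<epsilon> A \<longrightarrow> (\<exists>y. m_maps f x y \<and> (\<forall>z. m_maps f x z \<longrightarrow> z = y)))"
definition "m_fun_into f A B \<longleftrightarrow> m_fun_on f A \<and> (\<forall>x y. m_maps f x y \<longrightarrow> y \<epsilon> B)"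
definition "m_bijection f A B \<longleftrightarrow> m_fun_into f A B \<and>
  (\<forall>y. y \<epsilon> B \<longrightarrow> (\<exists>x. m_maps f x y \<and> (\<forall>z. m_maps f z y \<longrightarrow> z = x)))"
definition "m_omega w \<longleftrightarrow> m_inductive w \<and> (\<forall>v. m_inductive v \<longrightarrow> m_sub w v)"
definition "m_finite A \<longleftrightarrow> (\<exists>w n. m_omega w \<and> n \<epsilon> w \<and> (\<exists>f. m_bijection f A n))"
definition "m_countable A \<longleftrightarrow> (\<exists>w B. m_omega w \<and> m_sub B w \<and> (\<exists>f. m_bijection f A B))"
definition "m_choice g J F \<longleftrightarrow> m_fun_on g J \<and> (\<forall>j a x. m_maps F j a \<and> m_maps g j x \<longrightarrow> x \<epsilon> a)"
definition "m_multiple_choice g J F \<longleftrightarrow> m_fun_on g J \<and>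
  (\<forall>j a s. m_maps F j a \<and> m_maps g j s \<longrightarrow> m_sub s a \<and> m_finite s \<and> \<not> m_empty s)"
definition "m_denumerable_family J F \<longleftrightarrow> (\<not> m_finite J \<and> m_countable J) \<and> m_fun_on F J \<and>
  (\<forall>j a. m_maps F j a \<longrightarrow> \<not> m_empty a)"
definition "m_op f x y z \<longleftrightarrow> (\<exists>p. m_pair p x y \<and> m_maps f p z)"
definition "m_binop f R \<longleftrightarrow>
  (\<forall>t. t \<epsilon> f \<longrightarrow> (\<exists>p x y z. x \<epsilon> R \<and> y \<epsilon> R \<and> z \<epsilon> R \<and> m_pair p x y \<and> m_pair t p z)) \<and>
  (\<forall>x y. x \<epsilon> R \<and> y \<epsilon> R \<longrightarrow> (\<exists>z. m_op f x y z \<and> (\<forall>v. m_op f x y v \<longrightarrow> v = z)))"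
definition "m_assoc f \<longleftrightarrow> (\<forall>x y z u v s t. m_op f x y u \<and> m_op f u z s \<and> m_op f y z v \<and> m_op f x v t
  \<longrightarrow> s = t)"
definition "m_comm f \<longleftrightarrow> (\<forall>x y u. m_op f x y u \<longrightarrow> m_op f y x u)"
definition "m_neutral f R e \<longleftrightarrow> e \<epsilon> R \<and> (\<forall>x. x \<epsilon> R \<longrightarrow> m_op f x e x)"
definition "m_leq l x y \<longleftrightarrow> m_maps l x y \<or> x = y"
definition "m_abs_diff a l o' x y d \<longleftrightarrow> (\<exists>u. m_op a y u x \<and>
  (m_leq l o' u \<and> d = u \<or> m_maps l u o' \<and> m_op a u d o'))"
definition "m_lub R l P s \<longleftrightarrow> s \<epsilon> R \<and> (\<forall>d. P d \<longrightarrow> m_leq l d s) \<and>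
  (\<forall>u. u \<epsilon> R \<and> (\<forall>d. P d \<longrightarrow> m_leq l d u) \<longrightarrow> m_leq l s u)"
definition "m_osc_le R a l o' f A e \<longleftrightarrow> m_empty A \<or>
  (\<exists>s. m_lub R l (\<lambda>d. \<exists>x y u v. x \<epsilon> A \<and> y \<epsilon> A \<and> m_maps f x u \<and> m_maps f y v \<and>
     m_abs_diff a l o' u v d) s \<and> m_leq l s e)"
definition "m_union u S \<longleftrightarrow> (\<forall>x. x \<epsilon> u \<longleftrightarrow> (\<exists>U. U \<epsilon> S \<and> x \<epsilon> U))"
definition "m_topology X T \<longleftrightarrow> (\<forall>U. U \<epsilon> T \<longrightarrow> m_sub U X) \<and> X \<epsilon> T \<and> (\<forall>U. m_empty U \<longrightarrow> U \<epsilon> T) \<and>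
  (\<forall>S U. m_sub S T \<and> m_union U S \<longrightarrow> U \<epsilon> T) \<and>
  (\<forall>U V W. U \<epsilon> T \<and> V \<epsilon> T \<and> (\<forall>x. x \<epsilon> W \<longleftrightarrow> x \<epsilon> U \<and> x \<epsilon> V) \<longrightarrow> W \<epsilon> T)"
definition "m_discrete X T \<longleftrightarrow> m_topology X T \<and> (\<forall>U. m_sub U X \<longrightarrow> U \<epsilon> T)"
definition "m_clopen X T A \<longleftrightarrow> A \<epsilon> T \<and> (\<exists>B. (\<forall>x. x \<epsilon> B \<longleftrightarrow> x \<epsilon> X \<and> \<not> x \<epsilon> A) \<and> B \<epsilon> T)"
definition "m_real_open R a l o' V \<longleftrightarrow> m_sub V R \<and> (\<forall>x. x \<epsilon> V \<longrightarrow> (\<exists>e. m_maps l o' e \<and>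
  (\<forall>y d. m_abs_diff a l o' x y d \<and> m_maps l d e \<longrightarrow> y \<epsilon> V)))"
definition "m_continuous R a l o' X T f \<longleftrightarrow> m_fun_into f X R \<and>
  (\<forall>V U. m_real_open R a l o' V \<and> (\<forall>x. x \<epsilon> U \<longleftrightarrow> (\<exists>y. m_maps f x y \<and> y \<epsilon> V)) \<longrightarrow> U \<epsilon> T)"
definition "m_U R a l o' X T f \<longleftrightarrow> m_continuous R a l o' X T f \<and> (\<forall>e. m_maps l o' e \<longrightarrow>
  (\<exists>C. m_countable C \<and> m_union X C \<and> (\<forall>A. A \<epsilon> C \<longrightarrow> m_clopen X T A \<and> m_osc_le R a l o' f A e)))"
definition "m_covers F X \<longleftrightarrow> (\<forall>x. x \<epsilon> X \<longleftrightarrow> (\<exists>j a. m_maps F j a \<and> x \<epsilon> a))"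
definition "m_disjoint F \<longleftrightarrow> (\<forall>i j a b. m_maps F i a \<and> m_maps F j b \<and> \<not> i = j \<longrightarrow>
  \<not> (\<exists>x. x \<epsilon> a \<and> x \<epsilon> b))"
definition "m_U_disjoint sel R a l o' X T f \<longleftrightarrow> m_continuous R a l o' X T f \<and> (\<forall>e. m_maps l o' e \<longrightarrow>
  (\<exists>J F. m_countable J \<and> m_fun_on F J \<and> m_covers F X \<and> m_disjoint F \<and> sel J F \<and>
    (\<forall>j A. m_maps F j A \<longrightarrow> m_clopen X T A \<and> m_osc_le R a l o' f A e)))"

definition "m_add_group R a o' \<longleftrightarrow> m_binop a R \<and> m_assoc a \<and> m_comm a \<and> m_neutral a R o' \<and>
  (\<forall>x. x \<epsilon> R \<longrightarrow> (\<exists>y. y \<epsilon> R \<and> m_op a x y o'))"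
definition "m_order R a l o' \<longleftrightarrow>
  (\<forall>p. p \<epsilon> l \<longrightarrow> (\<exists>x y. x \<epsilon> R \<and> y \<epsilon> R \<and> m_pair p x y)) \<and>
  (\<forall>x. \<not> m_maps l x x) \<and>
  (\<forall>x y z. m_maps l x y \<and> m_maps l y z \<longrightarrow> m_maps l x z) \<and>
  (\<forall>x y. x \<epsilon> R \<and> y \<epsilon> R \<longrightarrow> m_maps l x y \<or> x = y \<or> m_maps l y x) \<and>
  (\<forall>x y z s t. m_maps l x y \<and> m_op a x z s \<and> m_op a y z t \<longrightarrow> m_maps l s t)"
definition "m_complete R l \<longleftrightarrow> (\<forall>S. m_sub S R \<and> \<not> m_empty S \<and>
    (\<exists>u. u \<epsilon> R \<and> (\<forall>d. d \<epsilon> S \<longrightarrow> m_leq l d u)) \<longrightarrow> (\<exists>s. m_lub R l (\<lambda>d. d \<epsilon> S) s))"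

abbreviation "hold \<equiv> holds E (=)"

lemma hold_set [holds]:
  "x < n \<Longrightarrow> hold r n s (is_empty x) = m_empty (s x)"
  "x < n \<Longrightarrow> y < n \<Longrightarrow> hold r n s (x \<^bold>\<subseteq> y) = m_sub (s x) (s y)"
  "x < n \<Longrightarrow> y < n \<Longrightarrow> hold r n s (is_succ x y) = m_succ (s x) (s y)"
  "x < n \<Longrightarrow> y < n \<Longrightarrow> z < n \<Longrightarrow> hold r n s (is_upair x y z) = m_upair (s x) (s y) (s z)"
  "x < n \<Longrightarrow> y < n \<Longrightarrow> hold r n s (is_union x y) = m_union (s x) (s y)"
  by (simp_all add: holds is_empty_def m_empty_def is_subset_def m_sub_def is_succ_def m_succ_def
    is_upair_def m_upair_def is_union_def m_union_def)

lemma hold_inductive [holds]: "x < n \<Longrightarrow> hold r n s (is_inductive x) = m_inductive (s x)"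
  by (simp add: holds is_inductive_def m_inductive_def)

lemma hold_omega [holds]: "x < n \<Longrightarrow> hold r n s (is_omega x) = m_omega (s x)"
  by (simp add: holds is_omega_def m_omega_def)

lemma hold_pair [holds]:
  "x < n \<Longrightarrow> y < n \<Longrightarrow> z < n \<Longrightarrow> hold r n s (is_pair x y z) = m_pair (s x) (s y) (s z)"
  by (simp add: holds is_pair_def m_pair_def)

lemma hold_maps [holds]:
  "x < n \<Longrightarrow> y < n \<Longrightarrow> z < n \<Longrightarrow> hold r n s (maps x y z) = m_maps (s x) (s y) (s z)"
  by (simp add: holds maps_def m_maps_def)

lemma hold_fun_on [holds]: "x < n \<Longrightarrow> y < n \<Longrightarrow> hold r n s (fun_on x y) = m_fun_on (s x) (s y)"
  by (simp add: holds fun_on_def m_fun_on_def)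

lemma hold_fun_into [holds]:
  "x < n \<Longrightarrow> y < n \<Longrightarrow> z < n \<Longrightarrow> hold r n s (fun_into x y z) = m_fun_into (s x) (s y) (s z)"
  by (simp add: holds fun_into_def m_fun_into_def)

lemma hold_bijection [holds]:
  "x < n \<Longrightarrow> y < n \<Longrightarrow> z < n \<Longrightarrow> hold r n s (is_bijection x y z) = m_bijection (s x) (s y) (s z)"
  by (simp add: holds is_bijection_def m_bijection_def)

lemma hold_cardinality [holds]:
  "x < n \<Longrightarrow> hold r n s (is_finite x) = m_finite (s x)"
  "x < n \<Longrightarrow> hold r n s (is_countable x) = m_countable (s x)"
  by (simp_all add: holds is_finite_def m_finite_def is_countable_def m_countable_def
    equipotent_def)

lemma hold_choice [holds]:
  "j < n \<Longrightarrow> f < n \<Longrightarrow> hold r n s (has_choice j f) = (\<exists>g. m_choice g (s j) (s f))"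
  "j < n \<Longrightarrow> f < n \<Longrightarrow>
     hold r n s (has_multiple_choice j f) = (\<exists>g. m_multiple_choice g (s j) (s f))"
  by (simp_all add: holds has_choice_def choice_function_def m_choice_def
    has_multiple_choice_def multiple_choice_function_def m_multiple_choice_def)

lemma hold_family [holds]:
  "j < n \<Longrightarrow> f < n \<Longrightarrow>
     hold r n s (denumerable_nonempty_family j f) = m_denumerable_family (s j) (s f)"
  by (simp add: holds denumerable_nonempty_family_def is_denumerable_def m_denumerable_family_def)

lemma hold_CAC [holds]:
  "hold r n s CAC = (\<forall>J F. m_denumerable_family J F \<longrightarrow> (\<exists>g. m_choice g J F))"
  "hold r n s CMC = (\<forall>J F. m_denumerable_family J F \<longrightarrow> (\<exists>g. m_multiple_choice g J F))"
  by (simp_all add: holds CAC_def CMC_def)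

lemma hold_op_maps [holds]:
  "f < n \<Longrightarrow> x < n \<Longrightarrow> y < n \<Longrightarrow> z < n \<Longrightarrow>
     hold r n s (op_maps f x y z) = m_op (s f) (s x) (s y) (s z)"
  by (simp add: holds op_maps_def m_op_def)

lemma hold_op [holds]:
  "f < n \<Longrightarrow> x < n \<Longrightarrow> hold r n s (binary_op f x) = m_binop (s f) (s x)"
  "f < n \<Longrightarrow> hold r n s (op_assoc f) = m_assoc (s f)"
  "f < n \<Longrightarrow> hold r n s (op_comm f) = m_comm (s f)"
  "f < n \<Longrightarrow> x < n \<Longrightarrow> e < n \<Longrightarrow> hold r n s (op_neutral f x e) = m_neutral (s f) (s x) (s e)"
  by (simp_all add: holds binary_op_def m_binop_def op_assoc_def m_assoc_def op_comm_def
    m_comm_def op_neutral_def m_neutral_def)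

lemma hold_rleq [holds]:
  "rlt \<R> < n \<Longrightarrow> x < n \<Longrightarrow> y < n \<Longrightarrow> hold r n s (rless \<R> x y) = m_maps (s (rlt \<R>)) (s x) (s y)"
  "rlt \<R> < n \<Longrightarrow> x < n \<Longrightarrow> y < n \<Longrightarrow> hold r n s (rleq \<R> x y) = m_leq (s (rlt \<R>)) (s x) (s y)"
  by (simp_all add: holds rless_def rleq_def m_leq_def)

text \<open>P is evaluated at two depths: directly below the binder of d at level n, and below u and
  then d, where d has level \<open>Suc n\<close>. Each depth gives one premise.\<close>

lemma hold_lub [holds]:
  "rlt \<R> < n \<Longrightarrow> rcarr \<R> < n \<Longrightarrow> x < n \<Longrightarrow>
   (\<And>v. hold r (Suc n) (s(n := v)) (P n) = P' v) \<Longrightarrow>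
   (\<And>v w. hold r (Suc (Suc n)) (s(n := v, Suc n := w)) (P (Suc n)) = P' w) \<Longrightarrow>
   hold r n s (is_lub \<R> P x) = m_lub (s (rcarr \<R>)) (s (rlt \<R>)) P' (s x)"
  by (simp add: holds is_lub_def m_lub_def)

lemma hold_abs_diff [holds]:
  "rlt \<R> < n \<Longrightarrow> radd \<R> < n \<Longrightarrow> rzero \<R> < n \<Longrightarrow> x < n \<Longrightarrow> y < n \<Longrightarrow> d < n \<Longrightarrow>
   hold r n s (abs_diff \<R> x y d) =
     m_abs_diff (s (radd \<R>)) (s (rlt \<R>)) (s (rzero \<R>)) (s x) (s y) (s d)"
  by (simp add: holds abs_diff_def m_abs_diff_def)

lemma hold_osc_le [holds]:
  "rlt \<R> < n \<Longrightarrow> radd \<R> < n \<Longrightarrow> rzero \<R> < n \<Longrightarrow> rcarr \<R> < n \<Longrightarrow> f < n \<Longrightarrow> A < n \<Longrightarrow> e < n \<Longrightarrow>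
   hold r n s (osc_le \<R> f A e) =
     m_osc_le (s (rcarr \<R>)) (s (radd \<R>)) (s (rlt \<R>)) (s (rzero \<R>)) (s f) (s A) (s e)"
  unfolding osc_le_def m_osc_le_def
  by (simp only: holds, subst hold_lub[where P' = "\<lambda>d. \<exists>x y u v. x \<epsilon> s A \<and> y \<epsilon> s A \<and> m_maps (s f) x u \<and>
      m_maps (s f) y v \<and> m_abs_diff (s (radd \<R>)) (s (rlt \<R>)) (s (rzero \<R>)) u v d"])
    (simp_all add: holds)

lemma hold_topology [holds]:
  "X < n \<Longrightarrow> T < n \<Longrightarrow> hold r n s (topological_space X T) = m_topology (s X) (s T)"
  "X < n \<Longrightarrow> T < n \<Longrightarrow> A < n \<Longrightarrow> hold r n s (clopen X T A) = m_clopen (s X) (s T) (s A)"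
  by (simp_all add: holds topological_space_def m_topology_def clopen_def m_clopen_def is_diff_def
    is_inter_def)

lemma hold_discrete [holds]:
  "X < n \<Longrightarrow> T < n \<Longrightarrow> hold r n s (discrete_space X T) = m_discrete (s X) (s T)"
  by (simp add: holds discrete_space_def m_discrete_def)

lemma hold_real_open [holds]:
  "rlt \<R> < n \<Longrightarrow> radd \<R> < n \<Longrightarrow> rzero \<R> < n \<Longrightarrow> rcarr \<R> < n \<Longrightarrow> V < n \<Longrightarrow>
   hold r n s (real_open \<R> V) =
     m_real_open (s (rcarr \<R>)) (s (radd \<R>)) (s (rlt \<R>)) (s (rzero \<R>)) (s V)"
  by (simp add: holds real_open_def m_real_open_def)

lemma hold_continuous [holds]:
  "rlt \<R> < n \<Longrightarrow> radd \<R> < n \<Longrightarrow> rzero \<R> < n \<Longrightarrow> rcarr \<R> < n \<Longrightarrow> X < n \<Longrightarrow> T < n \<Longrightarrow> f < n \<Longrightarrow>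
   hold r n s (is_continuous \<R> X T f) =
     m_continuous (s (rcarr \<R>)) (s (radd \<R>)) (s (rlt \<R>)) (s (rzero \<R>)) (s X) (s T) (s f)"
  by (simp add: holds is_continuous_def m_continuous_def is_preimage_def)

lemma hold_covers [holds]:
  "X < n \<Longrightarrow> F < n \<Longrightarrow> hold r n s (covers F X) = m_covers (s F) (s X)"
  "F < n \<Longrightarrow> hold r n s (pairwise_disjoint F) = m_disjoint (s F)"
  by (simp_all add: holds covers_def m_covers_def pairwise_disjoint_def m_disjoint_def)

lemma hold_U [holds]:
  assumes "rlt \<R> < n" "radd \<R> < n" "rzero \<R> < n" "rcarr \<R> < n" "X < n" "T < n" "f < n"
  shows "hold r n s (U_aleph0 \<R> X T f) =
     m_U (s (rcarr \<R>)) (s (radd \<R>)) (s (rlt \<R>)) (s (rzero \<R>)) (s X) (s T) (s f)"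
    "hold r n s (U_aleph0_AC \<R> X T f) = m_U_disjoint (\<lambda>J F. \<exists>g. m_choice g J F)
       (s (rcarr \<R>)) (s (radd \<R>)) (s (rlt \<R>)) (s (rzero \<R>)) (s X) (s T) (s f)"
    "hold r n s (U_aleph0_MC \<R> X T f) = m_U_disjoint (\<lambda>J F. \<exists>g. m_multiple_choice g J F)
       (s (rcarr \<R>)) (s (radd \<R>)) (s (rlt \<R>)) (s (rzero \<R>)) (s X) (s T) (s f)"
  using assms by (simp_all add: holds U_aleph0_def m_U_def U_aleph0_AC_def U_aleph0_MC_def
    U_disjoint_def m_U_disjoint_def)

lemma hold_complete_ordered_fieldD:
  assumes "hold r n s (complete_ordered_field \<R>)"
    and "rlt \<R> < n" "radd \<R> < n" "rmul \<R> < n" "rzero \<R> < n" "rone \<R> < n" "rcarr \<R> < n"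
  shows "m_add_group (s (rcarr \<R>)) (s (radd \<R>)) (s (rzero \<R>))"
    and "m_order (s (rcarr \<R>)) (s (radd \<R>)) (s (rlt \<R>)) (s (rzero \<R>))"
    and "m_complete (s (rcarr \<R>)) (s (rlt \<R>))"
    and "\<exists>x. x \<epsilon> s (rcarr \<R>) \<and> x \<noteq> s (rzero \<R>)"
proof -
  have of: "hold r n s (ordered_field \<R>)" using assms(1) by (simp add: complete_ordered_field_def holds)
  then have fd: "hold r n s (is_field \<R>)" by (simp add: ordered_field_def holds)
  show "m_add_group (s (rcarr \<R>)) (s (radd \<R>)) (s (rzero \<R>))"
    using fd assms by (simp add: is_field_def holds m_add_group_def)
  show "\<exists>x. x \<epsilon> s (rcarr \<R>) \<and> x \<noteq> s (rzero \<R>)"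
    using fd assms by (simp add: is_field_def holds m_neutral_def) metis
  show "m_order (s (rcarr \<R>)) (s (radd \<R>)) (s (rlt \<R>)) (s (rzero \<R>))"
  proof -
    have "hold r n s (ordered_field \<R>) \<longleftrightarrow> hold r n s (is_field \<R>) \<and>
      m_order (s (rcarr \<R>)) (s (radd \<R>)) (s (rlt \<R>)) (s (rzero \<R>)) \<and>
      (\<forall>x y t. m_maps (s (rlt \<R>)) (s (rzero \<R>)) x \<and> m_maps (s (rlt \<R>)) (s (rzero \<R>)) y \<and>
        m_op (s (rmul \<R>)) x y t \<longrightarrow> m_maps (s (rlt \<R>)) (s (rzero \<R>)) t)"
      using assms(2-) by (simp add: ordered_field_def holds m_order_def)
    with of show ?thesis by blast
  qed
  show "m_complete (s (rcarr \<R>)) (s (rlt \<R>))"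
    using assms unfolding complete_ordered_field_def
    by (simp add: holds hold_lub[where P' = "\<lambda>d. d \<epsilon> _"] m_complete_def)
qed

end

section \<open>Definable predicates\<close>

text \<open>The constant functions among the atoms are the parameters of a definable predicate.\<close>

definition atom :: "((nat \<Rightarrow> 'a) \<Rightarrow> 'a) \<Rightarrow> bool" where
  "atom t \<longleftrightarrow> (\<exists>i. t = (\<lambda>e. e i)) \<or> (\<exists>c. t = (\<lambda>e. c))"

lemma atom_var: "atom (\<lambda>e. e i)" and atom_const: "atom (\<lambda>e. c)"
  by (auto simp: atom_def)

lemma atom_ren: "atom t \<Longrightarrow> atom (\<lambda>e. t (\<lambda>i. e (f i)))"
  by (auto simp: atom_def)

text \<open>Seen from inside a quantifier, an atom either is the bound variable or ignores it; in
  the second case \<open>undefined\<close> fills a place that is not read.\<close>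

lemma atom_push:
  assumes "atom t"
  shows "t (push x e) = (if t = (\<lambda>e. e 0) then x else t (push undefined e))"
    and "atom (\<lambda>e. t (push y e))"
  using assms
proof (auto simp: atom_def)
  fix i assume "(\<lambda>e. e i) \<noteq> (\<lambda>e :: nat \<Rightarrow> 'a. e 0)"
  then have "i \<noteq> 0" by auto
  then show "push x e i = push undefined e i" by (cases i) auto
next
  fix i
  assume *: "\<forall>c. (\<lambda>e. push y e i) \<noteq> (\<lambda>e. c)"
  show "\<exists>j. (\<lambda>e. push y e i) = (\<lambda>e. e j)"
    using * by (cases i) auto
qed

context membership
begin

text \<open>The atoms g let the free variables of p stand for variables of e or for fixed elements
  of the structure. Closure under the connectives then yields definability by following the syntax
  of a predicate, without writing p down.\<close>

definition definable :: "((nat \<Rightarrow> 'a) \<Rightarrow> bool) \<Rightarrow> bool" where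
  "definable P \<longleftrightarrow> (\<exists>p g. (\<forall>i. atom (g i)) \<and> (\<forall>e. P e = sat E (=) (\<lambda>i. g i e) p))"

lemma definableI: "(\<And>i. atom (g i)) \<Longrightarrow> (\<And>e. P e = sat E (=) (\<lambda>i. g i e) p) \<Longrightarrow> definable P"
  unfolding definable_def by (intro exI[of _ p] exI[of _ g]) simp

lemma definableE:
  assumes "definable P"
  obtains g p where "\<And>i. atom (g i)" "\<And>e. P e = sat E (=) (\<lambda>i. g i e) p"
proof -
  from assms obtain g p where "(\<forall>i. atom (g i)) \<and> (\<forall>e. P e = sat E (=) (\<lambda>i. g i e) p)"
    unfolding definable_def by (elim exE)
  then show ?thesis by (intro that) simp_all
qed

text \<open>Isolates the variable 0: all atoms equal to it are merged into index 0 of the new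
  formula, and the others no longer depend on it. This is the shape that a quantifier and the
  separation scheme ask for.\<close>

lemma definable_push:
  assumes "definable P"
  obtains g p where "\<And>i. atom (g i)"
    "\<And>x e. P (push x e) = sat E (=) (push x (\<lambda>i. g i e)) p"
proof -
  obtain g p where g: "\<And>i. atom (g i)" and P: "\<And>e. P e = sat E (=) (\<lambda>i. g i e) p"
    using assms by (rule definableE) (rule that)
  define f where "f i = (if g i = (\<lambda>e. e 0) then 0 else Suc i)" for i
  define k where "k i = (\<lambda>e. g i (push undefined e))" for i
  have "push x (\<lambda>i. k i e) (f i) = g i (push x e)" for x e i
    using atom_push(1)[OF g, of i x e] by (simp add: f_def k_def)
  then have "P (push x e) = sat E (=) (push x (\<lambda>i. k i e)) (ren f p)" for x e
    by (simp add: P sat_ren)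
  moreover have "atom (k i)" for i
    unfolding k_def by (rule atom_push(2)[OF g])
  ultimately show ?thesis by (rule that[rotated])
qed

lemma definable_ren:
  assumes "definable P"
  shows "definable (\<lambda>e. P (\<lambda>i. e (f i)))"
proof -
  obtain g p where g: "\<And>i. atom (g i)" and P: "\<And>e. P e = sat E (=) (\<lambda>i. g i e) p"
    using assms by (rule definableE) (rule that)
  show ?thesis
    by (rule definableI[where g = "\<lambda>j e. g j (\<lambda>i. e (f i))" and p = p]) (simp_all add: P g atom_ren)
qed

lemma definable_imp:
  assumes "definable P" "definable Q"
  shows "definable (\<lambda>e. P e \<longrightarrow> Q e)"
proof -
  obtain g p where g: "\<And>i. atom (g i)" and P: "\<And>e. P e = sat E (=) (\<lambda>i. g i e) p"
    using assms(1) by (rule definableE) (rule that)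
  obtain h q where h: "\<And>i. atom (h i)" and Q: "\<And>e. Q e = sat E (=) (\<lambda>i. h i e) q"
    using assms(2) by (rule definableE) (rule that)
  \<comment> \<open>Even indices carry the atoms of P, odd ones those of Q, so that the two formulas
    share one assignment.\<close>
  define k where "k i = (if even i then g (i div 2) else h (i div 2))" for i
  have "(P e \<longrightarrow> Q e) = sat E (=) (\<lambda>i. k i e) (FImp (ren (\<lambda>i. 2 * i) p) (ren (\<lambda>i. 2 * i + 1) q))"
    for e by (simp add: sat_ren k_def P Q)
  moreover have "atom (k i)" for i using g h by (simp add: k_def)
  ultimately show ?thesis by (intro definableI)
qed

lemma definable_all:
  assumes "definable (\<lambda>e. Q (e 0) (\<lambda>i. e (Suc i)))"
  shows "definable (\<lambda>e. \<forall>x. Q x e)"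
proof -
  obtain g p where g: "\<And>i. atom (g i)"
    and P: "\<And>x e. Q (push x e 0) (\<lambda>i. push x e (Suc i)) = sat E (=) (push x (\<lambda>i. g i e)) p"
    using assms by (rule definable_push) (rule that)
  have "(\<forall>x. Q x e) = sat E (=) (\<lambda>i. g i e) (FAll p)" for e
    using P by simp
  with g show ?thesis by (rule definableI)
qed

lemma definable_mem: "atom t \<Longrightarrow> atom u \<Longrightarrow> definable (\<lambda>e. t e \<epsilon> u e)"
  by (rule definableI[where p = "FMem 0 1" and g = "\<lambda>i. if i = 0 then t else u"]) simp_all

lemma definable_eq: "atom t \<Longrightarrow> atom u \<Longrightarrow> definable (\<lambda>e. t e = u e)"
  by (rule definableI[where p = "FEq 0 1" and g = "\<lambda>i. if i = 0 then t else u"]) simp_all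

lemma definable_False: "definable (\<lambda>e. False)"
  by (rule definableI[where p = FBot and g = "\<lambda>i e. e 0"]) (simp_all add: atom_var)

lemma definable_not: "definable P \<Longrightarrow> definable (\<lambda>e. \<not> P e)"
  using definable_imp[OF _ definable_False, of P] by simp

lemma definable_or: "definable P \<Longrightarrow> definable Q \<Longrightarrow> definable (\<lambda>e. P e \<or> Q e)"
  using definable_imp[OF definable_not, of P Q] by (simp add: disj_imp)

lemma definable_and: "definable P \<Longrightarrow> definable Q \<Longrightarrow> definable (\<lambda>e. P e \<and> Q e)"
  using definable_not[OF definable_imp[OF _ definable_not], of P Q] by simp

lemma definable_iff: "definable P \<Longrightarrow> definable Q \<Longrightarrow> definable (\<lambda>e. P e \<longleftrightarrow> Q e)"
  using definable_and[OF definable_imp definable_imp, of P Q Q P]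
  by (simp add: iff_conv_conj_imp)

lemma definable_ex:
  "definable (\<lambda>e. Q (e 0) (\<lambda>i. e (Suc i))) \<Longrightarrow> definable (\<lambda>e. \<exists>x. Q x e)"
  using definable_not[OF definable_all, of "\<lambda>x e. \<not> Q x e"] definable_not by simp

named_theorems dfn

declare definable_mem [dfn] definable_eq [dfn] definable_not [dfn] definable_or [dfn]
  definable_and [dfn] definable_iff [dfn] definable_imp [dfn] definable_ex [dfn]
  definable_all [dfn] atom_var [dfn] atom_const [dfn]

text \<open>This rule and the following ones admit arbitrary atoms. Below a quantifier an argument t
  reappears as \<open>t (\<lambda>i. e (Suc i))\<close>, which \<open>atom_ren\<close> recognises as
  an atom again.\<close>

lemma definable_m_empty [dfn]:
  assumes "atom t"
  shows "definable (\<lambda>e. m_empty (t e))"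
  unfolding m_empty_def by (intro dfn assms assms[THEN atom_ren])

lemma definable_m_succ [dfn]:
  assumes "atom t" "atom u"
  shows "definable (\<lambda>e. m_succ (t e) (u e))"
  unfolding m_succ_def by (intro dfn assms assms[THEN atom_ren])

lemma definable_m_upair [dfn]:
  assumes "atom t" "atom u" "atom v"
  shows "definable (\<lambda>e. m_upair (t e) (u e) (v e))"
  unfolding m_upair_def by (intro dfn assms assms[THEN atom_ren])

lemma definable_m_inductive [dfn]:
  assumes "atom t"
  shows "definable (\<lambda>e. m_inductive (t e))"
  unfolding m_inductive_def by (intro dfn assms assms[THEN atom_ren])

lemma definable_m_pair [dfn]:
  assumes "atom t" "atom u" "atom v"
  shows "definable (\<lambda>e. m_pair (t e) (u e) (v e))"
  unfolding m_pair_def by (intro dfn assms assms[THEN atom_ren])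

lemma definable_m_maps [dfn]:
  assumes "atom t" "atom u" "atom v"
  shows "definable (\<lambda>e. m_maps (t e) (u e) (v e))"
  unfolding m_maps_def by (intro dfn assms assms[THEN atom_ren])

lemma definable_m_fun_on [dfn]:
  assumes "atom t" "atom u"
  shows "definable (\<lambda>e. m_fun_on (t e) (u e))"
  unfolding m_fun_on_def by (intro dfn assms assms[THEN atom_ren])

lemma definable_m_fun_into [dfn]:
  assumes "atom t" "atom u" "atom v"
  shows "definable (\<lambda>e. m_fun_into (t e) (u e) (v e))"
  unfolding m_fun_into_def by (intro dfn assms assms[THEN atom_ren])

lemma definable_m_op [dfn]:
  assumes "atom t" "atom u" "atom v" "atom w"
  shows "definable (\<lambda>e. m_op (t e) (u e) (v e) (w e))"
  unfolding m_op_def by (intro dfn assms assms[THEN atom_ren])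

lemma definable_m_leq [dfn]:
  assumes "atom t" "atom u" "atom v"
  shows "definable (\<lambda>e. m_leq (t e) (u e) (v e))"
  unfolding m_leq_def by (intro dfn assms assms[THEN atom_ren])

lemma definable_m_abs_diff [dfn]:
  assumes "atom t" "atom u" "atom v" "atom w" "atom a" "atom b"
  shows "definable (\<lambda>e. m_abs_diff (t e) (u e) (v e) (w e) (a e) (b e))"
  unfolding m_abs_diff_def by (intro dfn assms assms[THEN atom_ren])

end

section \<open>Models of ZF\<close>

lemma ZF_satD:
  assumes "\<And>p e. p \<in> ZF \<Longrightarrow> sat E Q e p"
  shows "holds E Q r 0 s extensionality" "holds E Q r 0 s foundation" "holds E Q r 0 s pairing"
    "holds E Q r 0 s union_axiom" "holds E Q r 0 s power_set" "holds E Q r 0 s infinity"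
    "holds E Q r 0 s (separation \<phi>)"
  by (simp_all add: sat_sentence[symmetric] assms ZF_def)

text \<open>With finitely many classes, pairing and union would collect the whole universe into one
  set s, and Russell's paradox applies to s. Equality is still a congruence Q here because this is
  used before the quotient is formed.\<close>

lemma ZF_infinite:
  assumes c: "congruence E Q" and ax: "\<And>p e. p \<in> ZF \<Longrightarrow> sat E Q e p" and "finite S"
  shows "\<exists>x. \<forall>y\<in>S. \<not> Q x y"
proof (rule ccontr)
  assume "\<not> ?thesis"
  then have S: "\<exists>y\<in>S. Q x y" for x by blast
  have refl: "Q x x" for x using c by (simp add: congruence_def equivp_reflp)
  have cong: "Q x y \<Longrightarrow> E y z \<Longrightarrow> E x z" for x y z using c by (simp add: congruence_def)
  have pair: "\<exists>p. \<forall>z. E z p \<longleftrightarrow> Q z x \<or> Q z y" for x y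
    using ZF_satD(3)[OF ax, where r = undefined and s = undefined] by (simp add: pairing_def holds)
  have union: "\<exists>u. \<forall>z. E z u \<longleftrightarrow> (\<exists>y. E y x \<and> E z y)" for x
    using ZF_satD(4)[OF ax, where r = undefined and s = undefined]
    by (simp add: union_axiom_def holds)
  have "\<exists>s. \<forall>y\<in>S. E y s"
    using \<open>finite S\<close>
  proof (induction S rule: finite_induct)
    case (insert y S)
    then obtain s where s: "\<forall>y\<in>S. E y s" by blast
    obtain p where p: "\<forall>z. E z p \<longleftrightarrow> Q z y \<or> Q z y" using pair by blast
    obtain q where q: "\<forall>z. E z q \<longleftrightarrow> Q z s \<or> Q z p" using pair by blast
    obtain u where u: "\<forall>z. E z u \<longleftrightarrow> (\<exists>v. E v q \<and> E z v)" using union by blast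
    have "\<forall>z\<in>insert y S. E z u" using s p q u refl by blast
    then show ?case ..
  qed simp
  then obtain s where s: "\<forall>y\<in>S. E y s" ..
  obtain b where b: "\<forall>x. E x b \<longleftrightarrow> E x s \<and> \<not> E x x"
    using ZF_satD(7)[OF ax, where r = undefined and s = undefined and \<phi> = "FImp (FMem 0 0) FBot"]
    by (simp add: separation_def holds holds_app1) blast
  have "E b s" using S[of b] s cong by blast
  with b show False by blast
qed

locale zf_model = membership +
  assumes ext: "(\<And>z. z \<epsilon> x \<longleftrightarrow> z \<epsilon> y) \<Longrightarrow> x = y"
    and foundation: "y \<epsilon> x \<Longrightarrow> \<exists>y. y \<epsilon> x \<and> \<not> (\<exists>z. z \<epsilon> x \<and> z \<epsilon> y)"
    and pairing: "\<exists>p. m_upair p x y"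
    and union: "\<exists>u. m_union u x"
    and power: "\<exists>p. \<forall>z. z \<epsilon> p \<longleftrightarrow> m_sub z x"
    and infinity: "\<exists>w. m_inductive w"
    and separation: "definable (\<lambda>e. P (e 0)) \<Longrightarrow> \<exists>b. \<forall>x. x \<epsilon> b \<longleftrightarrow> x \<epsilon> a \<and> P x"

lemma zf_modelI:
  assumes ax: "\<And>p e. p \<in> ZF \<Longrightarrow> sat E (=) e p"
  shows "zf_model E"
proof -
  interpret membership E .
  note sat = ZF_satD[OF ax, where r = undefined and s = undefined]
  show ?thesis
  proof
    fix x y :: 'a assume "\<And>z. E z x \<longleftrightarrow> E z y"
    then show "x = y" using sat(1) by (simp add: extensionality_def holds)
  next
    fix x y assume "E y x"
    then show "\<exists>y. E y x \<and> \<not> (\<exists>z. E z x \<and> E z y)"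
      using sat(2) by (simp add: foundation_def holds) blast
  next
    fix x y show "\<exists>p. m_upair p x y"
      using sat(3) by (simp add: pairing_def holds m_upair_def)
  next
    fix x show "\<exists>u. m_union u x"
      using sat(4) by (simp add: union_axiom_def holds m_union_def)
  next
    fix x show "\<exists>p. \<forall>z. E z p \<longleftrightarrow> m_sub z x"
      using sat(5) by (simp add: power_set_def holds)
  next
    show "\<exists>w. m_inductive w"
      using sat(6) by (simp add: infinity_def holds)
  next
    fix P a assume "definable (\<lambda>e. P (e 0))"
    then obtain g p where P: "\<And>x e. P (push x e 0) = sat E (=) (push x (\<lambda>i. g i e)) p"
      by (rule definable_push) (rule that)
    \<comment> \<open>\<open>P (push x e 0)\<close> does not depend on e, so the remaining atoms may
      be evaluated in any environment; their values become the parameters of the scheme.\<close>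
    have "holds E (=) (\<lambda>i. g i undefined) 0 undefined (separation p)"
      by (rule ZF_satD(7)[OF ax])
    then show "\<exists>b. \<forall>x. E x b \<longleftrightarrow> E x a \<and> P x"
      using P by (simp add: separation_def holds holds_app1)
  qed
qed

context zf_model
begin

text \<open>Foundation for the pair of x and y. Injectivity of \<open>suc\<close> follows from
  it.\<close>

lemma mem_asym: "x \<epsilon> y \<Longrightarrow> \<not> y \<epsilon> x"
proof
  assume xy: "x \<epsilon> y" "y \<epsilon> x"
  obtain p where "m_upair p x y" using pairing by blast
  then show False using foundation[of x p] xy by (auto simp: m_upair_def)
qed

subsection \<open>Pairs, relations and functions\<close>

definition upair :: "'a \<Rightarrow> 'a \<Rightarrow> 'a" where
  "upair x y = (THE p. m_upair p x y)"

lemma m_upair_iff: "m_upair p x y \<longleftrightarrow> p = upair x y"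
proof -
  obtain q where q: "m_upair q x y" using pairing by blast
  have "q = q'" if "m_upair q' x y" for q'
    using q that by (intro ext) (simp add: m_upair_def)
  with q show ?thesis unfolding upair_def by (metis the_equality)
qed

lemma mem_upair [simp]: "z \<epsilon> upair x y \<longleftrightarrow> z = x \<or> z = y"
  using m_upair_iff[of "upair x y" x y] by (simp add: m_upair_def)

definition opair :: "'a \<Rightarrow> 'a \<Rightarrow> 'a" where
  "opair x y = upair (upair x x) (upair x y)"

lemma m_pair_iff: "m_pair p x y \<longleftrightarrow> p = opair x y"
  by (simp add: m_pair_def m_upair_iff opair_def)

lemma upair_eq_iff: "upair x y = upair u v \<longleftrightarrow> x = u \<and> y = v \<or> x = v \<and> y = u"
  by (metis mem_upair ext)

lemma opair_eq_iff [simp]: "opair x y = opair u v \<longleftrightarrow> x = u \<and> y = v"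
  by (auto simp: opair_def upair_eq_iff)

lemma m_maps_iff: "m_maps f x y \<longleftrightarrow> opair x y \<epsilon> f"
  by (simp add: m_maps_def m_pair_iff)

lemma m_op_iff: "m_op f x y z \<longleftrightarrow> opair (opair x y) z \<epsilon> f"
  by (simp add: m_op_def m_maps_iff m_pair_iff)

lemma ex_power: obtains p where "\<And>z. z \<epsilon> p \<longleftrightarrow> m_sub z x"
  using power[of x] by blast

lemma ex_union: obtains u where "\<And>z. z \<epsilon> u \<longleftrightarrow> (\<exists>y. y \<epsilon> x \<and> z \<epsilon> y)"
  using union[of x] unfolding m_union_def by blast

lemma ex_binary_union: obtains u where "\<And>z. z \<epsilon> u \<longleftrightarrow> z \<epsilon> x \<or> z \<epsilon> y"
  by (rule ex_union[of "upair x y"]) auto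

lemma ex_subset:
  assumes "definable (\<lambda>e. P (e 0))"
  obtains b where "\<And>x. x \<epsilon> b \<longleftrightarrow> x \<epsilon> a \<and> P x"
  using separation[OF assms, of a] by blast

text \<open>Kuratowski pairs of elements of a set u lie in its double power set. A superset of the
  product suffices, as separation cuts it down afterwards.\<close>

lemma ex_product: obtains P where "\<And>x y. x \<epsilon> A \<Longrightarrow> y \<epsilon> B \<Longrightarrow> opair x y \<epsilon> P"
proof -
  obtain u where u: "\<And>z. z \<epsilon> u \<longleftrightarrow> z \<epsilon> A \<or> z \<epsilon> B" by (rule ex_binary_union[of A B]) (rule that)
  obtain p where p: "\<And>z. z \<epsilon> p \<longleftrightarrow> m_sub z u" by (rule ex_power[of u]) (rule that)
  obtain q where q: "\<And>z. z \<epsilon> q \<longleftrightarrow> m_sub z p" by (rule ex_power[of p]) (rule that)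
  show ?thesis by (rule that[of q]) (auto simp: q p u m_sub_def opair_def)
qed

lemma ex_relation:
  assumes "definable (\<lambda>e. R (e (Suc 0)) (e 0))"
  obtains f where "\<And>x y. m_maps f x y \<longleftrightarrow> x \<epsilon> A \<and> y \<epsilon> B \<and> R x y"
    "\<And>p. p \<epsilon> f \<Longrightarrow> \<exists>x y. x \<epsilon> A \<and> y \<epsilon> B \<and> p = opair x y"
proof -
  obtain P where P: "\<And>x y. x \<epsilon> A \<Longrightarrow> y \<epsilon> B \<Longrightarrow> opair x y \<epsilon> P"
    by (rule ex_product[of A B]) (rule that)
  have "definable (\<lambda>e. \<exists>x y. m_pair (e 0) x y \<and> x \<epsilon> A \<and> y \<epsilon> B \<and> R x y)"
    by (intro dfn definable_ren[OF assms, of "\<lambda>i. i"])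
  then obtain f where f: "\<And>p. p \<epsilon> f \<longleftrightarrow> p \<epsilon> P \<and> (\<exists>x y. m_pair p x y \<and> x \<epsilon> A \<and> y \<epsilon> B \<and> R x y)"
    by (rule ex_subset[of _ P]) (rule that)
  show ?thesis by (rule that[of f]) (auto simp: m_maps_iff f m_pair_iff P)
qed

lemma m_fun_onI:
  assumes "\<And>p. p \<epsilon> f \<Longrightarrow> \<exists>x y. x \<epsilon> A \<and> p = opair x y" "\<And>x. x \<epsilon> A \<Longrightarrow> \<exists>y. m_maps f x y"
    "\<And>x y z. m_maps f x y \<Longrightarrow> m_maps f x z \<Longrightarrow> y = z"
  shows "m_fun_on f A"
  unfolding m_fun_on_def m_pair_iff using assms by meson

lemma m_fun_onD:
  assumes "m_fun_on f A"
  shows "m_maps f x y \<Longrightarrow> x \<epsilon> A" "x \<epsilon> A \<Longrightarrow> \<exists>y. m_maps f x y"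
    "m_maps f x y \<Longrightarrow> m_maps f x z \<Longrightarrow> y = z"
proof -
  show *: "x \<epsilon> A" if "m_maps f x y" for x y
    using assms that unfolding m_fun_on_def m_pair_iff m_maps_iff by fastforce
  show "x \<epsilon> A \<Longrightarrow> \<exists>y. m_maps f x y"
    using assms unfolding m_fun_on_def by blast
  show "m_maps f x y \<Longrightarrow> m_maps f x z \<Longrightarrow> y = z"
    using assms *[of x y] unfolding m_fun_on_def by blast
qed

lemma m_fun_intoD:
  assumes "m_fun_into f A B"
  shows "m_maps f x y \<Longrightarrow> x \<epsilon> A" "m_maps f x y \<Longrightarrow> y \<epsilon> B" "x \<epsilon> A \<Longrightarrow> \<exists>y. m_maps f x y"
    "m_maps f x y \<Longrightarrow> m_maps f x z \<Longrightarrow> y = z"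
  using assms m_fun_onD[of f A] unfolding m_fun_into_def by blast+

lemma m_bijectionD:
  assumes "m_bijection f A B"
  shows "m_maps f x y \<Longrightarrow> x \<epsilon> A" "m_maps f x y \<Longrightarrow> y \<epsilon> B" "x \<epsilon> A \<Longrightarrow> \<exists>y. m_maps f x y"
    "m_maps f x y \<Longrightarrow> m_maps f x z \<Longrightarrow> y = z"
    "y \<epsilon> B \<Longrightarrow> \<exists>x. m_maps f x y" "m_maps f x y \<Longrightarrow> m_maps f z y \<Longrightarrow> x = z"
proof -
  have i: "m_fun_into f A B" using assms by (simp add: m_bijection_def)
  show "m_maps f x y \<Longrightarrow> x \<epsilon> A" "m_maps f x y \<Longrightarrow> y \<epsilon> B" "x \<epsilon> A \<Longrightarrow> \<exists>y. m_maps f x y"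
    "m_maps f x y \<Longrightarrow> m_maps f x z \<Longrightarrow> y = z"
    using m_fun_intoD[OF i] by blast+
  show "y \<epsilon> B \<Longrightarrow> \<exists>x. m_maps f x y"
    using assms unfolding m_bijection_def by blast
  show "m_maps f x y \<Longrightarrow> m_maps f z y \<Longrightarrow> x = z"
    using assms m_fun_intoD(2)[OF i, of x y] unfolding m_bijection_def by blast
qed

text \<open>The gateway through which functions enter the model. R has to be total and single-valued
  on A beforehand, so no choice made in HOL can slip in.\<close>

lemma ex_function:
  assumes d: "definable (\<lambda>e. R (e (Suc 0)) (e 0))"
    and ex: "\<And>x. x \<epsilon> A \<Longrightarrow> \<exists>y. y \<epsilon> B \<and> R x y"
    and un: "\<And>x y z. x \<epsilon> A \<Longrightarrow> y \<epsilon> B \<Longrightarrow> z \<epsilon> B \<Longrightarrow> R x y \<Longrightarrow> R x z \<Longrightarrow> y = z"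
  obtains f where "m_fun_into f A B" "\<And>x y. m_maps f x y \<longleftrightarrow> x \<epsilon> A \<and> y \<epsilon> B \<and> R x y"
proof -
  obtain f where f: "\<And>x y. m_maps f x y \<longleftrightarrow> x \<epsilon> A \<and> y \<epsilon> B \<and> R x y"
    "\<And>p. p \<epsilon> f \<Longrightarrow> \<exists>x y. x \<epsilon> A \<and> y \<epsilon> B \<and> p = opair x y"
    using d by (rule ex_relation[of R A B]) (rule that)
  have "m_fun_on f A"
    by (rule m_fun_onI) (use f ex un in blast)+
  then have "m_fun_into f A B" using f(1) by (simp add: m_fun_into_def)
  then show ?thesis using f(1) by (rule that)
qed

lemma ex_bijection:
  assumes d: "definable (\<lambda>e. R (e (Suc 0)) (e 0))"
    and ex: "\<And>x. x \<epsilon> A \<Longrightarrow> \<exists>y. y \<epsilon> B \<and> R x y" "\<And>y. y \<epsilon> B \<Longrightarrow> \<exists>x. x \<epsilon> A \<and> R x y"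
    and un: "\<And>x y z. x \<epsilon> A \<Longrightarrow> y \<epsilon> B \<Longrightarrow> z \<epsilon> B \<Longrightarrow> R x y \<Longrightarrow> R x z \<Longrightarrow> y = z"
      "\<And>x y z. x \<epsilon> A \<Longrightarrow> z \<epsilon> A \<Longrightarrow> y \<epsilon> B \<Longrightarrow> R x y \<Longrightarrow> R z y \<Longrightarrow> x = z"
  shows "\<exists>f. m_bijection f A B"
proof -
  obtain f where f: "m_fun_into f A B" "\<And>x y. m_maps f x y \<longleftrightarrow> x \<epsilon> A \<and> y \<epsilon> B \<and> R x y"
    by (rule ex_function[where R = R and A = A and B = B, OF d ex(1) un(1)]) (assumption | rule that)+
  have "m_bijection f A B"
    unfolding m_bijection_def using f ex(2) un(2) by meson
  then show ?thesis ..
qed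

lemma ex_identity: "\<exists>f. m_bijection f A A"
  by (rule ex_bijection[where R = "(=)"]) (auto intro: dfn)

subsection \<open>The natural numbers of a model\<close>

definition zero :: 'a where "zero = (THE x. m_empty x)"
definition suc :: "'a \<Rightarrow> 'a" where "suc x = (THE y. m_succ y x)"
definition omega :: 'a where "omega = (THE w. m_omega w)"

lemma m_empty_iff: "m_empty x \<longleftrightarrow> x = zero"
proof -
  obtain w where "m_inductive w" using infinity by blast
  then obtain e where e: "m_empty e" unfolding m_inductive_def by blast
  have "x = e" if "m_empty x" for x
    using e that by (intro ext) (simp add: m_empty_def)
  with e show ?thesis unfolding zero_def by (metis the_equality)
qed

lemma not_mem_zero [simp]: "\<not> z \<epsilon> zero"
  using m_empty_iff[of zero] by (simp add: m_empty_def)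

lemma m_succ_iff: "m_succ y x \<longleftrightarrow> y = suc x"
proof -
  obtain u where "\<And>z. z \<epsilon> u \<longleftrightarrow> z \<epsilon> x \<or> z \<epsilon> upair x x"
    by (rule ex_binary_union[of x "upair x x"]) (rule that)
  then have u: "m_succ u x" by (simp add: m_succ_def)
  have "y = u" if "m_succ y x" for y
    using u that by (intro ext) (simp add: m_succ_def)
  with u show ?thesis unfolding suc_def by (metis the_equality)
qed

lemma mem_suc [simp]: "z \<epsilon> suc x \<longleftrightarrow> z \<epsilon> x \<or> z = x"
  using m_succ_iff[of "suc x" x] by (simp add: m_succ_def)

lemma suc_neq_zero [simp]: "suc x \<noteq> zero" "zero \<noteq> suc x"
  using mem_suc[of x x] by (metis not_mem_zero)+

lemma suc_eq_iff [simp]: "suc x = suc y \<longleftrightarrow> x = y"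
  by (metis mem_suc mem_asym)

lemma m_inductive_iff: "m_inductive w \<longleftrightarrow> zero \<epsilon> w \<and> (\<forall>x. x \<epsilon> w \<longrightarrow> suc x \<epsilon> w)"
  by (simp add: m_inductive_def m_empty_iff m_succ_iff)

lemma m_omega_iff: "m_omega w \<longleftrightarrow> w = omega"
proof -
  obtain w where w: "m_inductive w" using infinity by blast
  \<comment> \<open>The intersection of all inductive sets, cut out of one of them by
    separation.\<close>
  have d: "definable (\<lambda>e. \<forall>v. m_inductive v \<longrightarrow> e 0 \<epsilon> v)"
    by (intro dfn)
  obtain b where b: "\<And>x. x \<epsilon> b \<longleftrightarrow> x \<epsilon> w \<and> (\<forall>v. m_inductive v \<longrightarrow> x \<epsilon> v)"
    by (rule ex_subset[OF d, of w]) (rule that)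
  have "m_inductive b" using w unfolding m_inductive_iff b by blast
  then have o: "m_omega b" unfolding m_omega_def m_sub_def b by blast
  have "x = b" if "m_omega x" for x
    using o that unfolding m_omega_def m_sub_def by (intro ext) blast
  with o show ?thesis unfolding omega_def by (metis the_equality)
qed

lemma m_inductive_omega: "m_inductive omega"
  using m_omega_iff[of omega] by (simp add: m_omega_def)

lemma zero_mem_omega [simp]: "zero \<epsilon> omega" and suc_mem_omega [simp]: "x \<epsilon> omega \<Longrightarrow> suc x \<epsilon> omega"
  using m_inductive_omega unfolding m_inductive_iff by blast+

text \<open>Separation turns P into an inductive subset of \<open>omega\<close>. For an undefinable
  P the claim could fail, as \<open>omega\<close> may contain non-standard elements.\<close>

lemma omega_induct:
  assumes n: "n \<epsilon> omega" and d: "definable (\<lambda>e. P (e 0))" and 0: "P zero"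
    and step: "\<And>n. n \<epsilon> omega \<Longrightarrow> P n \<Longrightarrow> P (suc n)"
  shows "P n"
proof -
  obtain b where b: "\<And>x. x \<epsilon> b \<longleftrightarrow> x \<epsilon> omega \<and> P x"
    using d by (rule ex_subset[of P omega]) (rule that)
  have "m_inductive b" unfolding m_inductive_iff b using 0 step by simp
  then have "m_sub omega b" using m_omega_iff[of omega] by (simp add: m_omega_def)
  then show ?thesis using n by (simp add: m_sub_def b)
qed

lemma zero_or_mem: "n \<epsilon> omega \<Longrightarrow> zero = n \<or> zero \<epsilon> n"
  by (erule omega_induct[where P = "\<lambda>n. zero = n \<or> zero \<epsilon> n"]) (auto intro!: dfn)

lemma suc_mem_or_eq: "n \<epsilon> omega \<Longrightarrow> m \<epsilon> n \<Longrightarrow> suc m \<epsilon> n \<or> suc m = n"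
proof -
  assume n: "n \<epsilon> omega"
  have d: "definable (\<lambda>e. m \<epsilon> e 0 \<longrightarrow> suc m \<epsilon> e 0 \<or> suc m = e 0)" by (intro dfn)
  have "m \<epsilon> n \<longrightarrow> suc m \<epsilon> n \<or> suc m = n"
    by (rule omega_induct[OF n d]) auto
  then show "m \<epsilon> n \<Longrightarrow> suc m \<epsilon> n \<or> suc m = n" by blast
qed

text \<open>Induction on n with m fixed, membership being the order of \<open>omega\<close>; if n
  lies below m, the successor step is \<open>suc_mem_or_eq\<close>.\<close>

lemma omega_linear:
  assumes n: "n \<epsilon> omega" and m: "m \<epsilon> omega"
  shows "m \<epsilon> n \<or> m = n \<or> n \<epsilon> m"
proof -
  have d: "definable (\<lambda>e. m \<epsilon> e 0 \<or> m = e 0 \<or> e 0 \<epsilon> m)" by (intro dfn)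
  show ?thesis
    by (rule omega_induct[OF n d]) (use m zero_or_mem suc_mem_or_eq in auto)
qed

lemma omega_least:
  assumes d: "definable (\<lambda>e. P (e 0))" and n: "n \<epsilon> omega" "P n"
  obtains m where "m \<epsilon> omega" "P m" "\<And>k. k \<epsilon> omega \<Longrightarrow> P k \<Longrightarrow> \<not> k \<epsilon> m"
proof -
  obtain b where b: "\<And>x. x \<epsilon> b \<longleftrightarrow> x \<epsilon> omega \<and> P x"
    using d by (rule ex_subset[of P omega]) (rule that)
  then obtain m where "m \<epsilon> b" "\<not> (\<exists>z. z \<epsilon> b \<and> z \<epsilon> m)" using foundation[of n b] n by blast
  then show ?thesis using that b by blast
qed

definition injective_into :: "'a \<Rightarrow> 'a \<Rightarrow> 'a \<Rightarrow> bool" where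
  "injective_into f A B \<longleftrightarrow> m_fun_into f A B \<and>
     (\<forall>x y z. m_maps f x z \<and> m_maps f y z \<longrightarrow> x = y)"

text \<open>Shows that \<open>omega\<close> is infinite in the sense of the model, where n may be
  non-standard; hence the induction takes place inside the model.\<close>

lemma pigeonhole: "n \<epsilon> omega \<Longrightarrow> \<not> (\<exists>f. injective_into f omega n)"
proof (erule omega_induct)
  show "definable (\<lambda>e. \<not> (\<exists>f. injective_into f omega (e 0)))"
    unfolding injective_into_def by (intro dfn)
next
  show "\<not> (\<exists>f. injective_into f omega zero)"
    unfolding injective_into_def using m_fun_intoD(2,3) by (metis not_mem_zero zero_mem_omega)
next
  fix n assume n: "n \<epsilon> omega" and IH: "\<not> (\<exists>f. injective_into f omega n)"
  show "\<not> (\<exists>f. injective_into f omega (suc n))"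
  proof
    assume "\<exists>f. injective_into f omega (suc n)"
    then obtain f where f: "m_fun_into f omega (suc n)"
      and inj: "\<And>x y z. m_maps f x z \<Longrightarrow> m_maps f y z \<Longrightarrow> x = y"
      unfolding injective_into_def by blast
    note f = m_fun_intoD[OF f]
    obtain c where c: "m_maps f zero c" using f(3)[OF zero_mem_omega] by blast
    \<comment> \<open>The map f after \<open>suc\<close> no longer takes the value c = f(0), so c is
      free to replace the value n, and the result injects \<open>omega\<close> into n.\<close>
    define R where "R m y \<longleftrightarrow> (\<exists>s v. m_succ s m \<and> m_maps f s v \<and> (v \<noteq> n \<and> y = v \<or> v = n \<and> y = c))"
      for m y
    have d: "definable (\<lambda>e. R (e (Suc 0)) (e 0))" unfolding R_def by (intro dfn)
    have R: "R m y \<longleftrightarrow> (\<exists>v. m_maps f (suc m) v \<and> (v \<noteq> n \<and> y = v \<or> v = n \<and> y = c))" for m y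
      by (simp add: R_def m_succ_iff)
    have neq: "v \<noteq> c" if "m_maps f (suc m) v" for m v using inj[OF that, of zero] c by auto
    obtain g where g: "m_fun_into g omega n" "\<And>x y. m_maps g x y \<longleftrightarrow> x \<epsilon> omega \<and> y \<epsilon> n \<and> R x y"
    proof (rule ex_function[OF d])
      fix m assume "m \<epsilon> omega"
      then obtain v where v: "m_maps f (suc m) v" using f(3)[of "suc m"] by auto
      show "\<exists>y. y \<epsilon> n \<and> R m y"
      proof (cases "v = n")
        case True
        then have "c \<epsilon> n" using f(2)[OF c] neq[OF v] by auto
        then show ?thesis using v True by (auto simp: R)
      next
        case False
        then show ?thesis using v f(2)[OF v] by (auto simp: R)
      qed
    next
      show "R x y \<Longrightarrow> R x z \<Longrightarrow> y = z" for x y z unfolding R using f(4) by blast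
    qed (rule that)
    have "x = y" if "R x z" "R y z" for x y z
      using that neq inj unfolding R by (metis suc_eq_iff)
    then have "injective_into g omega n" using g unfolding injective_into_def by blast
    with IH show False by blast
  qed
qed

lemma omega_not_finite: "\<not> m_finite omega"
proof
  assume "m_finite omega"
  then obtain n f where n: "n \<epsilon> omega" and f: "m_bijection f omega n"
    unfolding m_finite_def m_omega_iff by blast
  have "injective_into f omega n"
    unfolding injective_into_def using f m_bijectionD(6)[OF f] by (auto simp: m_bijection_def)
  with pigeonhole[OF n] show False by blast
qed

lemma m_countable_iff: "m_countable A \<longleftrightarrow> (\<exists>B f. m_sub B omega \<and> m_bijection f A B)"
  by (auto simp: m_countable_def m_omega_iff)

lemma countable_subset_omega: "m_sub A omega \<Longrightarrow> m_countable A"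
  using ex_identity m_countable_iff by blast

end

section \<open>The additive group of the reals\<close>

locale zf_reals = zf_model +
  fixes R a l o' :: 'a
  assumes group: "m_add_group R a o'" and order: "m_order R a l o'" and complete: "m_complete R l"
    and nontrivial: "\<exists>x. x \<epsilon> R \<and> x \<noteq> o'"
begin

definition plus :: "'a \<Rightarrow> 'a \<Rightarrow> 'a" (infixl "\<oplus>" 65) where
  "x \<oplus> y = (THE z. m_op a x y z)"

abbreviation less :: "'a \<Rightarrow> 'a \<Rightarrow> bool" (infix "\<prec>" 50) where "x \<prec> y \<equiv> m_maps l x y"
abbreviation leq :: "'a \<Rightarrow> 'a \<Rightarrow> bool" (infix "\<preceq>" 50) where "x \<preceq> y \<equiv> m_leq l x y"
abbreviation abs_diff :: "'a \<Rightarrow> 'a \<Rightarrow> 'a \<Rightarrow> bool" where "abs_diff \<equiv> m_abs_diff a l o'"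

lemma m_op_plus: "m_op a x y z \<longleftrightarrow> x \<epsilon> R \<and> y \<epsilon> R \<and> z = x \<oplus> y"
proof -
  have b: "m_binop a R" using group by (simp add: m_add_group_def)
  have carr: "x \<epsilon> R \<and> y \<epsilon> R" if "m_op a x y z" for x y z
    using b that unfolding m_binop_def m_op_iff m_pair_iff by fastforce
  have ex1: "\<exists>!z. m_op a x y z" if "x \<epsilon> R" "y \<epsilon> R" for x y
    using b that unfolding m_binop_def by metis
  show ?thesis
    using carr[of x y z] theI'[OF ex1, of x y] ex1[of x y] unfolding plus_def by blast
qed

lemma plus_closed [simp]: "x \<epsilon> R \<Longrightarrow> y \<epsilon> R \<Longrightarrow> x \<oplus> y \<epsilon> R"
  using group m_op_plus[of x y "x \<oplus> y"]
  unfolding m_add_group_def m_binop_def m_op_iff m_pair_iff by fastforce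

lemma zero_closed [simp]: "o' \<epsilon> R"
  using group by (simp add: m_add_group_def m_neutral_def)

lemma plus_zero [simp]: "x \<epsilon> R \<Longrightarrow> x \<oplus> o' = x"
  using group by (simp add: m_add_group_def m_neutral_def m_op_plus)

lemma plus_comm: "x \<epsilon> R \<Longrightarrow> y \<epsilon> R \<Longrightarrow> x \<oplus> y = y \<oplus> x"
  using group by (simp add: m_add_group_def m_comm_def m_op_plus)

lemma plus_assoc: "x \<epsilon> R \<Longrightarrow> y \<epsilon> R \<Longrightarrow> z \<epsilon> R \<Longrightarrow> x \<oplus> y \<oplus> z = x \<oplus> (y \<oplus> z)"
  using group by (simp add: m_add_group_def m_assoc_def m_op_plus)

lemma ex_minus: "x \<epsilon> R \<Longrightarrow> \<exists>y. y \<epsilon> R \<and> x \<oplus> y = o'"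
  using group unfolding m_add_group_def m_op_plus by metis

lemma less_closed: "x \<prec> y \<Longrightarrow> x \<epsilon> R" "x \<prec> y \<Longrightarrow> y \<epsilon> R"
proof -
  have "\<forall>p. p \<epsilon> l \<longrightarrow> (\<exists>u v. u \<epsilon> R \<and> v \<epsilon> R \<and> p = opair u v)"
    using order unfolding m_order_def m_pair_iff by (rule conjunct1)
  then show "x \<prec> y \<Longrightarrow> x \<epsilon> R" "x \<prec> y \<Longrightarrow> y \<epsilon> R"
    unfolding m_maps_iff by (metis opair_eq_iff)+
qed

lemma less_irrefl: "\<not> x \<prec> x"
  using order unfolding m_order_def by blast

lemma less_trans: "x \<prec> y \<Longrightarrow> y \<prec> z \<Longrightarrow> x \<prec> z"
  using order unfolding m_order_def by blast

lemma less_linear: "x \<epsilon> R \<Longrightarrow> y \<epsilon> R \<Longrightarrow> x \<prec> y \<or> x = y \<or> y \<prec> x"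
  using order unfolding m_order_def by blast

lemma plus_less_mono: "x \<prec> y \<Longrightarrow> z \<epsilon> R \<Longrightarrow> x \<oplus> z \<prec> y \<oplus> z"
  using order less_closed[of x y] unfolding m_order_def m_op_plus by blast

lemma leq_refl [simp]: "x \<preceq> x" and less_imp_leq: "x \<prec> y \<Longrightarrow> x \<preceq> y"
  by (simp_all add: m_leq_def)

lemma leq_trans: "x \<preceq> y \<Longrightarrow> y \<preceq> z \<Longrightarrow> x \<preceq> z"
  and leq_less_trans: "x \<preceq> y \<Longrightarrow> y \<prec> z \<Longrightarrow> x \<prec> z"
  and less_leq_trans: "x \<prec> y \<Longrightarrow> y \<preceq> z \<Longrightarrow> x \<prec> z"
  by (auto simp: m_leq_def intro: less_trans)

lemma plus_leq_mono: "x \<preceq> y \<Longrightarrow> z \<epsilon> R \<Longrightarrow> x \<oplus> z \<preceq> y \<oplus> z"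
  by (auto simp: m_leq_def intro: plus_less_mono)

lemma plus_leq_cancel:
  assumes "z \<oplus> x \<preceq> z \<oplus> y" "x \<epsilon> R" "y \<epsilon> R" "z \<epsilon> R"
  shows "x \<preceq> y"
proof (rule ccontr)
  assume "\<not> x \<preceq> y"
  then have "y \<prec> x" using less_linear assms by (auto simp: m_leq_def)
  then have "y \<oplus> z \<prec> x \<oplus> z" using assms by (intro plus_less_mono)
  then have "z \<oplus> y \<prec> z \<oplus> x" using assms plus_comm by simp
  then show False using assms less_irrefl less_leq_trans by blast
qed

lemma leq_antisym: "x \<preceq> y \<Longrightarrow> y \<preceq> x \<Longrightarrow> x = y"
  using less_trans less_irrefl unfolding m_leq_def by blast

lemma plus_cancel: "z \<oplus> x = z \<oplus> y \<Longrightarrow> x \<epsilon> R \<Longrightarrow> y \<epsilon> R \<Longrightarrow> z \<epsilon> R \<Longrightarrow> x = y"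
  using plus_leq_cancel leq_antisym leq_refl by metis

lemma abs_diff_iff: "abs_diff x y d \<longleftrightarrow> (\<exists>u. y \<epsilon> R \<and> u \<epsilon> R \<and> x = y \<oplus> u \<and>
    (o' \<preceq> u \<and> d = u \<or> u \<prec> o' \<and> d \<epsilon> R \<and> u \<oplus> d = o'))"
  unfolding m_abs_diff_def m_op_plus eq_commute[of o'] by blast

lemma abs_diff_self: "x \<epsilon> R \<Longrightarrow> abs_diff x x d \<longleftrightarrow> d = o'"
proof
  assume x: "x \<epsilon> R"
  show "abs_diff x x d" if "d = o'"
    unfolding abs_diff_iff using x that by (intro exI[of _ o']) simp
  assume "abs_diff x x d"
  then obtain u where u: "u \<epsilon> R" "x = x \<oplus> u"
    and d: "o' \<preceq> u \<and> d = u \<or> u \<prec> o' \<and> d \<epsilon> R \<and> u \<oplus> d = o'"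
    unfolding abs_diff_iff by blast
  have "u = o'" using plus_cancel[of x u o'] u x by simp
  then show "d = o'" using d less_irrefl by blast
qed

lemma abs_diff_closed: "abs_diff x y d \<Longrightarrow> d \<epsilon> R"
  unfolding abs_diff_iff by blast

lemma ex_abs_diff:
  assumes "x \<epsilon> R" "y \<epsilon> R"
  shows "\<exists>d. abs_diff x y d"
proof -
  obtain y' where y': "y' \<epsilon> R" "y \<oplus> y' = o'" using ex_minus assms by blast
  have "y \<oplus> (y' \<oplus> x) = x" using assms y' plus_comm[of o' x] plus_assoc[of y y' x] by simp
  then obtain u where u: "u \<epsilon> R" "x = y \<oplus> u" using assms y' by (metis plus_closed)
  obtain v where v: "v \<epsilon> R" "u \<oplus> v = o'" using ex_minus u by blast
  have "o' \<preceq> u \<or> u \<prec> o'" using less_linear[of o' u] u by (auto simp: m_leq_def)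
  then show ?thesis unfolding abs_diff_iff using u v assms by blast
qed

text \<open>A distance of at least c, stated without subtraction. With x = y + u, one sign of u
  contradicts c > 0 in each case, and for the other sign d is the absolute value of u and the bound
  can be cancelled.\<close>

lemma abs_diff_far:
  assumes far: "x \<oplus> c \<preceq> y \<or> y \<oplus> c \<preceq> x" and c: "o' \<prec> c"
    and x: "x \<epsilon> R" and d: "abs_diff x y d"
  shows "c \<preceq> d"
proof -
  have cR: "c \<epsilon> R" using c by (rule less_closed)
  obtain u where y: "y \<epsilon> R" and u: "u \<epsilon> R" "x = y \<oplus> u"
    and d: "o' \<preceq> u \<and> d = u \<or> u \<prec> o' \<and> d \<epsilon> R \<and> u \<oplus> d = o'"
    using d unfolding abs_diff_iff by blast
  from far show ?thesis
  proof
    assume "x \<oplus> c \<preceq> y"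
    then have "y \<oplus> (u \<oplus> c) \<preceq> y \<oplus> o'" using u y cR by (simp add: plus_assoc)
    then have uc: "u \<oplus> c \<preceq> o'" using u y cR by (auto intro: plus_leq_cancel[of y])
    from d show ?thesis
    proof
      assume "o' \<preceq> u \<and> d = u"
      then have "o' \<oplus> c \<preceq> u \<oplus> c" using cR by (intro plus_leq_mono) auto
      then have "c \<preceq> o'" using uc cR plus_comm[of o' c] leq_trans by simp
      then show ?thesis using c less_irrefl less_leq_trans by blast
    next
      assume d: "u \<prec> o' \<and> d \<epsilon> R \<and> u \<oplus> d = o'"
      then show ?thesis using uc u cR by (auto intro: plus_leq_cancel[of u])
    qed
  next
    assume "y \<oplus> c \<preceq> x"
    then have cu: "c \<preceq> u" using u y cR by (auto intro: plus_leq_cancel[of y])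
    from d show ?thesis
    proof
      assume "u \<prec> o' \<and> d \<epsilon> R \<and> u \<oplus> d = o'"
      then show ?thesis using cu c less_irrefl less_trans leq_less_trans by blast
    qed (use cu in simp)
  qed
qed

lemma ex_positive: obtains e where "o' \<prec> e"
proof -
  obtain x where x: "x \<epsilon> R" "x \<noteq> o'" using nontrivial by blast
  obtain y where y: "y \<epsilon> R" "x \<oplus> y = o'" using ex_minus x by blast
  show ?thesis
  proof (cases "o' \<prec> x")
    case False
    then have "x \<prec> o'" using less_linear[of x o'] x by auto
    then have "x \<oplus> y \<prec> o' \<oplus> y" using y by (intro plus_less_mono)
    then show ?thesis using y plus_comm[of o' y] that by simp
  qed (rule that)
qed

subsection \<open>A uniformly separated sequence\<close>

text \<open>Recursion inside the model: the least such relation is the graph of the multiples of c.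
  The relations \<open>m_succ\<close> and \<open>m_op\<close> replace \<open>suc\<close> and
  \<open>\<oplus>\<close> because the definability rules cover them.\<close>

definition closed_graph :: "'a \<Rightarrow> 'a \<Rightarrow> bool" where
  "closed_graph c r \<longleftrightarrow> m_maps r zero o' \<and>
     (\<forall>n x s y. m_maps r n x \<and> m_succ s n \<and> m_op a x c y \<longrightarrow> m_maps r s y)"

lemma closed_graph_iff: "closed_graph c r \<longleftrightarrow> m_maps r zero o' \<and>
    (\<forall>n x. m_maps r n x \<and> x \<epsilon> R \<and> c \<epsilon> R \<longrightarrow> m_maps r (suc n) (x \<oplus> c))"
  unfolding closed_graph_def m_op_plus m_succ_iff by blast

lemma ex_multiples:
  assumes c: "c \<epsilon> R"
  obtains G where "m_fun_into G omega R" "closed_graph c G"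
    "\<And>n x. m_maps G n x \<Longrightarrow> n = zero \<and> x = o' \<or> (\<exists>m z. n = suc m \<and> m_maps G m z \<and> x = z \<oplus> c)"
proof -
  have d: "definable (\<lambda>e. \<forall>r. closed_graph c r \<longrightarrow> m_maps r (e (Suc 0)) (e 0))"
    unfolding closed_graph_def by (intro dfn)
  obtain G where G: "\<And>n x. m_maps G n x \<longleftrightarrow> n \<epsilon> omega \<and> x \<epsilon> R \<and> (\<forall>r. closed_graph c r \<longrightarrow> m_maps r n x)"
    and G_pair: "\<And>p. p \<epsilon> G \<Longrightarrow> \<exists>x y. x \<epsilon> omega \<and> y \<epsilon> R \<and> p = opair x y"
    by (rule ex_relation[where R = "\<lambda>n x. \<forall>r. closed_graph c r \<longrightarrow> m_maps r n x" and A = omega and B = R, OF d])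
      (rule that)
  have cG: "closed_graph c G"
    unfolding closed_graph_iff G using c by simp
  have inv: "n = zero \<and> x = o' \<or> (\<exists>m z. n = suc m \<and> m_maps G m z \<and> x = z \<oplus> c)"
    if "m_maps G n x" for n x
  proof -
    \<comment> \<open>The pairs of G that are the starting pair or come from a predecessor in G.
      They again form a closed graph, so by minimality they are all of G.\<close>
    define I where "I n x \<longleftrightarrow> m_maps G n x \<and> (n = zero \<and> x = o' \<or>
      (\<exists>m z. m_succ n m \<and> m_maps G m z \<and> m_op a z c x))" for n x
    have dI: "definable (\<lambda>e. I (e (Suc 0)) (e 0))" unfolding I_def by (intro dfn)
    obtain r where r: "\<And>n x. m_maps r n x \<longleftrightarrow> n \<epsilon> omega \<and> x \<epsilon> R \<and> I n x"
      by (rule ex_relation[where A = omega and B = R, OF dI]) (rule that)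
    have "closed_graph c r"
      unfolding closed_graph_iff r I_def m_succ_iff m_op_plus
      using cG c unfolding closed_graph_iff by auto
    then have "m_maps r n x" using that unfolding G by blast
    then have "I n x" unfolding r by blast
    then show ?thesis unfolding I_def m_succ_iff m_op_plus by blast
  qed
  have "m_fun_on G omega"
  proof (rule m_fun_onI)
    show "p \<epsilon> G \<Longrightarrow> \<exists>x y. x \<epsilon> omega \<and> p = opair x y" for p using G_pair by blast
  next
    fix n assume "n \<epsilon> omega"
    then show "\<exists>x. m_maps G n x"
    proof (rule omega_induct)
      show "definable (\<lambda>e. \<exists>x. m_maps G (e 0) x)" by (intro dfn)
      show "\<exists>x. m_maps G zero x" using cG unfolding closed_graph_iff by blast
      show "\<exists>x. m_maps G (suc n) x" if "n \<epsilon> omega" "\<exists>x. m_maps G n x" for n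
        using cG c that G unfolding closed_graph_iff by blast
    qed
  next
    fix n x y assume xy: "m_maps G n x" "m_maps G n y"
    then have "n \<epsilon> omega" using G by blast
    then have "\<forall>x y. m_maps G n x \<and> m_maps G n y \<longrightarrow> x = y"
    proof (rule omega_induct)
      show "definable (\<lambda>e. \<forall>x y. m_maps G (e 0) x \<and> m_maps G (e 0) y \<longrightarrow> x = y)" by (intro dfn)
      show "\<forall>x y. m_maps G zero x \<and> m_maps G zero y \<longrightarrow> x = y"
        using inv suc_neq_zero by metis
      show "\<forall>x y. m_maps G (suc n) x \<and> m_maps G (suc n) y \<longrightarrow> x = y"
        if "n \<epsilon> omega" "\<forall>x y. m_maps G n x \<and> m_maps G n y \<longrightarrow> x = y" for n
        using inv[of "suc n"] that suc_neq_zero suc_eq_iff by metis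
    qed
    with xy show "x = y" by blast
  qed
  then have "m_fun_into G omega R" unfolding m_fun_into_def using G by blast
  then show ?thesis using cG inv by (rule that)
qed

lemma ex_separated_sequence:
  obtains e G where "o' \<prec> e" "m_fun_into G omega R"
    "\<And>n m x y d. m_maps G n x \<Longrightarrow> m_maps G m y \<Longrightarrow> abs_diff x y d \<Longrightarrow> d \<preceq> e \<Longrightarrow> n = m"
proof -
  obtain e where e: "o' \<prec> e" by (rule ex_positive)
  then have eR: "e \<epsilon> R" by (rule less_closed)
  \<comment> \<open>Any step larger than e would do; twice e is one that addition provides.\<close>
  define c where "c = e \<oplus> e"
  have cR: "c \<epsilon> R" using eR by (simp add: c_def)
  have "o' \<oplus> e \<prec> c" unfolding c_def using e eR by (intro plus_less_mono)
  then have ec: "e \<prec> c" using plus_comm[of o' e] eR by simp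
  then have c: "o' \<prec> c" using e less_trans by blast
  obtain G where G: "m_fun_into G omega R" and cG: "closed_graph c G"
    and inv: "\<And>n x. m_maps G n x \<Longrightarrow>
      n = zero \<and> x = o' \<or> (\<exists>m z. n = suc m \<and> m_maps G m z \<and> x = z \<oplus> c)"
    by (rule ex_multiples[OF cR]) (rule that)
  note G_in = m_fun_intoD[OF G]
  have leq_plus: "x \<preceq> x \<oplus> c" if "x \<epsilon> R" for x
    using plus_less_mono[OF c that] plus_comm[of x o'] plus_comm[of c x] that cR
    by (simp add: m_leq_def)
  have nonneg: "\<forall>x. m_maps G n x \<longrightarrow> o' \<preceq> x" if "n \<epsilon> omega" for n
    using that
  proof (rule omega_induct)
    show "definable (\<lambda>e. \<forall>x. m_maps G (e 0) x \<longrightarrow> o' \<preceq> x)" by (intro dfn)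
    show "\<forall>x. m_maps G zero x \<longrightarrow> o' \<preceq> x" using inv suc_neq_zero leq_refl by metis
    show "\<forall>x. m_maps G (suc n) x \<longrightarrow> o' \<preceq> x" if "\<forall>x. m_maps G n x \<longrightarrow> o' \<preceq> x" for n
      using inv[of "suc n"] that leq_plus G_in(2) leq_trans suc_neq_zero suc_eq_iff by metis
  qed
  have c_leq: "c \<preceq> x" if nx: "m_maps G n x" "n \<noteq> zero" for n x
  proof -
    obtain m z where z: "m_maps G m z" "x = z \<oplus> c" using inv[OF nx(1)] nx(2) by blast
    then have "o' \<oplus> c \<preceq> z \<oplus> c" using nonneg G_in(1) cR by (intro plus_leq_mono) blast+
    then show ?thesis using z plus_comm[of o' c] cR by simp
  qed
  \<comment> \<open>Symmetric in x and y, so the induction need not know which index is larger: two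
    successors reduce to their predecessors by adding c on both sides. The use of
    \<open>m_op\<close> keeps it definable.\<close>
  define far where "far x y \<longleftrightarrow> (\<exists>z. m_op a x c z \<and> z \<preceq> y) \<or> (\<exists>z. m_op a y c z \<and> z \<preceq> x)"
    for x y
  have far: "\<forall>m x y. m_maps G n x \<and> m_maps G m y \<and> \<not> n = m \<longrightarrow> far x y" if "n \<epsilon> omega" for n
    using that
  proof (rule omega_induct)
    show "definable (\<lambda>e. \<forall>m x y. m_maps G (e 0) x \<and> m_maps G m y \<and> \<not> e 0 = m \<longrightarrow> far x y)"
      unfolding far_def by (intro dfn)
  next
    show "\<forall>m x y. m_maps G zero x \<and> m_maps G m y \<and> \<not> zero = m \<longrightarrow> far x y"
    proof (intro allI impI)
      fix m x y assume *: "m_maps G zero x \<and> m_maps G m y \<and> \<not> zero = m"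
      then have "x = o'" using inv[of zero x] by auto
      moreover have "c \<preceq> y" using * c_leq[of m y] by auto
      ultimately show "far x y" using cR plus_comm[of o' c] by (auto simp: far_def m_op_plus)
    qed
  next
    fix n assume n: "n \<epsilon> omega" and IH: "\<forall>m x y. m_maps G n x \<and> m_maps G m y \<and> \<not> n = m \<longrightarrow> far x y"
    show "\<forall>m x y. m_maps G (suc n) x \<and> m_maps G m y \<and> \<not> suc n = m \<longrightarrow> far x y"
    proof (intro allI impI)
      fix m x y assume *: "m_maps G (suc n) x \<and> m_maps G m y \<and> \<not> suc n = m"
      then obtain x' where x': "m_maps G n x'" "x = x' \<oplus> c" using inv[of "suc n" x] by auto
      show "far x y"
      proof (cases "m = zero")
        case True
        then have "y = o'" using inv[of m y] * by auto
        moreover have "c \<preceq> x" using * c_leq[of "suc n" x] by auto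
        ultimately show ?thesis using cR plus_comm[of o' c] by (auto simp: far_def m_op_plus)
      next
        case False
        then obtain k y' where y': "m = suc k" "m_maps G k y'" "y = y' \<oplus> c"
          using inv[of m y] * by blast
        then have "far x' y'" using IH x' * by blast
        then show ?thesis
          using x' y' cR G_in(2) plus_leq_mono unfolding far_def m_op_plus by (metis plus_closed)
      qed
    qed
  qed
  show ?thesis
  proof (rule that[OF e G])
    fix n m x y d
    assume *: "m_maps G n x" "m_maps G m y" "abs_diff x y d" "d \<preceq> e"
    show "n = m"
    proof (rule ccontr)
      assume "n \<noteq> m"
      then have "far x y" using far G_in(1) * by blast
      then have "c \<preceq> d"
        using * G_in(2) c by (intro abs_diff_far[of x c y d]) (auto simp: far_def m_op_plus)
      then show False using *(4) ec less_irrefl less_leq_trans leq_trans by blast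
    qed
  qed
qed

subsection \<open>Oscillation\<close>

abbreviation osc_le :: "'a \<Rightarrow> 'a \<Rightarrow> 'a \<Rightarrow> bool" where "osc_le \<equiv> m_osc_le R a l o'"

text \<open>A bound on the oscillation asserts that the supremum exists, so passing to a non-empty
  subset takes completeness: the differences over B include zero and are bounded by the supremum
  over A.\<close>

lemma osc_le_subset:
  assumes osc: "osc_le f A e" and f: "m_fun_into f X R" and B: "m_sub B A" and A: "m_sub A X"
  shows "osc_le f B e"
proof (cases "m_empty B")
  case True
  then show ?thesis by (simp add: m_osc_le_def)
next
  case False
  then obtain x0 where x0: "x0 \<epsilon> B" by (auto simp: m_empty_def)
  note fD = m_fun_intoD[OF f]
  define P where "P C d \<longleftrightarrow> (\<exists>x y u v. x \<epsilon> C \<and> y \<epsilon> C \<and> m_maps f x u \<and> m_maps f y v \<and> abs_diff u v d)"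
    for C d
  have PBA: "P B d \<Longrightarrow> P A d" for d using B unfolding P_def m_sub_def by blast
  obtain s where s: "m_lub R l (P A) s" "s \<preceq> e"
    using osc x0 B unfolding m_osc_le_def m_empty_def m_sub_def P_def[symmetric] by blast
  have d: "definable (\<lambda>e. P B (e 0))" unfolding P_def by (intro dfn)
  obtain S where S: "\<And>d. d \<epsilon> S \<longleftrightarrow> d \<epsilon> R \<and> P B d"
    by (rule ex_subset[where a = R, OF d]) (rule that)
  have P_closed: "P B d \<Longrightarrow> d \<epsilon> R" for d unfolding P_def using abs_diff_closed by blast
  have mem_S: "d \<epsilon> S \<longleftrightarrow> P B d" for d using S P_closed by blast
  obtain u0 where u0: "m_maps f x0 u0" using fD(3)[of x0] x0 A B by (auto simp: m_sub_def)
  then have "P B o'" unfolding P_def using x0 abs_diff_self[of u0 o'] fD(2) by blast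
  then have ne: "\<not> m_empty S" using mem_S by (auto simp: m_empty_def)
  have bound: "s \<epsilon> R \<and> (\<forall>d. d \<epsilon> S \<longrightarrow> d \<preceq> s)"
    using s(1) PBA unfolding m_lub_def mem_S by blast
  moreover have "m_sub S R" using S by (simp add: m_sub_def)
  ultimately obtain t where t: "m_lub R l (\<lambda>d. d \<epsilon> S) t"
    using complete ne unfolding m_complete_def by blast
  then have "t \<preceq> s" using bound unfolding m_lub_def by blast
  then have "t \<preceq> e" using s(2) by (rule leq_trans)
  then show ?thesis using t unfolding mem_S m_osc_le_def P_def by blast
qed

lemma osc_le_const:
  assumes "o' \<prec> e" "u \<epsilon> R" "\<And>x v. x \<epsilon> A \<Longrightarrow> m_maps f x v \<longleftrightarrow> v = u"
  shows "osc_le f A e"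
proof (cases "m_empty A")
  case False
  then obtain x where "x \<epsilon> A" by (auto simp: m_empty_def)
  then have "(\<exists>x y u v. x \<epsilon> A \<and> y \<epsilon> A \<and> m_maps f x u \<and> m_maps f y v \<and> abs_diff u v d) \<longleftrightarrow> d = o'" for d
    using assms abs_diff_self by metis
  moreover have "m_lub R l (\<lambda>d. d = o') o'" by (simp add: m_lub_def)
  ultimately show ?thesis
    unfolding m_osc_le_def using less_imp_leq[OF assms(1)] by auto
qed (simp add: m_osc_le_def)

lemma osc_leD:
  assumes "osc_le f A e" "x \<epsilon> A" "y \<epsilon> A" "m_maps f x u" "m_maps f y v" "abs_diff u v d"
  shows "d \<preceq> e"
proof -
  obtain s where "m_lub R l (\<lambda>d. \<exists>x y u v. x \<epsilon> A \<and> y \<epsilon> A \<and> m_maps f x u \<and> m_maps f y v \<and> abs_diff u v d) s"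
    "s \<preceq> e" using assms(1,2) unfolding m_osc_le_def m_empty_def by blast
  then show ?thesis using assms(2-) leq_trans unfolding m_lub_def by blast
qed

end

section \<open>Selections\<close>

context zf_model
begin

text \<open>Choice and multiple choice are treated at once: \<open>Q s A\<close> says that s is an admissible value
  at a family member A.\<close>

definition selects :: "('a \<Rightarrow> 'a \<Rightarrow> bool) \<Rightarrow> 'a \<Rightarrow> 'a \<Rightarrow> bool" where
  "selects Q J F \<longleftrightarrow> (\<exists>g. m_fun_on g J \<and> (\<forall>j A s. m_maps F j A \<and> m_maps g j s \<longrightarrow> Q s A))"

lemma denumerable_omega: "m_fun_on F omega \<Longrightarrow> (\<And>j A. m_maps F j A \<Longrightarrow> \<not> m_empty A) \<Longrightarrow>
    m_denumerable_family omega F"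
  using omega_not_finite countable_subset_omega[of omega]
  by (simp add: m_denumerable_family_def m_sub_def)

end

context zf_reals
begin

abbreviation "in_U \<equiv> m_U R a l o'"
abbreviation "in_U_disjoint Q \<equiv> m_U_disjoint (selects Q) R a l o'"

section \<open>From selections for families on \<open>omega\<close> to disjoint covers\<close>

lemma clopen_discrete:
  assumes "m_discrete X T"
  shows "m_clopen X T A \<longleftrightarrow> m_sub A X"
proof
  show "m_clopen X T A \<Longrightarrow> m_sub A X"
    using assms unfolding m_clopen_def m_discrete_def m_topology_def by blast
next
  assume A: "m_sub A X"
  have "definable (\<lambda>e. \<not> e 0 \<epsilon> A)" by (intro dfn)
  then obtain B where B: "\<And>x. x \<epsilon> B \<longleftrightarrow> x \<epsilon> X \<and> \<not> x \<epsilon> A"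
    by (rule ex_subset[of _ X]) (rule that)
  then have "m_sub B X" by (simp add: m_sub_def)
  then show "m_clopen X T A"
    using assms A B unfolding m_clopen_def m_discrete_def by blast
qed

text \<open>A countable cover is made disjoint by the order of its indices in omega. Its empty pieces
  are dropped; padding them by a fixed non-empty set instead gives a family on all of omega, so
  that no choice for finite families is needed.\<close>

lemma in_U_disjointI:
  assumes select: "\<And>F. m_fun_on F omega \<Longrightarrow> (\<And>j A. m_maps F j A \<Longrightarrow> \<not> m_empty A) \<Longrightarrow> selects Q omega F"
    and X: "m_discrete X T" and f: "in_U X T f"
  shows "in_U_disjoint Q X T f"
proof -
  have cont: "m_continuous R a l o' X T f" using f by (simp add: m_U_def)
  then have fX: "m_fun_into f X R" by (simp add: m_continuous_def)
  have "\<exists>J F. m_countable J \<and> m_fun_on F J \<and> m_covers F X \<and> m_disjoint F \<and> selects Q J F \<and>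
    (\<forall>j A. m_maps F j A \<longrightarrow> m_clopen X T A \<and> osc_le f A e)" if e: "o' \<prec> e" for e
  proof -
    obtain C where C: "m_countable C" "m_union X C"
      "\<And>A. A \<epsilon> C \<Longrightarrow> m_clopen X T A" "\<And>A. A \<epsilon> C \<Longrightarrow> osc_le f A e"
      using f e unfolding m_U_def by blast
    obtain B h where B: "m_sub B omega" and h: "m_bijection h C B"
      using C(1) unfolding m_countable_iff by blast
    note hD = m_bijectionD[OF h]
    have h_omega: "n \<epsilon> omega" if "m_maps h A n" for A n
      using hD(2)[OF that] B by (simp add: m_sub_def)
    define piece where "piece n x \<longleftrightarrow> (\<exists>A. m_maps h A n \<and> x \<epsilon> A)" for n x
    \<comment> \<open>The members of n are the smaller indices, so this is the n-th piece without
      all earlier ones.\<close>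
    define first where "first n x \<longleftrightarrow> piece n x \<and> \<not> (\<exists>m. m \<epsilon> n \<and> piece m x)" for n x
    have piece_X: "x \<epsilon> X" if "piece n x" for n x
      using that C(2) hD(1) unfolding piece_def m_union_def by blast
    have ex_first: "\<exists>n. n \<epsilon> omega \<and> first n x" if x: "x \<epsilon> X" for x
    proof -
      obtain A where A: "A \<epsilon> C" "x \<epsilon> A" using C(2) x unfolding m_union_def by blast
      obtain n where n: "m_maps h A n" using hD(3)[OF A(1)] by blast
      have d: "definable (\<lambda>e. piece (e 0) x)" unfolding piece_def by (intro dfn)
      have px: "piece n x" using n A unfolding piece_def by blast
      obtain m where m: "m \<epsilon> omega" "piece m x" "\<And>k. k \<epsilon> omega \<Longrightarrow> piece k x \<Longrightarrow> \<not> k \<epsilon> m"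
        by (rule omega_least[where P = "\<lambda>n. piece n x", OF d h_omega[OF n] px]) (rule that)
      then have "first m x" unfolding first_def using h_omega unfolding piece_def by blast
      with m(1) show ?thesis by blast
    qed
    have first_unique: "n = m" if "first n x" "first m x" for n m x
      using that omega_linear[of n m] h_omega unfolding first_def piece_def by blast
    have "definable (\<lambda>e. \<exists>x. first (e 0) x)" unfolding first_def piece_def by (intro dfn)
    then obtain J where J: "\<And>n. n \<epsilon> J \<longleftrightarrow> n \<epsilon> omega \<and> (\<exists>x. first n x)"
      by (rule ex_subset[of _ omega]) (rule that)
    obtain P where P: "\<And>z. z \<epsilon> P \<longleftrightarrow> m_sub z X" by (rule ex_power[of X]) (rule that)
    have dF: "definable (\<lambda>e. \<forall>x. x \<epsilon> e 0 \<longleftrightarrow> first (e (Suc 0)) x)"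
      unfolding first_def piece_def by (intro dfn)
    obtain F where F_fun: "m_fun_into F J P"
      and F: "\<And>n A. m_maps F n A \<longleftrightarrow> n \<epsilon> J \<and> A \<epsilon> P \<and> (\<forall>x. x \<epsilon> A \<longleftrightarrow> first n x)"
    proof (rule ex_function[where R = "\<lambda>n A. \<forall>x. x \<epsilon> A \<longleftrightarrow> first n x" and A = J and B = P, OF dF])
      fix n
      have d: "definable (\<lambda>e. first n (e 0))" unfolding first_def piece_def by (intro dfn)
      obtain A where A: "\<And>x. x \<epsilon> A \<longleftrightarrow> x \<epsilon> X \<and> first n x"
        by (rule ex_subset[where a = X, OF d]) (rule that)
      have "\<forall>x. x \<epsilon> A \<longleftrightarrow> first n x" using A piece_X unfolding first_def by blast
      moreover have "A \<epsilon> P" using A P by (simp add: m_sub_def)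
      ultimately show "\<exists>A. A \<epsilon> P \<and> (\<forall>x. x \<epsilon> A \<longleftrightarrow> first n x)" by blast
    next
      show "\<forall>x. x \<epsilon> A \<longleftrightarrow> first n x \<Longrightarrow> \<forall>x. x \<epsilon> A' \<longleftrightarrow> first n x \<Longrightarrow> A = A'" for n A A'
        by (intro ext) simp
    qed (rule that)
    note FD = m_fun_intoD[OF F_fun]
    have "m_countable J" by (rule countable_subset_omega) (simp add: J m_sub_def)
    moreover have F_on: "m_fun_on F J" using F_fun by (simp add: m_fun_into_def)
    moreover have "m_covers F X"
      unfolding m_covers_def
    proof (intro allI iffI)
      fix x assume "x \<epsilon> X"
      then obtain n where n: "n \<epsilon> omega" "first n x" using ex_first by blast
      then have "n \<epsilon> J" using J by blast
      then obtain A where A: "m_maps F n A" using FD(3) by blast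
      then have "x \<epsilon> A" using F n by blast
      with A show "\<exists>n A. m_maps F n A \<and> x \<epsilon> A" by blast
    next
      fix x assume "\<exists>n A. m_maps F n A \<and> x \<epsilon> A"
      then show "x \<epsilon> X" using F piece_X unfolding first_def by blast
    qed
    moreover have "m_disjoint F"
      unfolding m_disjoint_def using F first_unique by blast
    moreover have "selects Q J F"
    proof -
      obtain Z where Z: "\<And>z. z \<epsilon> Z \<longleftrightarrow> z \<epsilon> P \<or> z \<epsilon> upair omega omega"
        by (rule ex_binary_union[of P "upair omega omega"]) (rule that)
      have dG: "definable (\<lambda>e. m_maps F (e (Suc 0)) (e 0) \<or> \<not> e (Suc 0) \<epsilon> J \<and> e 0 = omega)"
        by (intro dfn)
      obtain G where G_fun: "m_fun_into G omega Z"
        and G: "\<And>n A. m_maps G n A \<longleftrightarrow> n \<epsilon> omega \<and> A \<epsilon> Z \<and> (m_maps F n A \<or> \<not> n \<epsilon> J \<and> A = omega)"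
      proof (rule ex_function[where R = "\<lambda>n A. m_maps F n A \<or> \<not> n \<epsilon> J \<and> A = omega" and A = omega
            and B = Z, OF dG])
        show "\<exists>A. A \<epsilon> Z \<and> (m_maps F n A \<or> \<not> n \<epsilon> J \<and> A = omega)" for n
          using FD(2) FD(3)[of n] Z by (cases "n \<epsilon> J") auto
        show "m_maps F n A \<or> \<not> n \<epsilon> J \<and> A = omega \<Longrightarrow> m_maps F n A' \<or> \<not> n \<epsilon> J \<and> A' = omega \<Longrightarrow> A = A'"
          for n A A' using FD(1,4) by blast
      qed (rule that)
      have "\<not> m_empty A" if "m_maps G n A" for n A
        using that zero_mem_omega unfolding G F J m_empty_def by blast
      then have "selects Q omega G" using select G_fun by (simp add: m_fun_into_def)
      then obtain g where g: "m_fun_on g omega" "\<And>n A s. m_maps G n A \<Longrightarrow> m_maps g n s \<Longrightarrow> Q s A"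
        unfolding selects_def by blast
      note gD = m_fun_onD[OF g(1)]
      \<comment> \<open>Restricting g to J discards the values that were selected from the
        padding.\<close>
      have dg: "definable (\<lambda>e. \<exists>n y. m_pair (e 0) n y \<and> n \<epsilon> J)" by (intro dfn)
      obtain g' where g': "\<And>p. p \<epsilon> g' \<longleftrightarrow> p \<epsilon> g \<and> (\<exists>n y. m_pair p n y \<and> n \<epsilon> J)"
        by (rule ex_subset[where a = g, OF dg]) (rule that)
      have g'_maps: "m_maps g' n y \<longleftrightarrow> m_maps g n y \<and> n \<epsilon> J" for n y
        unfolding m_maps_iff g' m_pair_iff by auto
      have "m_fun_on g' J"
      proof (rule m_fun_onI)
        show "p \<epsilon> g' \<Longrightarrow> \<exists>x y. x \<epsilon> J \<and> p = opair x y" for p unfolding g' m_pair_iff by blast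
        show "x \<epsilon> J \<Longrightarrow> \<exists>y. m_maps g' x y" for x using g'_maps gD(2) J by blast
        show "m_maps g' x y \<Longrightarrow> m_maps g' x z \<Longrightarrow> y = z" for x y z using g'_maps gD(3) by blast
      qed
      moreover have "m_maps G n A" if "m_maps F n A" for n A
        using that FD(1,2) J Z unfolding G by blast
      ultimately show ?thesis using g(2) g'_maps unfolding selects_def by blast
    qed
    moreover have "m_clopen X T A \<and> osc_le f A e" if FA: "m_maps F n A" for n A
    proof
      show "m_clopen X T A" using FA F P clopen_discrete[OF X] by blast
      \<comment> \<open>An index in J has a non-empty difference, which exhibits a member D of the
        cover numbered n. As h is injective, A lies in D and inherits the bound on the
        oscillation.\<close>
      obtain x where "first n x" using FA F J by blast
      then obtain D where D: "m_maps h D n" unfolding first_def piece_def by blast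
      have "m_sub A D"
        using FA F D hD(6) unfolding m_sub_def first_def piece_def by metis
      moreover have "m_sub D X" using C(3) hD(1)[OF D] clopen_discrete[OF X] by blast
      ultimately show "osc_le f A e"
        using osc_le_subset[OF C(4)[OF hD(1)[OF D]] fX] by blast
    qed
    ultimately show ?thesis by blast
  qed
  with cont show ?thesis unfolding m_U_disjoint_def by blast
qed

section \<open>From disjoint covers to selections for denumerable families\<close>

lemma discrete_power:
  assumes "\<And>z. z \<epsilon> T \<longleftrightarrow> m_sub z X"
  shows "m_discrete X T"
proof -
  have "m_sub U X" if "m_sub S T" "m_union U S" for S U
    using that assms unfolding m_sub_def m_union_def by blast
  moreover have "m_sub W X" if "m_sub U X" "\<forall>x. x \<epsilon> W \<longleftrightarrow> x \<epsilon> U \<and> x \<epsilon> V" for U V W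
    using that unfolding m_sub_def by blast
  ultimately show ?thesis
    unfolding m_discrete_def m_topology_def assms by (auto simp: m_empty_def m_sub_def)
qed

text \<open>Each block takes its value from the piece of least index that meets it. The relation
  \<open>\<pi> j t s\<close> says that s is the projection to the member of index j of an admissible value t in
  the block of j.\<close>

lemma selects_of_U:
  assumes U: "\<And>X T f. m_discrete X T \<Longrightarrow> in_U X T f \<Longrightarrow> in_U_disjoint Q X T f"
    and Q_nonempty: "\<And>t A. Q t A \<Longrightarrow> \<not> m_empty A"
    and Q_bound: "\<And>s A. Q s A \<Longrightarrow> s \<epsilon> A \<or> m_sub s A"
    and d\<pi>: "\<And>t u v. atom t \<Longrightarrow> atom u \<Longrightarrow> atom v \<Longrightarrow> definable (\<lambda>e. \<pi> (t e) (u e) (v e))"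
    and \<pi>: "\<And>j t A' A. Q t A' \<Longrightarrow> (\<And>p. p \<epsilon> A' \<Longrightarrow> \<exists>x. x \<epsilon> A \<and> p = opair j x) \<Longrightarrow> \<exists>s. \<pi> j t s \<and> Q s A"
    and \<pi>_unique: "\<And>j t s s'. \<pi> j t s \<Longrightarrow> \<pi> j t s' \<Longrightarrow> s = s'"
    and JF: "m_denumerable_family J F"
  shows "selects Q J F"
proof -
  have F: "m_fun_on F J" and F_ne: "\<And>j A. m_maps F j A \<Longrightarrow> \<exists>x. x \<epsilon> A" and Jc: "m_countable J"
    using JF unfolding m_denumerable_family_def m_empty_def by blast+
  note FD = m_fun_onD[OF F]
  obtain B h where B: "m_sub B omega" and h: "m_bijection h J B"
    using Jc unfolding m_countable_iff by blast
  note hD = m_bijectionD[OF h]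
  have h_omega: "n \<epsilon> omega" if "m_maps h j n" for j n
    using hD(2)[OF that] B by (simp add: m_sub_def)
  obtain e G where e: "o' \<prec> e" and G: "m_fun_into G omega R"
    and sep: "\<And>n m x y d. m_maps G n x \<Longrightarrow> m_maps G m y \<Longrightarrow> abs_diff x y d \<Longrightarrow> d \<preceq> e \<Longrightarrow> n = m"
    by (rule ex_separated_sequence) (rule that)
  note GD = m_fun_intoD[OF G]
  \<comment> \<open>V is a set containing all elements of all members. Three unions are taken: a
    member A sits inside the Kuratowski pair of j and A two levels below F, and its elements one
    level further down.\<close>
  obtain V where V: "\<And>j A x. m_maps F j A \<Longrightarrow> x \<epsilon> A \<Longrightarrow> x \<epsilon> V"
  proof -
    obtain u where u: "\<And>z. z \<epsilon> u \<longleftrightarrow> (\<exists>y. y \<epsilon> F \<and> z \<epsilon> y)" by (rule ex_union[of F]) (rule that)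
    obtain v where v: "\<And>z. z \<epsilon> v \<longleftrightarrow> (\<exists>y. y \<epsilon> u \<and> z \<epsilon> y)" by (rule ex_union[of u]) (rule that)
    obtain w where w: "\<And>z. z \<epsilon> w \<longleftrightarrow> (\<exists>y. y \<epsilon> v \<and> z \<epsilon> y)" by (rule ex_union[of v]) (rule that)
    have "A \<epsilon> v" if "m_maps F j A" for j A
      using that unfolding m_maps_iff v u opair_def by (metis mem_upair)
    then show ?thesis using w by (intro that[of w]) blast
  qed
  have dX: "definable (\<lambda>e. \<exists>A. m_maps F (e (Suc 0)) A \<and> e 0 \<epsilon> A)" by (intro dfn)
  obtain X where X: "\<And>j x. m_maps X j x \<longleftrightarrow> j \<epsilon> J \<and> x \<epsilon> V \<and> (\<exists>A. m_maps F j A \<and> x \<epsilon> A)"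
    and X_pair: "\<And>p. p \<epsilon> X \<Longrightarrow> \<exists>j x. j \<epsilon> J \<and> x \<epsilon> V \<and> p = opair j x"
    by (rule ex_relation[where R = "\<lambda>j x. \<exists>A. m_maps F j A \<and> x \<epsilon> A" and A = J and B = V, OF dX])
      (rule that)
  have X_mem: "p \<epsilon> X \<longleftrightarrow> (\<exists>j A x. m_maps F j A \<and> x \<epsilon> A \<and> p = opair j x)" for p
    using X X_pair V FD(1) unfolding m_maps_iff by metis
  obtain T where T: "\<And>z. z \<epsilon> T \<longleftrightarrow> m_sub z X" by (rule ex_power[of X]) (rule that)
  have disc: "m_discrete X T" using T by (rule discrete_power)
  \<comment> \<open>J is merely countable, so the sequence is evaluated at the number that h assigns
    to j.\<close>
  define fR where "fR p y \<longleftrightarrow> (\<exists>j x n. m_pair p j x \<and> m_maps h j n \<and> m_maps G n y)" for p y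
  have fR: "fR (opair j x) y \<longleftrightarrow> (\<exists>n. m_maps h j n \<and> m_maps G n y)" for j x y
    unfolding fR_def m_pair_iff by auto
  have df: "definable (\<lambda>e. fR (e (Suc 0)) (e 0))" unfolding fR_def by (intro dfn)
  obtain f where f_fun: "m_fun_into f X R" and f: "\<And>p y. m_maps f p y \<longleftrightarrow> p \<epsilon> X \<and> y \<epsilon> R \<and> fR p y"
  proof (rule ex_function[where A = X and B = R, OF df])
    fix p assume "p \<epsilon> X"
    then obtain j x where p: "j \<epsilon> J" "p = opair j x" using X_pair by blast
    obtain n where n: "m_maps h j n" using hD(3) p by blast
    obtain y where y: "m_maps G n y" using GD(3) h_omega n by blast
    show "\<exists>y. y \<epsilon> R \<and> fR p y" using p n y fR GD(2) by blast
  next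
    fix p y z assume "p \<epsilon> X" "fR p y" "fR p z"
    then show "y = z" using X_pair fR hD(4) GD(4) by metis
  qed (rule that)
  note fD = m_fun_intoD[OF f_fun]
  have cont: "m_continuous R a l o' X T f"
    unfolding m_continuous_def T m_sub_def using f_fun fD(1) by blast
  define block where "block j D \<longleftrightarrow> (\<forall>p. p \<epsilon> D \<longleftrightarrow> p \<epsilon> X \<and> (\<exists>x. m_pair p j x))" for j D
  have ex_block: "\<exists>D. D \<epsilon> T \<and> block j D" for j
  proof -
    have d: "definable (\<lambda>e. \<exists>x. m_pair (e 0) j x)" by (intro dfn)
    obtain D where D: "\<And>p. p \<epsilon> D \<longleftrightarrow> p \<epsilon> X \<and> (\<exists>x. m_pair p j x)"
      by (rule ex_subset[where a = X, OF d]) (rule that)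
    then show ?thesis unfolding block_def T m_sub_def by blast
  qed
  have block_ne: "\<exists>x. opair j x \<epsilon> D" if j: "j \<epsilon> J" and D: "block j D" for j D
  proof -
    obtain A where A: "m_maps F j A" using FD(2)[OF j] by blast
    obtain x where "x \<epsilon> A" using F_ne[OF A] by blast
    with A D show ?thesis unfolding block_def X_mem m_pair_iff by blast
  qed
  have block_fun: "D = D'" if "block j D" "block j D'" for j D D'
    using that unfolding block_def by (intro ext) blast
  \<comment> \<open>A block remembers its index because it is non-empty. Hence blocks at distinct
    indices differ even where F repeats a member.\<close>
  have block_inj: "j = j'" if j: "j \<epsilon> J" "block j D" "block j' D" for j j' D
  proof -
    obtain x where "opair j x \<epsilon> D" using block_ne j by blast
    with j(3) show ?thesis unfolding block_def m_pair_iff by auto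
  qed
  have dC: "definable (\<lambda>e. \<exists>j. j \<epsilon> J \<and> block j (e 0))" unfolding block_def by (intro dfn)
  obtain C where C: "\<And>D. D \<epsilon> C \<longleftrightarrow> D \<epsilon> T \<and> (\<exists>j. j \<epsilon> J \<and> block j D)"
    by (rule ex_subset[where a = T, OF dC]) (rule that)
  \<comment> \<open>The block of j is given the number of j, so C inherits the enumeration of
    J.\<close>
  have dk: "definable (\<lambda>e. \<exists>j. m_maps h j (e 0) \<and> block j (e (Suc 0)))"
    unfolding block_def by (intro dfn)
  have "\<exists>k. m_bijection k C B"
  proof (rule ex_bijection[where R = "\<lambda>D n. \<exists>j. m_maps h j n \<and> block j D", OF dk])
    show "D \<epsilon> C \<Longrightarrow> \<exists>n. n \<epsilon> B \<and> (\<exists>j. m_maps h j n \<and> block j D)" for D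
      using C hD(2,3) by blast
    show "n \<epsilon> B \<Longrightarrow> \<exists>D. D \<epsilon> C \<and> (\<exists>j. m_maps h j n \<and> block j D)" for n
      using C hD(1,5) ex_block by blast
    show "\<exists>j. m_maps h j n \<and> block j D \<Longrightarrow> \<exists>j. m_maps h j m \<and> block j D \<Longrightarrow> n = m" for D n m
      using hD(1,4) block_inj by blast
    show "\<exists>j. m_maps h j n \<and> block j D \<Longrightarrow> \<exists>j. m_maps h j n \<and> block j D' \<Longrightarrow> D = D'" for D n D'
      using hD(6) block_fun by blast
  qed
  then have C_countable: "m_countable C" using B m_countable_iff by blast
  have C_union: "m_union X C"
    unfolding m_union_def
  proof (intro allI iffI)
    fix p assume p: "p \<epsilon> X"
    then obtain j x where j: "j \<epsilon> J" "p = opair j x" using X_pair by blast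
    obtain D where "D \<epsilon> T" "block j D" using ex_block by blast
    with j p show "\<exists>D. D \<epsilon> C \<and> p \<epsilon> D" unfolding C block_def m_pair_iff by blast
  next
    fix p assume "\<exists>D. D \<epsilon> C \<and> p \<epsilon> D"
    then show "p \<epsilon> X" unfolding C T m_sub_def by blast
  qed
  have "in_U X T f"
    unfolding m_U_def
  proof (intro conjI allI impI cont)
    \<comment> \<open>This e is an arbitrary bound that shadows the separation constant: f is
      constant on every block, so the blocks work for all bounds at once.\<close>
    fix e assume e: "o' \<prec> e"
    have "m_clopen X T D \<and> osc_le f D e" if D: "D \<epsilon> C" for D
    proof
      show "m_clopen X T D" using D unfolding C clopen_discrete[OF disc] T by blast
      obtain j where j: "j \<epsilon> J" "block j D" using D C by blast
      obtain n where n: "m_maps h j n" using hD(3) j by blast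
      obtain y where y: "m_maps G n y" using GD(3) h_omega n by blast
      show "osc_le f D e"
      proof (rule osc_le_const[OF e GD(2)[OF y]])
        fix p v assume "p \<epsilon> D"
        then obtain x where p: "p \<epsilon> X" "p = opair j x" using j(2) unfolding block_def m_pair_iff by blast
        have "fR p v \<longleftrightarrow> v = y" unfolding p(2) fR using n y hD(4) GD(4) by blast
        then show "m_maps f p v \<longleftrightarrow> v = y" using f p(1) GD(2)[OF y] by blast
      qed
    qed
    then show "\<exists>C. m_countable C \<and> m_union X C \<and> (\<forall>A. A \<epsilon> C \<longrightarrow> m_clopen X T A \<and> osc_le f A e)"
      using C_countable C_union by blast
  qed
  then have "in_U_disjoint Q X T f" using disc by (rule U[rotated])
  \<comment> \<open>The cover is taken for the separation constant e, the bound for which the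
    sequence was built.\<close>
  then obtain K F' where K: "m_countable K" and F': "m_fun_on F' K" "m_covers F' X"
    and "selects Q K F'"
    and F'_small: "\<And>k A. m_maps F' k A \<Longrightarrow> m_clopen X T A \<and> osc_le f A e"
    using e unfolding m_U_disjoint_def by blast
  then obtain g where g: "m_fun_on g K" "\<And>k A t. m_maps F' k A \<Longrightarrow> m_maps g k t \<Longrightarrow> Q t A"
    unfolding selects_def by blast
  note F'D = m_fun_onD[OF F'(1)] and gD = m_fun_onD[OF g(1)]
  obtain B' h' where B': "m_sub B' omega" and h': "m_bijection h' K B'"
    using K unfolding m_countable_iff by blast
  note h'D = m_bijectionD[OF h']
  have h'_omega: "n \<epsilon> omega" if "m_maps h' j n" for j n
    using h'D(2)[OF that] B' by (simp add: m_sub_def)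
  have F'_X: "p \<epsilon> X" if "m_maps F' k A" "p \<epsilon> A" for k A p
    using F'_small[OF that(1)] that(2) unfolding clopen_discrete[OF disc] m_sub_def by blast
  \<comment> \<open>Two values taken on one piece are at most e apart, so by \<open>sep\<close> they
    are the same term of the sequence, and h is injective.\<close>
  have one_block: "j = j'"
    if A: "m_maps F' k A" and p: "opair j x \<epsilon> A" "opair j' x' \<epsilon> A" for k A j j' x x'
  proof -
    obtain u where u: "m_maps f (opair j x) u" using fD(3)[OF F'_X[OF A p(1)]] by blast
    obtain v where v: "m_maps f (opair j' x') v" using fD(3)[OF F'_X[OF A p(2)]] by blast
    obtain d where d: "abs_diff u v d" using ex_abs_diff[OF fD(2)[OF u] fD(2)[OF v]] by blast
    have de: "d \<preceq> e" using osc_leD[OF _ p u v d] F'_small[OF A] by blast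
    obtain n where n: "m_maps h j n" "m_maps G n u" using u unfolding f fR by blast
    obtain m where m: "m_maps h j' m" "m_maps G m v" using v unfolding f fR by blast
    have "n = m" using n(2) m(2) d de by (rule sep)
    then show ?thesis using hD(6) n(1) m(1) by blast
  qed
  \<comment> \<open>Pieces are compared through their numbers under h', because K is only countable
    and carries no order of its own.\<close>
  define meets where "meets n j \<longleftrightarrow> (\<exists>k A p x. m_maps h' k n \<and> m_maps F' k A \<and> p \<epsilon> A \<and> m_pair p j x)"
    for n j
  define least where "least n j \<longleftrightarrow> meets n j \<and> \<not> (\<exists>m. m \<epsilon> omega \<and> meets m j \<and> m \<epsilon> n)" for n j
  have ex_least: "\<exists>n. least n j" if j: "j \<epsilon> J" for j
  proof -
    obtain A where A: "m_maps F j A" using FD(2)[OF j] by blast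
    obtain x where x: "x \<epsilon> A" using F_ne[OF A] by blast
    have "opair j x \<epsilon> X" using X_mem A x by blast
    then obtain k A' where k: "m_maps F' k A'" "opair j x \<epsilon> A'"
      using F'(2) unfolding m_covers_def by blast
    obtain n where n: "m_maps h' k n" using h'D(3) F'D(1) k by blast
    have mn: "meets n j" unfolding meets_def m_pair_iff using k n by blast
    have d: "definable (\<lambda>e. meets (e 0) j)" unfolding meets_def by (intro dfn)
    obtain m where "m \<epsilon> omega" "meets m j" "\<And>k. k \<epsilon> omega \<Longrightarrow> meets k j \<Longrightarrow> \<not> k \<epsilon> m"
      by (rule omega_least[where P = "\<lambda>n. meets n j", OF d h'_omega[OF n] mn]) (rule that)
    then show ?thesis unfolding least_def by blast
  qed
  have least_unique: "n = m" if "least n j" "least m j" for n m j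
    using that omega_linear[of n m] h'_omega unfolding least_def meets_def by blast
  define sel where "sel j s \<longleftrightarrow> (\<exists>n k t. least n j \<and> m_maps h' k n \<and> m_maps g k t \<and> \<pi> j t s)" for j s
  have ds: "definable (\<lambda>e. sel (e (Suc 0)) (e 0))"
    unfolding sel_def least_def meets_def by (intro dfn d\<pi>)
  have sel_unique: "s = s'" if "sel j s" "sel j s'" for j s s'
    using that least_unique h'D(6) gD(3) \<pi>_unique unfolding sel_def by metis
  have ex_sel: "\<exists>s. sel j s \<and> Q s A" if A: "m_maps F j A" for j A
  proof -
    obtain n where n: "least n j" using ex_least FD(1) A by blast
    then obtain k A' x where k: "m_maps h' k n" and A': "m_maps F' k A'" and x: "opair j x \<epsilon> A'"
      unfolding least_def meets_def m_pair_iff by blast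
    obtain t where t: "m_maps g k t" using gD(2) F'D(1) A' by blast
    \<comment> \<open>The piece meets the block of j and, by \<open>one_block\<close>, no other;
      being covered by blocks it lies inside this one, so its admissible value t projects to one for
      A.\<close>
    have "\<exists>x. x \<epsilon> A \<and> p = opair j x" if p: "p \<epsilon> A'" for p
    proof -
      obtain j' D x' where "m_maps F j' D" "x' \<epsilon> D" "p = opair j' x'"
        using F'_X[OF A' p] X_mem by blast
      moreover from this have "j' = j" using one_block[OF A'] x p by blast
      ultimately show ?thesis using A FD(3) by blast
    qed
    then obtain s where "\<pi> j t s" "Q s A" using \<pi>[OF g(2)[OF A' t]] by blast
    then show ?thesis unfolding sel_def using n k t by blast
  qed
  obtain P where P: "\<And>z. z \<epsilon> P \<longleftrightarrow> m_sub z V" by (rule ex_power[of V]) (rule that)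
  \<comment> \<open>A codomain for both kinds of selection: an element of A lies in V, a subset of A
    in the power set of V.\<close>
  obtain W where W: "\<And>z. z \<epsilon> W \<longleftrightarrow> z \<epsilon> V \<or> z \<epsilon> P" by (rule ex_binary_union[of V P]) (rule that)
  obtain c where c_fun: "m_fun_into c J W" and c: "\<And>j s. m_maps c j s \<longleftrightarrow> j \<epsilon> J \<and> s \<epsilon> W \<and> sel j s"
  proof (rule ex_function[where A = J and B = W, OF ds])
    fix j assume "j \<epsilon> J"
    then obtain A where A: "m_maps F j A" using FD(2) by blast
    then obtain s where s: "sel j s" "Q s A" using ex_sel by blast
    have "s \<epsilon> W" using Q_bound[OF s(2)] V[OF A] unfolding W P m_sub_def by blast
    with s show "\<exists>s. s \<epsilon> W \<and> sel j s" by blast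
  next
    show "sel j s \<Longrightarrow> sel j s' \<Longrightarrow> s = s'" for j s s' by (rule sel_unique)
  qed (rule that)
  have "Q s A" if A: "m_maps F j A" and s: "m_maps c j s" for j A s
    using ex_sel[OF A] s c sel_unique by blast
  then show ?thesis using c_fun unfolding selects_def m_fun_into_def by blast
qed

section \<open>The two equivalences inside a model\<close>

lemma choice_iff:
  "(\<forall>J F. m_denumerable_family J F \<longrightarrow> (\<exists>g. m_choice g J F)) \<longleftrightarrow>
   (\<forall>X T. m_discrete X T \<longrightarrow> (\<forall>f. in_U X T f \<longrightarrow>
      m_U_disjoint (\<lambda>J F. \<exists>g. m_choice g J F) R a l o' X T f))"
proof -
  have sel: "(\<lambda>J F. \<exists>g. m_choice g J F) = selects (\<lambda>s A. s \<epsilon> A)"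
    by (simp add: fun_eq_iff m_choice_def selects_def)
  show ?thesis
    \<comment> \<open>\<open>sel\<close> rewrites the abstraction passed to
      \<open>m_U_disjoint\<close>, its pointwise form the applied occurrence on the left-hand
      side.\<close>
    unfolding sel fun_cong[OF fun_cong[OF sel], simplified]
  proof (intro iffI allI impI)
    fix X T f
    assume "\<forall>J F. m_denumerable_family J F \<longrightarrow> selects (\<lambda>s A. s \<epsilon> A) J F" "m_discrete X T" "in_U X T f"
    then show "in_U_disjoint (\<lambda>s A. s \<epsilon> A) X T f"
      by (intro in_U_disjointI) (blast intro: denumerable_omega)+
  next
    fix J F
    assume U: "\<forall>X T. m_discrete X T \<longrightarrow> (\<forall>f. in_U X T f \<longrightarrow> in_U_disjoint (\<lambda>s A. s \<epsilon> A) X T f)"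
      and JF: "m_denumerable_family J F"
    show "selects (\<lambda>s A. s \<epsilon> A) J F"
    \<comment> \<open>The value chosen in a piece inside the block of j is a pair (j, s), and the
      projection returns s.\<close>
    proof (rule selects_of_U[where \<pi> = "\<lambda>j t s. m_pair t j s", OF _ _ _ _ _ _ JF])
      show "m_discrete X T \<Longrightarrow> in_U X T f \<Longrightarrow> in_U_disjoint (\<lambda>s A. s \<epsilon> A) X T f" for X T f
        using U by blast
    qed (auto simp: m_empty_def m_pair_iff intro: dfn[unfolded m_pair_iff])
  qed
qed

text \<open>All pairs in t share the first coordinate j, so the second coordinate is injective on t
  and the bijection of t with n carries over to s.\<close>

lemma finite_projection:
  assumes t: "m_finite t" and tj: "\<And>p. p \<epsilon> t \<Longrightarrow> \<exists>x. x \<epsilon> A \<and> p = opair j x"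
    and s: "\<And>x. x \<epsilon> s \<longleftrightarrow> opair j x \<epsilon> t"
  shows "m_finite s"
proof -
  obtain n b where n: "n \<epsilon> omega" and b: "m_bijection b t n"
    using t unfolding m_finite_def m_omega_iff by blast
  note bD = m_bijectionD[OF b]
  define r where "r x k \<longleftrightarrow> (\<exists>p. m_pair p j x \<and> m_maps b p k)" for x k
  have r: "r x k \<longleftrightarrow> m_maps b (opair j x) k" for x k by (simp add: r_def m_pair_iff)
  have d: "definable (\<lambda>e. r (e (Suc 0)) (e 0))" unfolding r_def by (intro dfn)
  have "\<exists>b. m_bijection b s n"
  proof (rule ex_bijection[where R = r, OF d])
    show "x \<epsilon> s \<Longrightarrow> \<exists>k. k \<epsilon> n \<and> r x k" for x unfolding r s using bD(2,3) by blast
    show "k \<epsilon> n \<Longrightarrow> \<exists>x. x \<epsilon> s \<and> r x k" for k unfolding r s using bD(1,5) tj by metis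
    show "r x k \<Longrightarrow> r x k' \<Longrightarrow> k = k'" for x k k' unfolding r by (rule bD(4))
    show "r x k \<Longrightarrow> r x' k \<Longrightarrow> x = x'" for x x' k unfolding r using bD(6) opair_eq_iff by blast
  qed
  then show ?thesis unfolding m_finite_def m_omega_iff using n by blast
qed

lemma multiple_choice_iff:
  "(\<forall>J F. m_denumerable_family J F \<longrightarrow> (\<exists>g. m_multiple_choice g J F)) \<longleftrightarrow>
   (\<forall>X T. m_discrete X T \<longrightarrow> (\<forall>f. in_U X T f \<longrightarrow>
      m_U_disjoint (\<lambda>J F. \<exists>g. m_multiple_choice g J F) R a l o' X T f))"
proof -
  define Q where "Q s A \<longleftrightarrow> m_sub s A \<and> m_finite s \<and> \<not> m_empty s" for s A
  have sel: "(\<lambda>J F. \<exists>g. m_multiple_choice g J F) = selects Q"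
    by (simp add: fun_eq_iff m_multiple_choice_def selects_def Q_def)
  show ?thesis
    unfolding sel fun_cong[OF fun_cong[OF sel], simplified]
  proof (intro iffI allI impI)
    fix X T f
    assume "\<forall>J F. m_denumerable_family J F \<longrightarrow> selects Q J F" "m_discrete X T" "in_U X T f"
    then show "in_U_disjoint Q X T f"
      by (intro in_U_disjointI) (blast intro: denumerable_omega)+
  next
    fix J F
    assume U: "\<forall>X T. m_discrete X T \<longrightarrow> (\<forall>f. in_U X T f \<longrightarrow> in_U_disjoint Q X T f)"
      and JF: "m_denumerable_family J F"
    \<comment> \<open>s is the set of second coordinates of the pairs in t with first coordinate j;
      being described by its members, it is unique by extensionality.\<close>
    define \<pi> where "\<pi> j t s \<longleftrightarrow> (\<forall>x. x \<epsilon> s \<longleftrightarrow> (\<exists>p. m_pair p j x \<and> p \<epsilon> t))" for j t s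
    show "selects Q J F"
    proof (rule selects_of_U[where \<pi> = \<pi>, OF _ _ _ _ _ _ JF])
      show "m_discrete X T \<Longrightarrow> in_U X T f \<Longrightarrow> in_U_disjoint Q X T f" for X T f
        using U by blast
      show "Q t A \<Longrightarrow> \<not> m_empty A" for t A unfolding Q_def m_empty_def m_sub_def by blast
      show "Q s A \<Longrightarrow> s \<epsilon> A \<or> m_sub s A" for s A by (simp add: Q_def)
      show "definable (\<lambda>e. \<pi> (t e) (u e) (v e))" if "atom t" "atom u" "atom v" for t u v
        unfolding \<pi>_def by (intro dfn that that[THEN atom_ren])
      show "s = s'" if "\<pi> j t s" "\<pi> j t s'" for j t s s'
        using that unfolding \<pi>_def by (intro ext) blast
    next
      fix j t A' A
      assume Q: "Q t A'" and A': "\<And>p. p \<epsilon> A' \<Longrightarrow> \<exists>x. x \<epsilon> A \<and> p = opair j x"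
      then have t: "\<exists>x. x \<epsilon> A \<and> p = opair j x" if "p \<epsilon> t" for p
        using that unfolding Q_def m_sub_def by blast
      have d: "definable (\<lambda>e. \<exists>p. m_pair p j (e 0) \<and> p \<epsilon> t)" by (intro dfn)
      obtain s where "\<And>x. x \<epsilon> s \<longleftrightarrow> x \<epsilon> A \<and> (\<exists>p. m_pair p j x \<and> p \<epsilon> t)"
        by (rule ex_subset[where a = A, OF d]) (rule that)
      then have s: "x \<epsilon> s \<longleftrightarrow> opair j x \<epsilon> t" and sA: "m_sub s A" for x
        using t unfolding m_pair_iff m_sub_def by (metis opair_eq_iff)+
      have "m_finite s" using Q t s unfolding Q_def by (intro finite_projection[of t A j s]) blast+
      moreover have "\<not> m_empty s" using Q t s unfolding Q_def m_empty_def by blast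
      ultimately show "\<exists>s. \<pi> j t s \<and> Q s A" using s sA unfolding \<pi>_def Q_def m_pair_iff by blast
    qed
  qed
qed

end

section \<open>From all models back to provability\<close>

lemma zf_realsI:
  assumes ZF: "\<And>p e. p \<in> ZF \<Longrightarrow> sat E (=) e p"
    and field: "holds E (=) r n s (complete_ordered_field \<R>)"
    and "rlt \<R> < n" "radd \<R> < n" "rmul \<R> < n" "rzero \<R> < n" "rone \<R> < n" "rcarr \<R> < n"
  shows "zf_reals E (s (rcarr \<R>)) (s (radd \<R>)) (s (rlt \<R>)) (s (rzero \<R>))"
proof -
  interpret zf_model E using ZF by (rule zf_modelI)
  show ?thesis
    by standard (use hold_complete_ordered_fieldD[OF assms(2-)] in blast)+
qed

text \<open>Combines \<open>completeness\<close> with the quantification over all complete ordered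
  fields. Such a field is one in the sense of the model and need not be a copy of the actual
  reals.\<close>

lemma ZF_provesI:
  fixes \<phi> :: "rstruct \<Rightarrow> form"
  assumes "\<And>(E :: nat \<Rightarrow> nat \<Rightarrow> bool) r s R a m l z e.
    zf_reals E (s R) (s a) (s l) (s z) \<Longrightarrow> R < 6 \<Longrightarrow> a < 6 \<Longrightarrow> m < 6 \<Longrightarrow> l < 6 \<Longrightarrow> z < 6 \<Longrightarrow> e < 6 \<Longrightarrow>
    holds E (=) r 6 s (\<phi> \<lparr>rcarr = R, radd = a, rmul = m, rlt = l, rzero = z, rone = e\<rparr>)"
  shows "ZF \<turnstile> sentence (for_the_reals \<phi>)"
proof (rule completeness)
  fix E :: "nat \<Rightarrow> nat \<Rightarrow> bool" and r
  assume ZF: "\<And>p e. p \<in> ZF \<Longrightarrow> sat E (=) e p"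
  \<comment> \<open>The six quantifiers of \<open>for_the_reals\<close> occupy the levels below 6,
    so the remaining formula is evaluated at depth 6.\<close>
  have six: "Suc (Suc (Suc (Suc (Suc (Suc 0))))) = 6" by simp
  have "holds E (=) r 6 s (complete_ordered_field \<lparr>rcarr = R, radd = a, rmul = m, rlt = l, rzero = z, rone = e\<rparr>)
    \<Longrightarrow> R < 6 \<Longrightarrow> a < 6 \<Longrightarrow> m < 6 \<Longrightarrow> l < 6 \<Longrightarrow> z < 6 \<Longrightarrow> e < 6 \<Longrightarrow>
    holds E (=) r 6 s (\<phi> \<lparr>rcarr = R, radd = a, rmul = m, rlt = l, rzero = z, rone = e\<rparr>)"
    for s R a m l z e
    using zf_realsI[OF ZF, where \<R> = "\<lparr>rcarr = R, radd = a, rmul = m, rlt = l, rzero = z, rone = e\<rparr>"]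
    by (intro assms) simp_all
  then have "holds E (=) r 0 r (for_the_reals \<phi>)"
    unfolding for_the_reals_def Let_def holds_all holds_connectives six by simp
  then show "sat E (=) r (sentence (for_the_reals \<phi>))" by (simp add: sat_sentence[where s = r])
qed (rule ZF_infinite)

theorem theorem2p6:
  shows "(ZF \<turnstile> sentence (for_the_reals (\<lambda>\<R>.
            CMC \<^bold>\<longleftrightarrow>
            (\<^bold>\<forall>X T. discrete_space X T \<^bold>\<longrightarrow>
               (\<^bold>\<forall>f. U_aleph0 \<R> X T f \<^bold>\<longrightarrow> U_aleph0_MC \<R> X T f)))))
       \<and> (ZF \<turnstile> sentence (for_the_reals (\<lambda>\<R>.
            CAC \<^bold>\<longleftrightarrow>
            (\<^bold>\<forall>X T. discrete_space X T \<^bold>\<longrightarrow>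
               (\<^bold>\<forall>f. U_aleph0 \<R> X T f \<^bold>\<longrightarrow> U_aleph0_AC \<R> X T f)))))"
proof
  show "ZF \<turnstile> sentence (for_the_reals (\<lambda>\<R>. CMC \<^bold>\<longleftrightarrow> (\<^bold>\<forall>X T. discrete_space X T \<^bold>\<longrightarrow>
      (\<^bold>\<forall>f. U_aleph0 \<R> X T f \<^bold>\<longrightarrow> U_aleph0_MC \<R> X T f))))"
  proof (rule ZF_provesI)
    fix E :: "nat \<Rightarrow> nat \<Rightarrow> bool" and r s :: "nat \<Rightarrow> nat" and R a m l z e :: nat
    assume zr: "zf_reals E (s R) (s a) (s l) (s z)" and lt: "R < 6" "a < 6" "m < 6" "l < 6" "z < 6" "e < 6"
    interpret zf_reals E "s R" "s a" "s l" "s z" by (rule zr)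
    show "hold r 6 s (CMC \<^bold>\<longleftrightarrow> (\<^bold>\<forall>X T. discrete_space X T \<^bold>\<longrightarrow> (\<^bold>\<forall>f.
      U_aleph0 \<lparr>rcarr = R, radd = a, rmul = m, rlt = l, rzero = z, rone = e\<rparr> X T f \<^bold>\<longrightarrow>
      U_aleph0_MC \<lparr>rcarr = R, radd = a, rmul = m, rlt = l, rzero = z, rone = e\<rparr> X T f)))"
      using lt multiple_choice_iff by (simp add: holds)
  qed
  show "ZF \<turnstile> sentence (for_the_reals (\<lambda>\<R>. CAC \<^bold>\<longleftrightarrow> (\<^bold>\<forall>X T. discrete_space X T \<^bold>\<longrightarrow>
      (\<^bold>\<forall>f. U_aleph0 \<R> X T f \<^bold>\<longrightarrow> U_aleph0_AC \<R> X T f))))"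
  proof (rule ZF_provesI)
    fix E :: "nat \<Rightarrow> nat \<Rightarrow> bool" and r s :: "nat \<Rightarrow> nat" and R a m l z e :: nat
    assume zr: "zf_reals E (s R) (s a) (s l) (s z)" and lt: "R < 6" "a < 6" "m < 6" "l < 6" "z < 6" "e < 6"
    interpret zf_reals E "s R" "s a" "s l" "s z" by (rule zr)
    show "hold r 6 s (CAC \<^bold>\<longleftrightarrow> (\<^bold>\<forall>X T. discrete_space X T \<^bold>\<longrightarrow> (\<^bold>\<forall>f.
      U_aleph0 \<lparr>rcarr = R, radd = a, rmul = m, rlt = l, rzero = z, rone = e\<rparr> X T f \<^bold>\<longrightarrow>
      U_aleph0_AC \<lparr>rcarr = R, radd = a, rmul = m, rlt = l, rzero = z, rone = e\<rparr> X T f)))"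
      using lt choice_iff by (simp add: holds)
  qed
qed

end
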